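(* Let $(R,\mathfrak{m},k)$ be a Noetherian local ring, let $x$ be a Conca generator of $\mathfrak{m}$ (that is, $x\in\mathfrak{m}$, $x\neq 0$, $x^{2}=0$ and $x\mathfrak{m}=\mathfrak{m}^{2}$), and let $M$ be a finitely generated $R$-module. Then the following hold. (1) $M$ is a Koszul $R$-module if $xM=0$; (2) $\operatorname{reg}_{R}(M)\leq 1$; (3) $\mathfrak{m}M$ is a Koszul $R$-module; (4) for every proper ideal $I$ of $R$ the quotient ring $R/I$ is a Koszul ring.
   Context: All rings are commutative Noetherian and all modules are finitely generated. Associated graded objects: for a local ring $(R,\mathfrak{m},k)$ and an $R$-module $M$, $R^{g}=\bigoplus_{i\ge 0}\mathfrak{m}^{i}/\mathfrak{m}^{i+1}$, a standard graded $k$-algebra, and $M^{g}=\bigoplus_{i\ge 0}\mathfrak{m}^{i}M/\mathfrak{m}^{i+1}M$, a graded $R^{g}$-module. Linear part: a complex of $R$-modules $\mathbf{C}$ with differential $\partial$ is minimal if $\partial_n(C_n)\subseteq\mathfrak{m}C_{n-1}$ for all $n$. For a minimal complex $\mathbf{C}$, define subcomplexes $\mathcal{F}^{i}\mathbf{C}$ ($i\geq 0$) by $(\mathcal{F}^{i}\mathbf{C})_{n}=\mathfrak{m}^{i-n}C_{n}$, where $\mathfrak{m}^{j}=R$ for $j\le 0$. The associated graded complex of this filtration is denoted $\operatorname{lin}^{R}(\mathbf{C})$; it is a complex of graded $R^{g}$-modules with $\operatorname{lin}^{R}(\mathbf{C})_n=C_n^{g}(-n)$. Koszul: an $R$-module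 $M$ with minimal free resolution $\mathbf{F}$ is Koszul if $H_i(\operatorname{lin}^{R}(\mathbf{F}))=0$ for all $i>0$. The local ring $R$ is a Koszul ring if its residue field $k$ is a Koszul $R$-module. Regularity: for a standard graded $k$-algebra $A$ and a finitely generated graded $A$-module $N$, $\operatorname{reg}_A(N)=\sup\{j-i : i\ge 0,\ j\in\mathbb{Z},\ \operatorname{Tor}^{A}_i(N,k)_j\neq 0\}$ (with $\sup\emptyset=-\infty$). For a local ring $R$ and an $R$-module $M$, $\operatorname{reg}_R(M):=\operatorname{reg}_{R^{g}}(M^{g})$. *)

theory Defs
  imports "HOL-Library.Extended_Real" "HOL-Algebra.Module" "HOL-Algebra.Ideal_Product" "HOL-Algebra.QuotRing" "HOL-Algebra.Ring_Divisibility"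
begin

section \<open>Local rings and finitely generated modules\<close>

definition local_noetherian_ring :: "('a, 'r) ring_scheme \<Rightarrow> bool" where
  "local_noetherian_ring R \<longleftrightarrow>
     cring R \<and> noetherian_ring R \<and> (\<exists>!\<mm>. maximalideal \<mm> R)"

definition max_ideal :: "('a, 'r) ring_scheme \<Rightarrow> 'a set" where
  "max_ideal R = (THE \<mm>. maximalideal \<mm> R)"

primrec ideal_power :: "('a, 'r) ring_scheme \<Rightarrow> 'a set \<Rightarrow> nat \<Rightarrow> 'a set" where
  "ideal_power R I 0 = carrier R"
| "ideal_power R I (Suc n) = I \<cdot>\<^bsub>R\<^esub> ideal_power R I n"

definition span_of ::
  "('a, 'r) ring_scheme \<Rightarrow> ('a, 'b, 'm) module_scheme \<Rightarrow> 'b set \<Rightarrow> 'b set" where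
  "span_of R M S = \<Inter>{H. submodule H R M \<and> S \<subseteq> H}"

definition fg_module :: "('a, 'r) ring_scheme \<Rightarrow> ('a, 'b, 'm) module_scheme \<Rightarrow> bool" where
  "fg_module R M \<longleftrightarrow>
     module R M \<and> (\<exists>S \<subseteq> carrier M. finite S \<and> span_of R M S = carrier M)"

definition ideal_smult ::
  "('a, 'r) ring_scheme \<Rightarrow> 'a set \<Rightarrow> ('a, 'b, 'm) module_scheme \<Rightarrow> 'b set" where
  "ideal_smult R I M = span_of R M {a \<odot>\<^bsub>M\<^esub> v | a v. a \<in> I \<and> v \<in> carrier M}"

definition conca_generator :: "('a, 'r) ring_scheme \<Rightarrow> 'a \<Rightarrow> bool" where
  "conca_generator R x \<longleftrightarrow>
     x \<in> max_ideal R \<and> x \<noteq> \<zero>\<^bsub>R\<^esub> \<and> x [^]\<^bsub>R\<^esub> (2::nat) = \<zero>\<^bsub>R\<^esub> \<and>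
     {x \<otimes>\<^bsub>R\<^esub> a | a. a \<in> max_ideal R} = ideal_power R (max_ideal R) 2"


section \<open>Module constructions\<close>

text \<open>The record of modules extends the record of rings; its fields \<open>mult\<close> and \<open>one\<close> play no role
  in the notion of a module and are left unspecified in the constructions below.\<close>

definition ring_module :: "('a, 'r) ring_scheme \<Rightarrow> ('a, 'a) module" where
  "ring_module R =
     \<lparr>carrier = carrier R, monoid.mult = undefined, one = undefined,
      zero = \<zero>\<^bsub>R\<^esub>, add = (\<oplus>\<^bsub>R\<^esub>), smult = (\<otimes>\<^bsub>R\<^esub>)\<rparr>"

definition quot_module ::
  "('a, 'b, 'm) module_scheme \<Rightarrow> 'b set \<Rightarrow> ('a, 'b set) module" where
  "quot_module M K =
     \<lparr>carrier = a_rcosets\<^bsub>M\<^esub> K, monoid.mult = undefined, one = undefined,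
      zero = K, add = set_add M,
      smult = (\<lambda>a X. \<Union>v\<in>X. K +>\<^bsub>M\<^esub> (a \<odot>\<^bsub>M\<^esub> v))\<rparr>"

text \<open>The map \<open>M'/K' \<rightarrow> M/K\<close> induced by \<open>f : M' \<rightarrow> M\<close> with \<open>f K' \<subseteq> K\<close>.\<close>

definition quot_map ::
  "('a, 'b, 'm) module_scheme \<Rightarrow> 'b set \<Rightarrow> ('c \<Rightarrow> 'b) \<Rightarrow> 'c set \<Rightarrow> 'b set" where
  "quot_map M K f X = (\<Union>v\<in>X. K +>\<^bsub>M\<^esub> f v)"

text \<open>The free module \<open>R\<^sup>n\<close>; vectors are indexed by \<open>{..<n}\<close> and vanish outside.\<close>

definition free_module :: "('a, 'r) ring_scheme \<Rightarrow> nat \<Rightarrow> ('a, nat \<Rightarrow> 'a) module" where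
  "free_module R n =
     \<lparr>carrier = {v. (\<forall>i. v i \<in> carrier R) \<and> (\<forall>i\<ge>n. v i = \<zero>\<^bsub>R\<^esub>)},
      monoid.mult = undefined, one = undefined,
      zero = (\<lambda>_. \<zero>\<^bsub>R\<^esub>), add = (\<lambda>v w i. v i \<oplus>\<^bsub>R\<^esub> w i),
      smult = (\<lambda>a v i. a \<otimes>\<^bsub>R\<^esub> v i)\<rparr>"

definition module_hom ::
  "('a, 'r) ring_scheme \<Rightarrow> ('a, 'b, 'm) module_scheme \<Rightarrow> ('a, 'c, 'n) module_scheme
     \<Rightarrow> ('b \<Rightarrow> 'c) set" where
  "module_hom R M N =
     {f. f \<in> carrier M \<rightarrow> carrier N \<and>
         (\<forall>v\<in>carrier M. \<forall>w\<in>carrier M. f (v \<oplus>\<^bsub>M\<^esub> w) = f v \<oplus>\<^bsub>N\<^esub> f w) \<and>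
         (\<forall>a\<in>carrier R. \<forall>v\<in>carrier M. f (a \<odot>\<^bsub>M\<^esub> v) = a \<odot>\<^bsub>N\<^esub> f v)}"


section \<open>Complexes and resolutions\<close>

text \<open>A complex is given by modules \<open>C n\<close> and differentials \<open>d n : C (Suc n) \<rightarrow> C n\<close>,
  for \<open>n \<ge> 0\<close>; it is zero in negative homological degrees.\<close>

definition cycles ::
  "(nat \<Rightarrow> ('a, 'b, 'm) module_scheme) \<Rightarrow> (nat \<Rightarrow> 'b \<Rightarrow> 'b) \<Rightarrow> nat \<Rightarrow> 'b set" where
  "cycles C d n =
     (case n of 0 \<Rightarrow> carrier (C 0)
      | Suc p \<Rightarrow> {v \<in> carrier (C (Suc p)). d p v = \<zero>\<^bsub>C p\<^esub>})"

definition boundaries ::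
  "(nat \<Rightarrow> ('a, 'b, 'm) module_scheme) \<Rightarrow> (nat \<Rightarrow> 'b \<Rightarrow> 'b) \<Rightarrow> nat \<Rightarrow> 'b set" where
  "boundaries C d n = d n ` carrier (C (Suc n))"

definition homology ::
  "(nat \<Rightarrow> ('a, 'b, 'm) module_scheme) \<Rightarrow> (nat \<Rightarrow> 'b \<Rightarrow> 'b) \<Rightarrow> nat \<Rightarrow> ('a, 'b set) module"
  where
  "homology C d n = quot_module ((C n)\<lparr>carrier := cycles C d n\<rparr>) (boundaries C d n)"

text \<open>Resolutions of \<open>M\<close> by finitely generated free modules, with ranks \<open>b\<close>, differentials \<open>d\<close>
  and augmentation \<open>\<epsilon> : F\<^sub>0 \<rightarrow> M\<close>.\<close>

definition free_resolution ::
  "('a, 'r) ring_scheme \<Rightarrow> ('a, 'b, 'm) module_scheme \<Rightarrow> (nat \<Rightarrow> nat)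
     \<Rightarrow> (nat \<Rightarrow> (nat \<Rightarrow> 'a) \<Rightarrow> (nat \<Rightarrow> 'a)) \<Rightarrow> ((nat \<Rightarrow> 'a) \<Rightarrow> 'b) \<Rightarrow> bool" where
  "free_resolution R M b d \<epsilon> \<longleftrightarrow>
     (\<forall>n. d n \<in> module_hom R (free_module R (b (Suc n))) (free_module R (b n))) \<and>
     \<epsilon> \<in> module_hom R (free_module R (b 0)) M \<and>
     \<epsilon> ` carrier (free_module R (b 0)) = carrier M \<and>
     {v \<in> carrier (free_module R (b 0)). \<epsilon> v = \<zero>\<^bsub>M\<^esub>} = d 0 ` carrier (free_module R (b 1)) \<and>
     (\<forall>n. {v \<in> carrier (free_module R (b (Suc n))). d n v = \<zero>\<^bsub>free_module R (b n)\<^esub>}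
            = d (Suc n) ` carrier (free_module R (b (Suc (Suc n)))))"

definition minimal_complex ::
  "('a, 'r) ring_scheme \<Rightarrow> (nat \<Rightarrow> ('a, 'b, 'm) module_scheme) \<Rightarrow> (nat \<Rightarrow> 'b \<Rightarrow> 'b) \<Rightarrow> bool"
  where
  "minimal_complex R C d \<longleftrightarrow>
     (\<forall>n. d n ` carrier (C (Suc n)) \<subseteq> ideal_smult R (max_ideal R) (C n))"

definition minimal_free_resolution ::
  "('a, 'r) ring_scheme \<Rightarrow> ('a, 'b, 'm) module_scheme \<Rightarrow> (nat \<Rightarrow> nat)
     \<Rightarrow> (nat \<Rightarrow> (nat \<Rightarrow> 'a) \<Rightarrow> (nat \<Rightarrow> 'a)) \<Rightarrow> ((nat \<Rightarrow> 'a) \<Rightarrow> 'b) \<Rightarrow> bool" where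
  "minimal_free_resolution R M b d \<epsilon> \<longleftrightarrow>
     free_resolution R M b d \<epsilon> \<and> minimal_complex R (\<lambda>n. free_module R (b n)) d"


section \<open>Associated graded objects\<close>

text \<open>For a descending filtration \<open>E\<close> of \<open>M\<close> with \<open>\<mm>\<^sup>j E\<^sub>l \<subseteq> E\<^sub>j\<^sub>+\<^sub>l\<close>, the associated graded
  module \<open>\<Oplus>\<^sub>i E\<^sub>i/E\<^sub>i\<^sub>+\<^sub>1\<close> is realised as the finitely supported sequences of cosets. Its scalars are
  the elements \<open>r\<close> of \<open>\<Oplus>\<^sub>j \<mm>\<^sup>j/\<mm>\<^sup>j\<^sup>+\<^sup>1\<close>, acting by convolution.\<close>

definition gr_piece ::
  "('a, 'b, 'm) module_scheme \<Rightarrow> (nat \<Rightarrow> 'b set) \<Rightarrow> nat \<Rightarrow> ('a, 'b set) module" where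
  "gr_piece M E i = quot_module (M\<lparr>carrier := E i\<rparr>) (E (Suc i))"

definition assoc_gr ::
  "('a, 'b, 'm) module_scheme \<Rightarrow> (nat \<Rightarrow> 'b set) \<Rightarrow> (nat \<Rightarrow> 'a set, nat \<Rightarrow> 'b set) module"
  where
  "assoc_gr M E =
     \<lparr>carrier = {f. (\<forall>i. f i \<in> carrier (gr_piece M E i)) \<and>
                    finite {i. f i \<noteq> \<zero>\<^bsub>gr_piece M E i\<^esub>}},
      monoid.mult = undefined, one = undefined,
      zero = (\<lambda>i. \<zero>\<^bsub>gr_piece M E i\<^esub>),
      add = (\<lambda>f g i. f i \<oplus>\<^bsub>gr_piece M E i\<^esub> g i),
      smult = (\<lambda>r f i. \<Oplus>\<^bsub>gr_piece M E i\<^esub> j\<in>{..i}.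
                 (\<Union>a\<in>r j. \<Union>v\<in>f (i - j). E (Suc i) +>\<^bsub>M\<^esub> (a \<odot>\<^bsub>M\<^esub> v)))\<rparr>"

definition gr_component ::
  "('a, 'b, 'm) module_scheme \<Rightarrow> (nat \<Rightarrow> 'b set) \<Rightarrow> int \<Rightarrow> (nat \<Rightarrow> 'b set) set" where
  "gr_component M E j =
     {f \<in> carrier (assoc_gr M E). \<forall>l. int l \<noteq> j \<longrightarrow> f l = \<zero>\<^bsub>gr_piece M E l\<^esub>}"

definition adic_filtration ::
  "('a, 'r) ring_scheme \<Rightarrow> ('a, 'b, 'm) module_scheme \<Rightarrow> nat \<Rightarrow> 'b set" where
  "adic_filtration R M i = ideal_smult R (ideal_power R (max_ideal R) i) M"

text \<open>\<open>R\<^sup>g\<close> and \<open>M\<^sup>g\<close>, with their gradings. The product of \<open>R\<^sup>g\<close> is its action on itself.\<close>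

definition gr_ring :: "('a, 'r) ring_scheme \<Rightarrow> (nat \<Rightarrow> 'a set) ring" where
  "gr_ring R =
     (let E = ideal_power R (max_ideal R); G = assoc_gr (ring_module R) E in
      \<lparr>carrier = carrier G, monoid.mult = (\<odot>\<^bsub>G\<^esub>),
       one = (\<lambda>i. if i = 0 then E 1 +>\<^bsub>R\<^esub> \<one>\<^bsub>R\<^esub> else E (Suc i)),
       zero = \<zero>\<^bsub>G\<^esub>, add = (\<oplus>\<^bsub>G\<^esub>)\<rparr>)"

definition gr_ring_component :: "('a, 'r) ring_scheme \<Rightarrow> int \<Rightarrow> (nat \<Rightarrow> 'a set) set" where
  "gr_ring_component R = gr_component (ring_module R) (ideal_power R (max_ideal R))"

definition gr_module ::
  "('a, 'r) ring_scheme \<Rightarrow> ('a, 'b, 'm) module_scheme \<Rightarrow> (nat \<Rightarrow> 'a set, nat \<Rightarrow> 'b set) module"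
  where
  "gr_module R M = assoc_gr M (adic_filtration R M)"

definition gr_module_component ::
  "('a, 'r) ring_scheme \<Rightarrow> ('a, 'b, 'm) module_scheme \<Rightarrow> int \<Rightarrow> (nat \<Rightarrow> 'b set) set" where
  "gr_module_component R M = gr_component M (adic_filtration R M)"


section \<open>Linear part and Koszul modules\<close>

text \<open>Truncated subtraction matches the convention \<open>\<mm>\<^sup>j = R\<close> for \<open>j \<le> 0\<close>.\<close>

definition lin_filtration ::
  "('a, 'r) ring_scheme \<Rightarrow> (nat \<Rightarrow> ('a, 'b, 'm) module_scheme) \<Rightarrow> nat \<Rightarrow> nat \<Rightarrow> 'b set" where
  "lin_filtration R C n i = ideal_smult R (ideal_power R (max_ideal R) (i - n)) (C n)"

definition lin_module ::
  "('a, 'r) ring_scheme \<Rightarrow> (nat \<Rightarrow> ('a, 'b, 'm) module_scheme) \<Rightarrow> nat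
     \<Rightarrow> (nat \<Rightarrow> 'a set, nat \<Rightarrow> 'b set) module" where
  "lin_module R C n = assoc_gr (C n) (lin_filtration R C n)"

definition lin_diff ::
  "('a, 'r) ring_scheme \<Rightarrow> (nat \<Rightarrow> ('a, 'b, 'm) module_scheme) \<Rightarrow> (nat \<Rightarrow> 'b \<Rightarrow> 'b) \<Rightarrow> nat
     \<Rightarrow> (nat \<Rightarrow> 'b set) \<Rightarrow> (nat \<Rightarrow> 'b set)" where
  "lin_diff R C d n f = (\<lambda>i. quot_map (C n) (lin_filtration R C n (Suc i)) (d n) (f i))"

text \<open>Minimal free resolutions exist and are unique up to isomorphism of complexes, so it is
  immaterial which one is used.\<close>

definition koszul_module :: "('a, 'r) ring_scheme \<Rightarrow> ('a, 'b, 'm) module_scheme \<Rightarrow> bool" where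
  "koszul_module R M \<longleftrightarrow>
     (\<exists>b d \<epsilon>. minimal_free_resolution R M b d \<epsilon> \<and>
        (let F = (\<lambda>n. free_module R (b n));
             H = homology (lin_module R F) (lin_diff R F d)
         in \<forall>i>0. carrier (H i) = {\<zero>\<^bsub>H i\<^esub>}))"

definition residue_module :: "('a, 'r) ring_scheme \<Rightarrow> ('a, 'a set) module" where
  "residue_module R = quot_module (ring_module R) (max_ideal R)"

definition koszul_ring :: "('a, 'r) ring_scheme \<Rightarrow> bool" where
  "koszul_ring R \<longleftrightarrow> local_noetherian_ring R \<and> koszul_module R (residue_module R)"


section \<open>Graded Tor and regularity\<close>

text \<open>Here \<open>A\<close> is a standard graded algebra over a field \<open>k\<close> with components \<open>AG j\<close>, and \<open>N\<close> is a
  finitely generated graded \<open>A\<close>-module with components \<open>NG j\<close>. The set \<open>shifted_free A AG b a j\<close> is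
  the degree \<open>j\<close> component of the free module \<open>\<Oplus>\<^sub>s\<^sub><\<^sub>b A(-a\<^sub>s)\<close>.\<close>

definition shifted_free ::
  "('c, 'r) ring_scheme \<Rightarrow> (int \<Rightarrow> 'c set) \<Rightarrow> nat \<Rightarrow> (nat \<Rightarrow> int) \<Rightarrow> int \<Rightarrow> (nat \<Rightarrow> 'c) set" where
  "shifted_free A AG b a j = {v \<in> carrier (free_module A b). \<forall>s<b. v s \<in> AG (j - a s)}"

type_synonym ('c, 'd) graded_res =
  "(nat \<Rightarrow> nat) \<times> (nat \<Rightarrow> nat \<Rightarrow> int) \<times> (nat \<Rightarrow> (nat \<Rightarrow> 'c) \<Rightarrow> (nat \<Rightarrow> 'c)) \<times> ((nat \<Rightarrow> 'c) \<Rightarrow> 'd)"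

fun graded_free_resolution ::
  "('c, 'r) ring_scheme \<Rightarrow> (int \<Rightarrow> 'c set) \<Rightarrow> ('c, 'd, 'm) module_scheme \<Rightarrow> (int \<Rightarrow> 'd set)
     \<Rightarrow> ('c, 'd) graded_res \<Rightarrow> bool" where
  "graded_free_resolution A AG N NG (b, a, d, \<epsilon>) \<longleftrightarrow>
     free_resolution A N b d \<epsilon> \<and>
     (\<forall>n j. d n ` shifted_free A AG (b (Suc n)) (a (Suc n)) j \<subseteq> shifted_free A AG (b n) (a n) j) \<and>
     (\<forall>j. \<epsilon> ` shifted_free A AG (b 0) (a 0) j \<subseteq> NG j)"

text \<open>Since \<open>k = A/A\<^sub>+\<close>, the tensor product \<open>F \<otimes>\<^sub>A k\<close> is \<open>F/A\<^sub>+F\<close>.\<close>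

definition irrelevant_ideal :: "('c, 'r) ring_scheme \<Rightarrow> (int \<Rightarrow> 'c set) \<Rightarrow> 'c set" where
  "irrelevant_ideal A AG = Idl\<^bsub>A\<^esub> (\<Union>j\<in>{0<..}. AG j)"

definition tensor_k ::
  "('c, 'r) ring_scheme \<Rightarrow> (int \<Rightarrow> 'c set) \<Rightarrow> ('c, 'e, 'm) module_scheme \<Rightarrow> ('c, 'e set) module"
  where
  "tensor_k A AG F = quot_module F (ideal_smult A (irrelevant_ideal A AG) F)"

definition tensor_k_map ::
  "('c, 'r) ring_scheme \<Rightarrow> (int \<Rightarrow> 'c set) \<Rightarrow> ('c, 'e, 'm) module_scheme
     \<Rightarrow> ('f \<Rightarrow> 'e) \<Rightarrow> 'f set \<Rightarrow> 'e set" where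
  "tensor_k_map A AG F g = quot_map F (ideal_smult A (irrelevant_ideal A AG) F) g"

text \<open>\<open>Tor\<^sub>i\<^sup>A(N,k)\<close> is computed from some graded free resolution of \<open>N\<close> by finitely generated free
  modules (different ones give isomorphic graded modules); its component of degree \<open>j\<close> consists of
  the classes of the cycles of degree \<open>j\<close>.\<close>

definition chosen_resolution ::
  "('c, 'r) ring_scheme \<Rightarrow> (int \<Rightarrow> 'c set) \<Rightarrow> ('c, 'd, 'm) module_scheme \<Rightarrow> (int \<Rightarrow> 'd set)
     \<Rightarrow> ('c, 'd) graded_res" where
  "chosen_resolution A AG N NG = (SOME F. graded_free_resolution A AG N NG F)"

definition tor_complex ::
  "('c, 'r) ring_scheme \<Rightarrow> (int \<Rightarrow> 'c set) \<Rightarrow> ('c, 'd, 'm) module_scheme \<Rightarrow> (int \<Rightarrow> 'd set)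
     \<Rightarrow> nat \<Rightarrow> ('c, (nat \<Rightarrow> 'c) set) module" where
  "tor_complex A AG N NG n =
     (case chosen_resolution A AG N NG of (b, a, d, \<epsilon>) \<Rightarrow>
        tensor_k A AG (free_module A (b n)))"

definition tor_diff ::
  "('c, 'r) ring_scheme \<Rightarrow> (int \<Rightarrow> 'c set) \<Rightarrow> ('c, 'd, 'm) module_scheme \<Rightarrow> (int \<Rightarrow> 'd set)
     \<Rightarrow> nat \<Rightarrow> (nat \<Rightarrow> 'c) set \<Rightarrow> (nat \<Rightarrow> 'c) set" where
  "tor_diff A AG N NG n =
     (case chosen_resolution A AG N NG of (b, a, d, \<epsilon>) \<Rightarrow>
        tensor_k_map A AG (free_module A (b n)) (d n))"

definition tor_complex_component ::
  "('c, 'r) ring_scheme \<Rightarrow> (int \<Rightarrow> 'c set) \<Rightarrow> ('c, 'd, 'm) module_scheme \<Rightarrow> (int \<Rightarrow> 'd set)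
     \<Rightarrow> nat \<Rightarrow> int \<Rightarrow> (nat \<Rightarrow> 'c) set set" where
  "tor_complex_component A AG N NG n j =
     (case chosen_resolution A AG N NG of (b, a, d, \<epsilon>) \<Rightarrow>
        (let F = free_module A (b n); K = ideal_smult A (irrelevant_ideal A AG) F
         in (\<lambda>v. K +>\<^bsub>F\<^esub> v) ` shifted_free A AG (b n) (a n) j))"

definition Tor ::
  "('c, 'r) ring_scheme \<Rightarrow> (int \<Rightarrow> 'c set) \<Rightarrow> ('c, 'd, 'm) module_scheme \<Rightarrow> (int \<Rightarrow> 'd set)
     \<Rightarrow> nat \<Rightarrow> ('c, (nat \<Rightarrow> 'c) set set) module" where
  "Tor A AG N NG i = homology (tor_complex A AG N NG) (tor_diff A AG N NG) i"

definition Tor_component ::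
  "('c, 'r) ring_scheme \<Rightarrow> (int \<Rightarrow> 'c set) \<Rightarrow> ('c, 'd, 'm) module_scheme \<Rightarrow> (int \<Rightarrow> 'd set)
     \<Rightarrow> nat \<Rightarrow> int \<Rightarrow> (nat \<Rightarrow> 'c) set set set" where
  "Tor_component A AG N NG i j =
     (let C = tor_complex A AG N NG; d = tor_diff A AG N NG
      in (\<lambda>X. boundaries C d i +>\<^bsub>C i\<^esub> X) `
           (cycles C d i \<inter> tor_complex_component A AG N NG i j))"

definition graded_regularity ::
  "('c, 'r) ring_scheme \<Rightarrow> (int \<Rightarrow> 'c set) \<Rightarrow> ('c, 'd, 'm) module_scheme \<Rightarrow> (int \<Rightarrow> 'd set)
     \<Rightarrow> ereal" where
  "graded_regularity A AG N NG =
     Sup {ereal (real_of_int (j - int i)) | i j.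
            Tor_component A AG N NG i j \<noteq> {\<zero>\<^bsub>Tor A AG N NG i\<^esub>}}"

definition regularity :: "('a, 'r) ring_scheme \<Rightarrow> ('a, 'b, 'm) module_scheme \<Rightarrow> ereal" where
  "regularity R M =
     graded_regularity (gr_ring R) (gr_ring_component R) (gr_module R M) (gr_module_component R M)"

end

theory Submission
  imports Defs
begin

text \<open>
  Let \<open>x\<close> be a Conca generator of the maximal ideal \<open>\<mm>\<close>. From \<open>\<mm>\<^sup>2 = x\<mm>\<close> and \<open>x\<^sup>2 = 0\<close> one gets
  \<open>\<mm>\<^sup>3 = x\<^sup>2\<mm> = 0\<close>. Because of this, a minimal free resolution \<open>F\<close> with syzygies
  \<open>Z\<^sub>n \<subseteq> \<mm>F\<^sub>n\<close> has an exact linear part in positive degrees as soon as \<open>\<mm>\<^sup>2F\<^sub>n \<subseteq> \<mm>Z\<^sub>n\<close> for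
  all \<open>n\<close> (\<open>koszul_moduleI\<close>).

  To obtain these inclusions, consider the modules \<open>N\<close> that have a submodule \<open>L\<close> with
  \<open>xL = 0\<close> and \<open>\<mm>N \<subseteq> xN + \<mm>L\<close> (\<open>conca_filtered\<close>). Let \<open>Z\<close> be the kernel of a minimal cover
  \<open>F \<rightarrow> N\<close> and \<open>P\<close> the preimage of \<open>L\<close>. Then \<open>\<mm>F \<subseteq> Z + xF + \<mm>P\<close>, and multiplication by \<open>x\<close> gives
  \<open>\<mm>\<^sup>2F = x\<mm>F \<subseteq> xZ + \<mm>(xP)\<close>. Since \<open>xP \<subseteq> Z\<close>, this lies in \<open>\<mm>Z\<close>; and since
  \<open>\<mm>Z \<subseteq> \<mm>\<^sup>2F\<close>, the module \<open>Z\<close> has the same property with \<open>xP\<close> in place of \<open>L\<close>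
  (\<open>kernel_syzygy_class\<close>). By induction all syzygies satisfy the inclusion, so every such \<open>N\<close> is
  Koszul. A module with \<open>xN = 0\<close> qualifies with \<open>L = N\<close>, and \<open>\<mm>N\<close> qualifies with \<open>L = 0\<close>
  because \<open>\<mm>(\<mm>N) = x(\<mm>N)\<close>. The argument applies equally to a quotient \<open>R/I\<close> with the image
  of \<open>x\<close>, possibly zero, and to its residue field, which is annihilated by that image.

  For the regularity, let \<open>A = R\<^sup>g\<close> and let \<open>N = M\<^sup>g\<close>. Writing again \<open>x\<close> for the class of
  \<open>x\<close> in \<open>A\<^sub>1\<close>, one has \<open>x\<^sup>2 = 0\<close>, \<open>A\<^sub>j = xA\<^sub>j\<^sub>-\<^sub>1\<close> and \<open>N\<^sub>j = xN\<^sub>j\<^sub>-\<^sub>1\<close> for \<open>j \<ge> 2\<close>, and \<open>N\<close> is generated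
  in degree \<open>0\<close>. If \<open>G \<rightarrow> N\<close> is a cover with generators of degree at most \<open>1\<close> and \<open>Z\<close> is its kernel,
  then \<open>G\<^sub>j = xG\<^sub>j\<^sub>-\<^sub>1\<close> and \<open>G\<^sub>j\<^sub>-\<^sub>1 \<subseteq> Z + xG\<^sub>j\<^sub>-\<^sub>2\<close> for \<open>j \<ge> 3\<close>, whence \<open>Z\<^sub>j = xZ\<^sub>j\<^sub>-\<^sub>1\<close>: the kernel is
  generated in degrees at most \<open>2\<close> and the situation repeats with all degrees raised by one. So
  there is a graded free resolution whose \<open>n\<close>-th module has generators of degree at most \<open>n + 1\<close>
  (\<open>syzygy_invariant_cover\<close>). Comparing chain complexes then
  bounds Tor computed from any other graded free resolution (\<open>graded_regularity_le\<close>).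
\<close>

section \<open>Spans and homomorphisms\<close>

context module
begin

lemma submoduleI':
  assumes "H \<subseteq> carrier M" "\<zero>\<^bsub>M\<^esub> \<in> H"
    and "\<And>v w. v \<in> H \<Longrightarrow> w \<in> H \<Longrightarrow> v \<oplus>\<^bsub>M\<^esub> w \<in> H"
    and smult: "\<And>a v. a \<in> carrier R \<Longrightarrow> v \<in> H \<Longrightarrow> a \<odot>\<^bsub>M\<^esub> v \<in> H"
  shows "submodule H R M"
proof (rule submoduleI)
  fix v assume "v \<in> H"
  then have "(\<ominus> \<one>) \<odot>\<^bsub>M\<^esub> v \<in> H" "v \<in> carrier M"
    using assms by auto
  then show "\<ominus>\<^bsub>M\<^esub> v \<in> H"
    by (simp add: smult_l_minus)
qed (use assms in auto)

lemma submoduleD: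
  assumes "submodule H R M"
  shows "H \<subseteq> carrier M" "\<zero>\<^bsub>M\<^esub> \<in> H"
    and "\<And>v w. v \<in> H \<Longrightarrow> w \<in> H \<Longrightarrow> v \<oplus>\<^bsub>M\<^esub> w \<in> H"
    and "\<And>v w. v \<in> H \<Longrightarrow> w \<in> H \<Longrightarrow> v \<ominus>\<^bsub>M\<^esub> w \<in> H"
    and "\<And>a v. a \<in> carrier R \<Longrightarrow> v \<in> H \<Longrightarrow> a \<odot>\<^bsub>M\<^esub> v \<in> H"
    and "\<And>v. v \<in> H \<Longrightarrow> v \<in> carrier M"
    and "subgroup H (add_monoid M)"
  using submoduleE[OF assms] submodule.axioms(1)[OF assms] subgroup.one_closed[of H "add_monoid M"]
  by (auto simp: a_minus_def)

lemma zero_submodule: "submodule {\<zero>\<^bsub>M\<^esub>} R M"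
  by (rule submoduleI') auto

lemma span_of_submodule:
  assumes "S \<subseteq> carrier M"
  shows "submodule (span_of R M S) R M"
proof (rule submoduleI')
  show "span_of R M S \<subseteq> carrier M"
    using carrier_is_submodule assms by (auto simp: span_of_def)
qed (auto simp: span_of_def dest: submoduleD)

lemma span_of_superset: "S \<subseteq> span_of R M S"
  by (auto simp: span_of_def)

lemma span_of_least: "submodule H R M \<Longrightarrow> S \<subseteq> H \<Longrightarrow> span_of R M S \<subseteq> H"
  by (auto simp: span_of_def)

lemma span_of_mono: "S \<subseteq> T \<Longrightarrow> span_of R M S \<subseteq> span_of R M T"
  by (auto simp: span_of_def)

lemma span_of_eq_submodule: "submodule H R M \<Longrightarrow> span_of R M H = H"
  using span_of_least span_of_superset by blast

text \<open>A span is the directed union of the spans of the finite subsets of the generating set, so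
  every generating set of a finitely generated module contains a finite generating set.\<close>

lemma span_of_finite_subset:
  assumes S: "S \<subseteq> carrier M" and T: "finite T" "T \<subseteq> span_of R M S"
  shows "\<exists>S0\<subseteq>S. finite S0 \<and> T \<subseteq> span_of R M S0"
proof -
  define H where "H = \<Union>{span_of R M S0 | S0. S0 \<subseteq> S \<and> finite S0}"
  have HI: "v \<in> H" if "v \<in> span_of R M S0" "S0 \<subseteq> S" "finite S0" for v S0
    using that by (auto simp: H_def)
  have sub: "submodule (span_of R M S0) R M" if "S0 \<subseteq> S" for S0
    using that S span_of_submodule by (meson subset_trans)
  have "submodule H R M"
  proof (rule submoduleI')
    show "H \<subseteq> carrier M" "\<zero>\<^bsub>M\<^esub> \<in> H"
      using submoduleD[OF sub] submoduleD(2)[OF sub[of "{}"]] by (auto simp: H_def)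
    fix v w assume "v \<in> H" "w \<in> H"
    then obtain S1 S2 where 1: "S1 \<subseteq> S" "finite S1" "v \<in> span_of R M S1"
      and 2: "S2 \<subseteq> S" "finite S2" "w \<in> span_of R M S2"
      by (auto simp: H_def)
    then have "v \<in> span_of R M (S1 \<union> S2)" "w \<in> span_of R M (S1 \<union> S2)"
      using span_of_mono[of S1 "S1 \<union> S2"] span_of_mono[of S2 "S1 \<union> S2"] by auto
    then have "v \<oplus>\<^bsub>M\<^esub> w \<in> span_of R M (S1 \<union> S2)"
      using submoduleD(3)[OF sub[of "S1 \<union> S2"]] 1 2 by auto
    then show "v \<oplus>\<^bsub>M\<^esub> w \<in> H"
      using HI[of _ "S1 \<union> S2"] 1 2 by auto
  next
    fix a v assume "a \<in> carrier R" "v \<in> H"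
    then show "a \<odot>\<^bsub>M\<^esub> v \<in> H"
      using submoduleD(5)[OF sub] by (auto simp: H_def)
  qed
  moreover have "S \<subseteq> H"
    using HI[of _ "{_}"] span_of_superset by blast
  ultimately have "T \<subseteq> H"
    using T span_of_least by blast
  then have "\<forall>t\<in>T. \<exists>S0. S0 \<subseteq> S \<and> finite S0 \<and> t \<in> span_of R M S0"
    by (auto simp: H_def)
  then obtain f where f: "\<And>t. t \<in> T \<Longrightarrow> f t \<subseteq> S \<and> finite (f t) \<and> t \<in> span_of R M (f t)"
    by metis
  have "T \<subseteq> span_of R M (\<Union>t\<in>T. f t)"
    using f span_of_mono[of "f _" "\<Union>t\<in>T. f t"] by blast
  then show ?thesis
    using f T(1) by (intro exI[of _ "\<Union>t\<in>T. f t"]) auto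
qed

lemma submodule_module: "submodule K R M \<Longrightarrow> module R (M\<lparr>carrier := K\<rparr>)"
  by (rule submodule.submodule_is_module) (auto intro: module_axioms)

lemma submodule_of_submodule:
  assumes K: "submodule K R M"
  shows "submodule H R (M\<lparr>carrier := K\<rparr>) \<longleftrightarrow> submodule H R M \<and> H \<subseteq> K"
proof -
  interpret K: module R "M\<lparr>carrier := K\<rparr>"
    by (rule submodule_module[OF K])
  show ?thesis
    using submoduleD[of H] K.submoduleD[of H] submoduleD(1)[OF K]
    by (auto 0 3 intro!: submoduleI' K.submoduleI')
qed

lemma span_of_restrict:
  assumes K: "submodule K R M" and S: "S \<subseteq> K"
  shows "span_of R (M\<lparr>carrier := K\<rparr>) S = span_of R M S"
proof -
  have "submodule (span_of R M S) R M" "span_of R M S \<subseteq> K"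
    using span_of_submodule span_of_least K S submoduleD(1)[OF K] by auto
  then show ?thesis
    using submodule_of_submodule[OF K] span_of_superset[of S] span_of_least[of _ S]
    by (auto simp: span_of_def)
qed

text \<open>The submodule usually written \<open>IK\<close>.\<close>

definition smult_span :: "'a set \<Rightarrow> 'c set \<Rightarrow> 'c set" where
  "smult_span I K = span_of R M {a \<odot>\<^bsub>M\<^esub> v | a v. a \<in> I \<and> v \<in> K}"

lemma ideal_smult_eq: "ideal_smult R I M = smult_span I (carrier M)"
  by (simp add: ideal_smult_def smult_span_def)

lemma smult_span_submodule:
  "I \<subseteq> carrier R \<Longrightarrow> K \<subseteq> carrier M \<Longrightarrow> submodule (smult_span I K) R M"
  unfolding smult_span_def by (rule span_of_submodule) auto

lemma smult_span_memI: "a \<in> I \<Longrightarrow> v \<in> K \<Longrightarrow> a \<odot>\<^bsub>M\<^esub> v \<in> smult_span I K"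
  using span_of_superset by (fastforce simp: smult_span_def)

lemma smult_span_least:
  assumes "submodule H R M" "\<And>a v. a \<in> I \<Longrightarrow> v \<in> K \<Longrightarrow> a \<odot>\<^bsub>M\<^esub> v \<in> H"
  shows "smult_span I K \<subseteq> H"
  unfolding smult_span_def using assms by (intro span_of_least) auto

lemma smult_span_mono: "I \<subseteq> I' \<Longrightarrow> K \<subseteq> K' \<Longrightarrow> smult_span I K \<subseteq> smult_span I' K'"
  unfolding smult_span_def by (rule span_of_mono) blast

end

lemma module_homI:
  assumes "\<And>v. v \<in> carrier M \<Longrightarrow> f v \<in> carrier N"
    and "\<And>v w. v \<in> carrier M \<Longrightarrow> w \<in> carrier M \<Longrightarrow> f (v \<oplus>\<^bsub>M\<^esub> w) = f v \<oplus>\<^bsub>N\<^esub> f w"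
    and "\<And>a v. a \<in> carrier R \<Longrightarrow> v \<in> carrier M \<Longrightarrow> f (a \<odot>\<^bsub>M\<^esub> v) = a \<odot>\<^bsub>N\<^esub> f v"
  shows "f \<in> module_hom R M N"
  using assms by (auto simp: module_hom_def)

lemma module_homD:
  assumes "f \<in> module_hom R M N"
  shows "\<And>v. v \<in> carrier M \<Longrightarrow> f v \<in> carrier N"
    and "\<And>v w. v \<in> carrier M \<Longrightarrow> w \<in> carrier M \<Longrightarrow> f (v \<oplus>\<^bsub>M\<^esub> w) = f v \<oplus>\<^bsub>N\<^esub> f w"
    and "\<And>a v. a \<in> carrier R \<Longrightarrow> v \<in> carrier M \<Longrightarrow> f (a \<odot>\<^bsub>M\<^esub> v) = a \<odot>\<^bsub>N\<^esub> f v"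
  using assms by (auto simp: module_hom_def)

locale linear_map = M: module R M + N: module R N
  for R (structure) and M :: "('a, 'b, 'm) module_scheme" and N :: "('a, 'c, 'n) module_scheme" +
  fixes f assumes hom: "f \<in> module_hom R M N"
begin

lemmas closed = module_homD(1)[OF hom] and add = module_homD(2)[OF hom]
  and smult = module_homD(3)[OF hom]

lemma zero: "f \<zero>\<^bsub>M\<^esub> = \<zero>\<^bsub>N\<^esub>"
  using smult[of \<zero> "\<zero>\<^bsub>M\<^esub>"] closed by simp

lemma minus: "v \<in> carrier M \<Longrightarrow> f (\<ominus>\<^bsub>M\<^esub> v) = \<ominus>\<^bsub>N\<^esub> f v"
  using smult[of "\<ominus> \<one>" v] closed by (simp add: M.smult_l_minus N.smult_l_minus)

lemma diff: "v \<in> carrier M \<Longrightarrow> w \<in> carrier M \<Longrightarrow> f (v \<ominus>\<^bsub>M\<^esub> w) = f v \<ominus>\<^bsub>N\<^esub> f w"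
  by (simp add: a_minus_def add minus)

lemma preimage_submodule:
  assumes "submodule H R N" shows "submodule {v \<in> carrier M. f v \<in> H} R M"
  using N.submoduleD[OF assms]
  by (intro M.submoduleI') (auto simp: zero add smult)

lemma kernel_submodule: "submodule {v \<in> carrier M. f v = \<zero>\<^bsub>N\<^esub>} R M"
  using preimage_submodule[OF N.zero_submodule] by simp

lemma image_submodule:
  assumes H: "submodule H R M" shows "submodule (f ` H) R N"
proof (rule N.submoduleI')
  note HD = M.submoduleD[OF H]
  show "f ` H \<subseteq> carrier N" "\<zero>\<^bsub>N\<^esub> \<in> f ` H"
    using HD closed zero[symmetric] by auto
  fix v w assume "v \<in> f ` H" "w \<in> f ` H"
  then show "v \<oplus>\<^bsub>N\<^esub> w \<in> f ` H"
    using HD add by (metis (no_types, lifting) image_iff)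
next
  note HD = M.submoduleD[OF H]
  fix a v assume "a \<in> carrier R" "v \<in> f ` H"
  then show "a \<odot>\<^bsub>N\<^esub> v \<in> f ` H"
    using HD smult by (metis (no_types, lifting) image_iff)
qed

lemma image_span:
  assumes S: "S \<subseteq> carrier M" shows "f ` span_of R M S = span_of R N (f ` S)"
proof
  have "f ` S \<subseteq> carrier N"
    using S closed by auto
  then have "submodule {v \<in> carrier M. f v \<in> span_of R N (f ` S)} R M"
    by (intro preimage_submodule N.span_of_submodule)
  moreover have "S \<subseteq> {v \<in> carrier M. f v \<in> span_of R N (f ` S)}"
    using S N.span_of_superset[of "f ` S"] by auto
  ultimately have "span_of R M S \<subseteq> {v \<in> carrier M. f v \<in> span_of R N (f ` S)}"
    by (rule M.span_of_least)
  then show "f ` span_of R M S \<subseteq> span_of R N (f ` S)"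
    by auto
  show "span_of R N (f ` S) \<subseteq> f ` span_of R M S"
    using M.span_of_superset[of S]
    by (intro N.span_of_least image_submodule M.span_of_submodule S) auto
qed

lemma image_smult_span:
  assumes "I \<subseteq> carrier R" "K \<subseteq> carrier M"
  shows "f ` M.smult_span I K = N.smult_span I (f ` K)"
proof -
  have *: "f ` {a \<odot>\<^bsub>M\<^esub> v | a v. a \<in> I \<and> v \<in> K} = {a \<odot>\<^bsub>N\<^esub> w | a w. a \<in> I \<and> w \<in> f ` K}"
  proof (intro subset_antisym subsetI)
    fix u assume "u \<in> f ` {a \<odot>\<^bsub>M\<^esub> v | a v. a \<in> I \<and> v \<in> K}"
    then obtain a v where "a \<in> I" "v \<in> K" "u = f (a \<odot>\<^bsub>M\<^esub> v)" by auto
    moreover from this have "f (a \<odot>\<^bsub>M\<^esub> v) = a \<odot>\<^bsub>N\<^esub> f v"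
      using assms smult[of a v] by auto
    ultimately show "u \<in> {a \<odot>\<^bsub>N\<^esub> w | a w. a \<in> I \<and> w \<in> f ` K}"
      by blast
  next
    fix u assume "u \<in> {a \<odot>\<^bsub>N\<^esub> w | a w. a \<in> I \<and> w \<in> f ` K}"
    then obtain a v where "a \<in> I" "v \<in> K" "u = a \<odot>\<^bsub>N\<^esub> f v" by auto
    then show "u \<in> f ` {a \<odot>\<^bsub>M\<^esub> v | a v. a \<in> I \<and> v \<in> K}"
      using assms by (intro image_eqI[of _ f "a \<odot>\<^bsub>M\<^esub> v"]) (auto simp: smult subset_iff)
  qed
  have "{a \<odot>\<^bsub>M\<^esub> v | a v. a \<in> I \<and> v \<in> K} \<subseteq> carrier M"
    using assms by auto
  from image_span[OF this] show ?thesis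
    unfolding M.smult_span_def N.smult_span_def * .
qed

end

section \<open>Free modules\<close>

definition unit_vector :: "('a, 'r) ring_scheme \<Rightarrow> nat \<Rightarrow> nat \<Rightarrow> 'a" where
  "unit_vector R s = (\<lambda>i. if i = s then \<one>\<^bsub>R\<^esub> else \<zero>\<^bsub>R\<^esub>)"

text \<open>The linear map \<open>R\<^sup>n \<rightarrow> M\<close> that sends the unit vector with index \<open>s\<close> to \<open>z s\<close>.\<close>

definition free_map ::
  "('a, 'b, 'm) module_scheme \<Rightarrow> nat \<Rightarrow> (nat \<Rightarrow> 'b) \<Rightarrow> (nat \<Rightarrow> 'a) \<Rightarrow> 'b" where
  "free_map M n z v = (\<Oplus>\<^bsub>M\<^esub>s\<in>{..<n}. v s \<odot>\<^bsub>M\<^esub> z s)"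

lemma free_module_simps:
  "\<zero>\<^bsub>free_module R n\<^esub> = (\<lambda>_. \<zero>\<^bsub>R\<^esub>)"
  "v \<oplus>\<^bsub>free_module R n\<^esub> w = (\<lambda>i. v i \<oplus>\<^bsub>R\<^esub> w i)"
  "a \<odot>\<^bsub>free_module R n\<^esub> v = (\<lambda>i. a \<otimes>\<^bsub>R\<^esub> v i)"
  by (simp_all add: free_module_def)

lemma free_module_mem:
  "v \<in> carrier (free_module R n) \<longleftrightarrow> (\<forall>i. v i \<in> carrier R) \<and> (\<forall>i\<ge>n. v i = \<zero>\<^bsub>R\<^esub>)"
  by (simp add: free_module_def)

context cring
begin

lemma free_module_module: "module R (free_module R n)"
proof (rule moduleI)
  show "abelian_group (free_module R n)"
  proof (rule abelian_groupI)
    fix v assume "v \<in> carrier (free_module R n)"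
    then show "\<exists>w\<in>carrier (free_module R n).
        w \<oplus>\<^bsub>free_module R n\<^esub> v = \<zero>\<^bsub>free_module R n\<^esub>"
      by (intro bexI[of _ "\<lambda>i. \<ominus> v i"]) (auto simp: free_module_simps free_module_mem l_neg)
  qed (auto simp: free_module_simps free_module_mem a_ac)
qed (auto simp: free_module_simps free_module_mem l_distr r_distr m_assoc is_cring)

lemma free_module_minus:
  assumes "v \<in> carrier (free_module R n)"
  shows "\<ominus>\<^bsub>free_module R n\<^esub> v = (\<lambda>i. \<ominus> v i)"
proof -
  interpret F: module R "free_module R n" by (rule free_module_module)
  have "\<ominus>\<^bsub>free_module R n\<^esub> v = (\<ominus> \<one>) \<odot>\<^bsub>free_module R n\<^esub> v"
    using assms by (simp add: F.smult_l_minus)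
  then show ?thesis
    using assms by (auto simp: free_module_simps free_module_mem l_minus)
qed

lemma free_module_diff:
  assumes "v \<in> carrier (free_module R n)" "w \<in> carrier (free_module R n)"
  shows "v \<ominus>\<^bsub>free_module R n\<^esub> w = (\<lambda>i. v i \<ominus> w i)"
  using assms by (simp add: a_minus_def free_module_minus free_module_simps)

lemma unit_vector_mem: "s < n \<Longrightarrow> unit_vector R s \<in> carrier (free_module R n)"
  by (auto simp: unit_vector_def free_module_mem)

text \<open>A vector is assembled from multiples of the unit vectors, one coordinate after the other; the
  induction is on the number \<open>k\<close> of coordinates that may be nonzero.\<close>

lemma free_module_generated:
  assumes H: "submodule H R (free_module R n)" and e: "\<And>s. s < n \<Longrightarrow> unit_vector R s \<in> H"
  shows "H = carrier (free_module R n)"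
proof -
  interpret F: module R "free_module R n" by (rule free_module_module)
  note HD = F.submoduleD[OF H, unfolded free_module_simps]
  have "v \<in> H" if "v \<in> carrier (free_module R n)" "\<forall>i\<ge>k. v i = \<zero>" for k v
    using that
  proof (induction k arbitrary: v)
    case 0
    then have "v = (\<lambda>_. \<zero>)" by auto
    then show ?case using HD(2) by simp
  next
    case (Suc k)
    note v = Suc.prems[unfolded free_module_mem]
    have "v(k := \<zero>) \<in> H"
      using v by (intro Suc.IH) (auto simp: free_module_mem not_less_eq_eq[symmetric] le_Suc_eq)
    moreover have "(\<lambda>i. v k \<otimes> unit_vector R k i) \<in> H"
    proof (cases "k < n")
      case True
      then show ?thesis using HD(5)[of "v k" "unit_vector R k"] e[of k] v by auto
    next
      case False
      then have "v k = \<zero>" using v by auto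
      then have "(\<lambda>i. v k \<otimes> unit_vector R k i) = (\<lambda>_. \<zero>)"
        by (auto simp: unit_vector_def)
      then show ?thesis using HD(2) by simp
    qed
    ultimately have "(\<lambda>i. (v(k := \<zero>)) i \<oplus> v k \<otimes> unit_vector R k i) \<in> H"
      by (rule HD(3))
    moreover have "(\<lambda>i. (v(k := \<zero>)) i \<oplus> v k \<otimes> unit_vector R k i) = v"
      using v by (auto simp: unit_vector_def fun_eq_iff)
    ultimately show ?case by simp
  qed
  then show ?thesis
    using HD(1) by (auto simp: free_module_mem)
qed

lemma free_module_span:
  "span_of R (free_module R n) (unit_vector R ` {..<n}) = carrier (free_module R n)"
proof -
  interpret F: module R "free_module R n" by (rule free_module_module)
  show ?thesis
    using F.span_of_superset[of "unit_vector R ` {..<n}"] unit_vector_mem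
    by (intro free_module_generated F.span_of_submodule) auto
qed

text \<open>This description replaces all later computations with spans in \<open>IR\<^sup>n\<close> by computations with
  coordinates. As before, a vector is assembled one coordinate after the other.\<close>

lemma ideal_smult_free_module:
  assumes I: "ideal I R"
  shows "ideal_smult R I (free_module R n) = {v \<in> carrier (free_module R n). \<forall>i. v i \<in> I}"
    (is "?L = ?S")
proof
  interpret F: module R "free_module R n" by (rule free_module_module)
  interpret I: ideal I R by (rule I)
  have IR: "I \<subseteq> carrier R" by (rule I.a_subset)
  note L = F.smult_span_submodule[OF IR subset_refl]
  note LD = F.submoduleD[OF L, folded F.ideal_smult_eq, unfolded free_module_simps]
  show "?L \<subseteq> ?S"
    unfolding F.ideal_smult_eq
    by (intro F.smult_span_least F.submoduleI')
      (use I.I_r_closed I.I_l_closed I.Icarr in \<open>auto simp: free_module_mem free_module_simps\<close>)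
  have "v \<in> ?L" if "v \<in> carrier (free_module R n)" "\<forall>i. v i \<in> I" "\<forall>i\<ge>k. v i = \<zero>" "k \<le> n" for k v
    using that
  proof (induction k arbitrary: v)
    case 0
    then have "v = (\<lambda>_. \<zero>)" by auto
    then show ?case using LD(2) by simp
  next
    case (Suc k)
    note v = Suc.prems[unfolded free_module_mem]
    have "v(k := \<zero>) \<in> ?L"
      using v by (intro Suc.IH) (auto simp: free_module_mem not_less_eq_eq[symmetric] le_Suc_eq)
    moreover have "(\<lambda>i. v k \<otimes> unit_vector R k i) \<in> ?L"
      using F.smult_span_memI[of "v k" I "unit_vector R k"] unit_vector_mem[of k n] v
      by (auto simp: F.ideal_smult_eq free_module_simps)
    ultimately have "(\<lambda>i. (v(k := \<zero>)) i \<oplus> v k \<otimes> unit_vector R k i) \<in> ?L"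
      by (rule LD(3))
    moreover have "(\<lambda>i. (v(k := \<zero>)) i \<oplus> v k \<otimes> unit_vector R k i) = v"
      using v by (auto simp: unit_vector_def fun_eq_iff)
    ultimately show ?case by simp
  qed
  then show "?S \<subseteq> ?L"
    by (auto simp: free_module_mem)
qed

end

context module
begin

lemma free_map_hom:
  assumes z: "\<And>s. s < n \<Longrightarrow> z s \<in> carrier M"
  shows "free_map M n z \<in> module_hom R (free_module R n) M"
proof (rule module_homI)
  fix v w assume v: "v \<in> carrier (free_module R n)" and w: "w \<in> carrier (free_module R n)"
  show "free_map M n z v \<in> carrier M"
    using v z unfolding free_map_def by (intro M.finsum_closed) (auto simp: free_module_mem)
  show "free_map M n z (v \<oplus>\<^bsub>free_module R n\<^esub> w) = free_map M n z v \<oplus>\<^bsub>M\<^esub> free_map M n z w"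
  proof -
    have "free_map M n z (v \<oplus>\<^bsub>free_module R n\<^esub> w)
        = (\<Oplus>\<^bsub>M\<^esub>s\<in>{..<n}. v s \<odot>\<^bsub>M\<^esub> z s \<oplus>\<^bsub>M\<^esub> w s \<odot>\<^bsub>M\<^esub> z s)"
      using v w z unfolding free_map_def free_module_simps
      by (intro M.finsum_cong') (auto simp: free_module_mem smult_l_distr)
    also have "\<dots> = free_map M n z v \<oplus>\<^bsub>M\<^esub> free_map M n z w"
      using v w z unfolding free_map_def
      by (intro M.finsum_addf) (auto simp: free_module_mem)
    finally show ?thesis .
  qed
next
  fix a v assume a: "a \<in> carrier R" and v: "v \<in> carrier (free_module R n)"
  show "free_map M n z (a \<odot>\<^bsub>free_module R n\<^esub> v) = a \<odot>\<^bsub>M\<^esub> free_map M n z v"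
  proof -
    have "free_map M n z (a \<odot>\<^bsub>free_module R n\<^esub> v) = (\<Oplus>\<^bsub>M\<^esub>s\<in>{..<n}. a \<odot>\<^bsub>M\<^esub> (v s \<odot>\<^bsub>M\<^esub> z s))"
      using a v z unfolding free_map_def free_module_simps
      by (intro M.finsum_cong') (auto simp: free_module_mem smult_assoc1)
    also have "\<dots> = a \<odot>\<^bsub>M\<^esub> free_map M n z v"
      using a v z unfolding free_map_def
      by (intro finsum_smult_ldistr[symmetric]) (auto simp: free_module_mem)
    finally show ?thesis .
  qed
qed

lemma free_map_unit_vector:
  assumes z: "\<And>s. s < n \<Longrightarrow> z s \<in> carrier M" and t: "t < n"
  shows "free_map M n z (unit_vector R t) = z t"
proof -
  have "free_map M n z (unit_vector R t) = (\<Oplus>\<^bsub>M\<^esub>s\<in>{..<n}. if s = t then z s else \<zero>\<^bsub>M\<^esub>)"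
    unfolding free_map_def using z by (intro M.finsum_cong') (auto simp: unit_vector_def)
  also have "\<dots> = z t"
    using M.finsum_singleton[of t "{..<n}" z] z t by (simp add: eq_commute)
  finally show ?thesis .
qed

lemma free_linear_map:
  "f \<in> module_hom R (free_module R n) M \<Longrightarrow> linear_map R (free_module R n) M f"
  by (intro linear_map.intro linear_map_axioms.intro R.free_module_module module_axioms)

lemma free_map_image:
  assumes z: "\<And>s. s < n \<Longrightarrow> z s \<in> carrier M"
  shows "free_map M n z ` carrier (free_module R n) = span_of R M (z ` {..<n})"
proof -
  interpret f: linear_map R "free_module R n" M "free_map M n z"
    by (rule free_linear_map[OF free_map_hom[OF z]])
  have "free_map M n z ` carrier (free_module R n)
      = span_of R M (free_map M n z ` unit_vector R ` {..<n})"
    using f.image_span[of "unit_vector R ` {..<n}"] R.unit_vector_mem R.free_module_span by auto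
  also have "free_map M n z ` unit_vector R ` {..<n} = z ` {..<n}"
    using free_map_unit_vector[OF z] by (force simp: image_iff)
  finally show ?thesis .
qed

lemma free_hom_eqI:
  assumes f: "f \<in> module_hom R (free_module R n) M" and g: "g \<in> module_hom R (free_module R n) M"
    and eq: "\<And>s. s < n \<Longrightarrow> f (unit_vector R s) = g (unit_vector R s)"
    and v: "v \<in> carrier (free_module R n)"
  shows "f v = g v"
proof -
  interpret f: linear_map R "free_module R n" M f by (rule free_linear_map[OF f])
  interpret g: linear_map R "free_module R n" M g by (rule free_linear_map[OF g])
  have "submodule {v \<in> carrier (free_module R n). f v = g v} R (free_module R n)"
    by (intro f.M.submoduleI') (auto simp: f.zero g.zero f.add g.add f.smult g.smult)
  from R.free_module_generated[OF this] show ?thesis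
    using eq v R.unit_vector_mem by auto
qed

end

section \<open>Noetherian rings\<close>

lemma (in cring) coordinate_ideal:
  assumes K: "submodule K R (free_module R n)"
  shows "ideal ((\<lambda>v. v i) ` K) R"
proof -
  interpret F: module R "free_module R n" by (rule free_module_module)
  note KD = F.submoduleD[OF K, unfolded free_module_simps]
  define I where "I = (\<lambda>v. v i) ` K"
  have "ideal I R"
  proof (rule idealI)
    show "subgroup I (add_monoid R)"
    proof (rule add.subgroupI)
      show "I \<subseteq> carrier R" "I \<noteq> {}"
        using KD(2,6) by (auto simp: I_def free_module_mem)
      fix a assume "a \<in> I"
      then obtain v where v: "v \<in> K" "a = v i" by (auto simp: I_def)
      have "(\<lambda>i. \<ominus> \<one> \<otimes> v i) \<in> K"
        using KD(5) v by auto
      then have "\<ominus> \<one> \<otimes> v i \<in> I"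
        by (force simp: I_def)
      then show "\<ominus> a \<in> I"
        using v KD(6)[of v] by (simp add: free_module_mem l_minus)
      fix b assume "b \<in> I"
      then obtain w where w: "w \<in> K" "b = w i" by (auto simp: I_def)
      show "a \<oplus> b \<in> I"
        using KD(3)[OF v(1) w(1)] v w by (force simp: I_def)
    qed
    fix a b assume "a \<in> I" and b: "b \<in> carrier R"
    then obtain v where v: "v \<in> K" "a = v i" by (auto simp: I_def)
    show "b \<otimes> a \<in> I"
      using KD(5)[OF b v(1)] v by (force simp: I_def)
    then show "a \<otimes> b \<in> I"
      using b v KD(6)[of v] by (simp add: m_comm free_module_mem)
  qed (rule ring_axioms)
  then show ?thesis
    by (simp add: I_def)
qed

text \<open>Induction on \<open>n\<close>: the last coordinates of the elements of \<open>K\<close> form an ideal, and the elements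
  with vanishing last coordinate form a submodule of \<open>R\<^sup>n\<close>.\<close>

lemma (in cring) noetherian_free_module:
  assumes noeth: "noetherian_ring R" and K: "submodule K R (free_module R n)"
  shows "\<exists>S\<subseteq>K. finite S \<and> span_of R (free_module R n) S = K"
  using K
proof (induction n arbitrary: K)
  case 0
  interpret F: module R "free_module R 0" by (rule free_module_module)
  have "K = {\<lambda>_. \<zero>}"
    using F.submoduleD(1,2)[OF 0] by (auto simp: free_module_mem free_module_simps fun_eq_iff)
  then show ?case
    using F.span_of_eq_submodule[OF 0] by (intro exI[of _ K]) auto
next
  case (Suc n)
  interpret F: module R "free_module R (Suc n)" by (rule free_module_module)
  interpret F': module R "free_module R n" by (rule free_module_module)
  note KD = F.submoduleD[OF Suc.prems, unfolded free_module_simps]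
  define K' where "K' = {v \<in> K. v n = \<zero>}"
  have K'carr: "v \<in> carrier (free_module R n)" if "v \<in> K'" for v
  proof -
    have "v i = \<zero>" if "i \<ge> n" for i
      using that \<open>v \<in> K'\<close> KD(6)[of v] by (cases "i = n") (auto simp: K'_def free_module_mem)
    then show ?thesis
      using \<open>v \<in> K'\<close> KD(6)[of v] by (auto simp: K'_def free_module_mem)
  qed
  have "submodule K' R (free_module R n)"
    using K'carr KD by (intro F'.submoduleI') (auto simp: K'_def free_module_simps)
  from Suc.IH[OF this] obtain S where S: "S \<subseteq> K'" "finite S" "span_of R (free_module R n) S = K'"
    by auto
  define I where "I = (\<lambda>v. v n) ` K"
  have "ideal I R"
    unfolding I_def by (rule coordinate_ideal[OF Suc.prems])
  then obtain T where T: "T \<subseteq> carrier R" "finite T" "I = Idl T"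
    using noetherian_ring.finetely_gen[OF noeth] by auto
  then have "T \<subseteq> I"
    using genideal_self by auto
  then have "\<forall>t\<in>T. \<exists>v\<in>K. t = v n"
    by (auto simp: I_def)
  then obtain g where g: "\<And>t. t \<in> T \<Longrightarrow> g t \<in> K \<and> g t n = t"
    by metis
  let ?W = "S \<union> g ` T"
  have WK: "?W \<subseteq> K"
    using S g by (auto simp: K'_def)
  then have W: "submodule (span_of R (free_module R (Suc n)) ?W) R (free_module R (Suc n))"
    using KD(1) by (intro F.span_of_submodule) auto
  note WD = F.submoduleD[OF W, unfolded free_module_simps]
  have sub: "K' \<subseteq> span_of R (free_module R (Suc n)) ?W"
  proof -
    have "submodule {v \<in> carrier (free_module R n). v \<in> span_of R (free_module R (Suc n)) ?W}
        R (free_module R n)"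
      using WD by (intro F'.submoduleI') (auto simp: free_module_simps free_module_mem)
    moreover have "S \<subseteq> {v \<in> carrier (free_module R n). v \<in> span_of R (free_module R (Suc n)) ?W}"
      using S K'carr F.span_of_superset[of ?W] by auto
    ultimately show ?thesis
      using F'.span_of_least S(3) by blast
  qed
  \<comment> \<open>subtract an element of the span with the same last coordinate\<close>
  have "K \<subseteq> span_of R (free_module R (Suc n)) ?W"
  proof
    fix v assume v: "v \<in> K"
    define J where "J = (\<lambda>v. v n) ` span_of R (free_module R (Suc n)) ?W"
    have "ideal J R"
      unfolding J_def by (rule coordinate_ideal[OF W])
    moreover have "T \<subseteq> J"
    proof
      fix t assume "t \<in> T"
      then show "t \<in> J"
        using g[of t] F.span_of_superset[of ?W] unfolding J_def by (intro image_eqI[of _ _ "g t"]) auto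
    qed
    ultimately have "I \<subseteq> J"
      using T(3) genideal_minimal by auto
    then have "v n \<in> J"
      using v by (auto simp: I_def)
    then obtain w where w: "w \<in> span_of R (free_module R (Suc n)) ?W" "v n = w n"
      by (auto simp: J_def)
    have wK: "w \<in> K"
      using F.span_of_least[OF Suc.prems WK] w by auto
    have carr: "v \<in> carrier (free_module R (Suc n))" "w \<in> carrier (free_module R (Suc n))"
      using v wK KD(6) by auto
    have "v \<ominus>\<^bsub>free_module R (Suc n)\<^esub> w \<in> K"
      using KD(4) v wK by blast
    moreover have "(v \<ominus>\<^bsub>free_module R (Suc n)\<^esub> w) n = \<zero>"
      unfolding free_module_diff[OF carr]
      using carr w by (auto simp: free_module_mem a_minus_def r_neg)
    ultimately have "v \<ominus>\<^bsub>free_module R (Suc n)\<^esub> w \<in> K'"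
      by (simp add: K'_def)
    then have "(v \<ominus>\<^bsub>free_module R (Suc n)\<^esub> w) \<oplus>\<^bsub>free_module R (Suc n)\<^esub> w
        \<in> span_of R (free_module R (Suc n)) ?W"
      using sub w F.submoduleD(3)[OF W] by blast
    then show "v \<in> span_of R (free_module R (Suc n)) ?W"
      using carr by (simp add: F.M.a_assoc a_minus_def F.M.l_neg)
  qed
  then have "span_of R (free_module R (Suc n)) ?W = K"
    using F.span_of_least[OF Suc.prems WK] by (simp add: subset_antisym)
  moreover have "finite ?W"
    using S(2) T(2) by simp
  ultimately show ?case
    using WK by (intro exI[of _ ?W] conjI)
qed

lemma (in module) fg_module_cover:
  assumes "fg_module R M"
  shows "\<exists>n f. f \<in> module_hom R (free_module R n) M \<and> f ` carrier (free_module R n) = carrier M"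
proof -
  obtain S where S: "S \<subseteq> carrier M" "finite S" "span_of R M S = carrier M"
    using assms by (auto simp: fg_module_def)
  obtain z where z: "bij_betw z {..<card S} S"
    using ex_bij_betw_nat_finite[OF S(2)] by (auto simp: atLeast0LessThan)
  then have "z ` {..<card S} = S"
    by (auto simp: bij_betw_def)
  moreover from this have "\<And>s. s < card S \<Longrightarrow> z s \<in> carrier M"
    using S(1) by auto
  ultimately show ?thesis
    using free_map_image[of "card S" z] free_map_hom[of "card S" z] S(3)
    by (intro exI[of _ "card S"] exI[of _ "free_map M (card S) z"]) auto
qed

text \<open>The preimage of \<open>K\<close> under a cover \<open>R\<^sup>n \<rightarrow> M\<close> is finitely generated.\<close>

lemma (in module) noetherian_submodule_fg:
  assumes noeth: "noetherian_ring R" and M: "fg_module R M" and K: "submodule K R M"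
  shows "\<exists>S\<subseteq>K. finite S \<and> span_of R M S = K"
proof -
  obtain n f where f: "f \<in> module_hom R (free_module R n) M"
    and surj: "f ` carrier (free_module R n) = carrier M"
    using fg_module_cover[OF M] by auto
  interpret f: linear_map R "free_module R n" M f by (rule free_linear_map[OF f])
  define P where "P = {v \<in> carrier (free_module R n). f v \<in> K}"
  have "submodule P R (free_module R n)"
    unfolding P_def by (rule f.preimage_submodule[OF K])
  from R.noetherian_free_module[OF noeth this]
  obtain S where S: "S \<subseteq> P" "finite S" "span_of R (free_module R n) S = P"
    by (elim exE conjE)
  have image: "f ` P = K"
  proof
    show "f ` P \<subseteq> K"
      by (auto simp: P_def)
    show "K \<subseteq> f ` P"
    proof
      fix w assume "w \<in> K"
      moreover from this have "w \<in> f ` carrier (free_module R n)"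
        using surj submoduleD(1)[OF K] by auto
      ultimately show "w \<in> f ` P"
        by (auto simp: P_def)
    qed
  qed
  have "S \<subseteq> carrier (free_module R n)"
    using S(1) by (auto simp: P_def)
  from f.image_span[OF this] have "span_of R M (f ` S) = K"
    by (simp add: S(3) image)
  moreover have "f ` S \<subseteq> K"
    using S(1) image by blast
  ultimately show ?thesis
    using S(2) by (intro exI[of _ "f ` S"] conjI finite_imageI)
qed

section \<open>Quotient modules\<close>

lemma UN_eq_const: "X \<noteq> {} \<Longrightarrow> (\<And>u. u \<in> X \<Longrightarrow> f u = c) \<Longrightarrow> (\<Union>u\<in>X. f u) = c"
  by auto

lemma coset_restrict_carrier: "K +>\<^bsub>M\<lparr>carrier := H\<rparr>\<^esub> v = K +>\<^bsub>M\<^esub> v"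
  by (simp add: a_r_coset_def')

text \<open>The structure maps of the quotient modules, and the maps between them, are defined as unions
  over all representatives. This lemma shows that every representative contributes the same coset.\<close>

lemma coset_additive_map:
  assumes "K \<subseteq> carrier M" "v \<in> carrier M" "f ` K \<subseteq> K'" "subgroup K' (add_monoid N)" "abelian_group N"
    and "\<And>v w. v \<in> carrier M \<Longrightarrow> w \<in> carrier M \<Longrightarrow> f (v \<oplus>\<^bsub>M\<^esub> w) = f v \<oplus>\<^bsub>N\<^esub> f w"
    and "f v \<in> carrier N" and u: "u \<in> K +>\<^bsub>M\<^esub> v"
  shows "K' +>\<^bsub>N\<^esub> f u = K' +>\<^bsub>N\<^esub> f v"
proof -
  obtain k where k: "k \<in> K" "u = k \<oplus>\<^bsub>M\<^esub> v"
    using u by (auto simp: a_r_coset_def')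
  have "f u \<in> K' +>\<^bsub>N\<^esub> f v"
  proof -
    have "f u = f k \<oplus>\<^bsub>N\<^esub> f v" "f k \<in> K'"
      using k assms by auto
    then show ?thesis
      by (auto simp: a_r_coset_def')
  qed
  then show ?thesis
    using abelian_group.a_repr_independence[OF assms(5) _ assms(7,4)] by auto
qed

context module
begin

lemma coset_eq_iff:
  assumes K: "submodule K R M" and v: "v \<in> carrier M" "w \<in> carrier M"
  shows "K +>\<^bsub>M\<^esub> v = K +>\<^bsub>M\<^esub> w \<longleftrightarrow> v \<ominus>\<^bsub>M\<^esub> w \<in> K"
proof
  note KD = submoduleD[OF K]
  assume "K +>\<^bsub>M\<^esub> v = K +>\<^bsub>M\<^esub> w"
  moreover have "\<zero>\<^bsub>M\<^esub> \<oplus>\<^bsub>M\<^esub> v \<in> K +>\<^bsub>M\<^esub> v"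
    using KD v by (intro M.a_rcosI) auto
  ultimately obtain k where "k \<in> K" "v = k \<oplus>\<^bsub>M\<^esub> w"
    using v by (auto simp: a_r_coset_def')
  then show "v \<ominus>\<^bsub>M\<^esub> w \<in> K"
    using KD(6) v by (simp add: a_minus_def M.a_assoc M.r_neg)
next
  note KD = submoduleD[OF K]
  assume "v \<ominus>\<^bsub>M\<^esub> w \<in> K"
  then have "(v \<ominus>\<^bsub>M\<^esub> w) \<oplus>\<^bsub>M\<^esub> w \<in> K +>\<^bsub>M\<^esub> w"
    using KD v by (intro M.a_rcosI) auto
  then have "v \<in> K +>\<^bsub>M\<^esub> w"
    using v by (simp add: a_minus_def M.a_assoc M.l_neg)
  then show "K +>\<^bsub>M\<^esub> v = K +>\<^bsub>M\<^esub> w"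
    using M.a_repr_independence v KD(7) by metis
qed

lemma coset_eq_self_iff:
  assumes K: "submodule K R M" and v: "v \<in> carrier M"
  shows "K +>\<^bsub>M\<^esub> v = K \<longleftrightarrow> v \<in> K"
proof -
  have "\<ominus>\<^bsub>M\<^esub> \<zero>\<^bsub>M\<^esub> = \<zero>\<^bsub>M\<^esub>"
    by (rule M.minus_equality) auto
  then have "v \<ominus>\<^bsub>M\<^esub> \<zero>\<^bsub>M\<^esub> = v"
    using v by (metis a_minus_def M.r_zero)
  then show ?thesis
    using coset_eq_iff[OF K v M.zero_closed] submoduleD(1)[OF K] by simp
qed

lemma coset_self: "submodule K R M \<Longrightarrow> v \<in> carrier M \<Longrightarrow> v \<in> K +>\<^bsub>M\<^esub> v"
  using M.a_rcosI[of "\<zero>\<^bsub>M\<^esub>" K v] submoduleD[of K] by simp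

text \<open>Module structures are transported along surjections that respect the operations. In this way
  the axioms for modules of cosets reduce to identities between representatives.\<close>

lemma module_of_surjection:
  assumes carr: "carrier N = h ` carrier M" and zero: "\<zero>\<^bsub>N\<^esub> = h \<zero>\<^bsub>M\<^esub>"
    and add: "\<And>v w. v \<in> carrier M \<Longrightarrow> w \<in> carrier M \<Longrightarrow> h v \<oplus>\<^bsub>N\<^esub> h w = h (v \<oplus>\<^bsub>M\<^esub> w)"
    and smult: "\<And>a v. a \<in> carrier R \<Longrightarrow> v \<in> carrier M \<Longrightarrow> a \<odot>\<^bsub>N\<^esub> h v = h (a \<odot>\<^bsub>M\<^esub> v)"
  shows "module R N"
proof (rule moduleI)
  show "abelian_group N"
  proof (rule abelian_groupI)
    fix u assume "u \<in> carrier N"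
    then obtain v where v: "v \<in> carrier M" "u = h v" by (auto simp: carr)
    then show "\<exists>w\<in>carrier N. w \<oplus>\<^bsub>N\<^esub> u = \<zero>\<^bsub>N\<^esub>"
      by (intro bexI[of _ "h (\<ominus>\<^bsub>M\<^esub> v)"]) (auto simp: carr zero add M.l_neg)
  qed (auto simp: carr zero add M.a_ac)
qed (auto simp: carr add smult smult_l_distr smult_r_distr smult_assoc1 R.is_cring)

lemma quot_module_carrier: "carrier (quot_module M K) = (\<lambda>v. K +>\<^bsub>M\<^esub> v) ` carrier M"
  by (auto simp: quot_module_def A_RCOSETS_def')

lemma quot_module_zero: "\<zero>\<^bsub>quot_module M K\<^esub> = K"
  by (simp add: quot_module_def)

lemma quot_module_add:
  assumes "submodule K R M" "v \<in> carrier M" "w \<in> carrier M"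
  shows "(K +>\<^bsub>M\<^esub> v) \<oplus>\<^bsub>quot_module M K\<^esub> (K +>\<^bsub>M\<^esub> w) = K +>\<^bsub>M\<^esub> (v \<oplus>\<^bsub>M\<^esub> w)"
proof -
  interpret abelian_subgroup K M
    using submoduleD(7)[OF assms(1)] M.abelian_group_axioms
    by (intro abelian_subgroupI3 additive_subgroupI)
  show ?thesis
    using a_rcos_sum assms by (simp add: quot_module_def)
qed

lemma quot_module_smult:
  assumes "submodule K R M" "v \<in> carrier M" "a \<in> carrier R"
  shows "a \<odot>\<^bsub>quot_module M K\<^esub> (K +>\<^bsub>M\<^esub> v) = K +>\<^bsub>M\<^esub> (a \<odot>\<^bsub>M\<^esub> v)"
  unfolding quot_module_def module.simps
proof (rule UN_eq_const)
  note KD = submoduleD[OF assms(1)]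
  show "K +>\<^bsub>M\<^esub> v \<noteq> {}"
    using coset_self assms by blast
  show "K +>\<^bsub>M\<^esub> (a \<odot>\<^bsub>M\<^esub> u) = K +>\<^bsub>M\<^esub> (a \<odot>\<^bsub>M\<^esub> v)" if "u \<in> K +>\<^bsub>M\<^esub> v" for u
    using that assms KD(1,5,7) M.abelian_group_axioms
    by (intro coset_additive_map[where K = K and f = "\<lambda>v. a \<odot>\<^bsub>M\<^esub> v"]) (auto simp: smult_r_distr)
qed

lemmas quot_module_simps = quot_module_carrier quot_module_zero quot_module_add quot_module_smult

lemma quot_module_module: "submodule K R M \<Longrightarrow> module R (quot_module M K)"
  by (rule module_of_surjection[where h = "\<lambda>v. K +>\<^bsub>M\<^esub> v"])
    (simp_all add: quot_module_simps submoduleD(1))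

end

lemma (in linear_map) quot_map_coset:
  assumes "submodule K R M" "submodule K' R N" "f ` K \<subseteq> K'" "v \<in> carrier M"
  shows "quot_map N K' f (K +>\<^bsub>M\<^esub> v) = K' +>\<^bsub>N\<^esub> f v"
  unfolding quot_map_def
proof (rule UN_eq_const)
  show "K +>\<^bsub>M\<^esub> v \<noteq> {}"
    using M.coset_self assms by blast
  show "K' +>\<^bsub>N\<^esub> f u = K' +>\<^bsub>N\<^esub> f v" if "u \<in> K +>\<^bsub>M\<^esub> v" for u
    using assms closed that M.submoduleD[OF assms(1)] N.submoduleD[OF assms(2)]
    by (intro coset_additive_map[where f = f] N.abelian_group_axioms) (auto simp: add)
qed

section \<open>Associated graded modules\<close>

text \<open>Elements of an associated graded module are classes of sequences of representatives, with
  finitely many nonzero entries; the operations are induced by operations on sequences.\<close>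

definition gr_class ::
  "('a, 'b, 'm) module_scheme \<Rightarrow> (nat \<Rightarrow> 'b set) \<Rightarrow> (nat \<Rightarrow> 'b) \<Rightarrow> nat \<Rightarrow> 'b set" where
  "gr_class M E p = (\<lambda>i. E (Suc i) +>\<^bsub>M\<^esub> p i)"

definition gr_reps ::
  "('a, 'b, 'm) module_scheme \<Rightarrow> (nat \<Rightarrow> 'b set) \<Rightarrow> (nat \<Rightarrow> 'b) set" where
  "gr_reps M E = {p. (\<forall>i. p i \<in> E i) \<and> finite {i. p i \<noteq> \<zero>\<^bsub>M\<^esub>}}"

locale filtration = module R M
  for R (structure) and M :: "('a, 'b, 'm) module_scheme" (structure) and E :: "nat \<Rightarrow> 'b set" +
  assumes E_submodule: "submodule (E i) R M" and E_Suc: "E (Suc i) \<subseteq> E i"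
begin

lemma E_carrier: "v \<in> E i \<Longrightarrow> v \<in> carrier M"
  using submoduleD(6)[OF E_submodule] .

lemmas E_zero = submoduleD(2)[OF E_submodule] and E_add = submoduleD(3)[OF E_submodule]
  and E_diff = submoduleD(4)[OF E_submodule] and E_smult = submoduleD(5)[OF E_submodule]

lemma piece_submodule: "submodule (E (Suc i)) R (M\<lparr>carrier := E i\<rparr>)"
  using E_Suc E_submodule by (simp add: submodule_of_submodule)

lemma piece_module: "module R (gr_piece M E i)"
  unfolding gr_piece_def
  by (rule module.quot_module_module[OF submodule_module[OF E_submodule] piece_submodule])

lemma piece_simps:
  "carrier (gr_piece M E i) = (\<lambda>v. E (Suc i) +>\<^bsub>M\<^esub> v) ` E i"
  "\<zero>\<^bsub>gr_piece M E i\<^esub> = E (Suc i)"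
  "v \<in> E i \<Longrightarrow> w \<in> E i \<Longrightarrow>
    (E (Suc i) +>\<^bsub>M\<^esub> v) \<oplus>\<^bsub>gr_piece M E i\<^esub> (E (Suc i) +>\<^bsub>M\<^esub> w) = E (Suc i) +>\<^bsub>M\<^esub> (v \<oplus>\<^bsub>M\<^esub> w)"
  using module.quot_module_simps[OF submodule_module[OF E_submodule[of i]], of "E (Suc i)"]
    piece_submodule[of i]
  by (simp_all add: gr_piece_def coset_restrict_carrier)

lemma piece_finsum:
  assumes "finite A" "\<And>j. j \<in> A \<Longrightarrow> u j \<in> E i"
  shows "(\<Oplus>\<^bsub>gr_piece M E i\<^esub>j\<in>A. E (Suc i) +>\<^bsub>M\<^esub> u j) = E (Suc i) +>\<^bsub>M\<^esub> (\<Oplus>\<^bsub>M\<^esub>j\<in>A. u j)"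
    "(\<Oplus>\<^bsub>M\<^esub>j\<in>A. u j) \<in> E i"
proof -
  interpret P: module R "gr_piece M E i" by (rule piece_module)
  have "(\<Oplus>\<^bsub>gr_piece M E i\<^esub>j\<in>A. E (Suc i) +>\<^bsub>M\<^esub> u j) = E (Suc i) +>\<^bsub>M\<^esub> (\<Oplus>\<^bsub>M\<^esub>j\<in>A. u j)
      \<and> (\<Oplus>\<^bsub>M\<^esub>j\<in>A. u j) \<in> E i"
    using assms
  proof (induction A rule: finite_induct)
    case empty
    then show ?case
      using submoduleD(1)[OF E_submodule] by (simp add: piece_simps E_zero)
  next
    case (insert j A)
    moreover have "u k \<in> carrier M" if "k \<in> insert j A" for k
      using insert.prems[OF that] by (rule E_carrier)
    ultimately show ?case
      by (simp add: piece_simps E_add Pi_def)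
  qed
  then show "(\<Oplus>\<^bsub>gr_piece M E i\<^esub>j\<in>A. E (Suc i) +>\<^bsub>M\<^esub> u j) = E (Suc i) +>\<^bsub>M\<^esub> (\<Oplus>\<^bsub>M\<^esub>j\<in>A. u j)"
    "(\<Oplus>\<^bsub>M\<^esub>j\<in>A. u j) \<in> E i"
    by auto
qed

lemma gr_class_eq_iff:
  assumes "\<And>i. p i \<in> E i" "\<And>i. q i \<in> E i"
  shows "gr_class M E p = gr_class M E q \<longleftrightarrow> (\<forall>i. p i \<ominus>\<^bsub>M\<^esub> q i \<in> E (Suc i))"
  using coset_eq_iff[OF E_submodule E_carrier[OF assms(1)] E_carrier[OF assms(2)]]
  by (simp add: gr_class_def fun_eq_iff)

lemma gr_class_zero: "gr_class M E (\<lambda>_. \<zero>\<^bsub>M\<^esub>) = (\<lambda>i. E (Suc i))"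
  using submoduleD(1)[OF E_submodule] by (simp add: gr_class_def)

lemma gr_reps_zero: "(\<lambda>_. \<zero>\<^bsub>M\<^esub>) \<in> gr_reps M E"
  by (simp add: gr_reps_def E_zero)

lemma gr_repsD:
  assumes "p \<in> gr_reps M E"
  shows "\<And>i. p i \<in> E i" "finite {i. p i \<noteq> \<zero>\<^bsub>M\<^esub>}" "\<And>i. p i \<in> carrier M"
  using assms E_carrier by (auto simp: gr_reps_def)

lemma gr_reps_add:
  assumes "p \<in> gr_reps M E" "q \<in> gr_reps M E"
  shows "(\<lambda>i. p i \<oplus>\<^bsub>M\<^esub> q i) \<in> gr_reps M E"
proof -
  have "{i. p i \<oplus>\<^bsub>M\<^esub> q i \<noteq> \<zero>\<^bsub>M\<^esub>} \<subseteq> {i. p i \<noteq> \<zero>\<^bsub>M\<^esub>} \<union> {i. q i \<noteq> \<zero>\<^bsub>M\<^esub>}"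
    by auto
  then show ?thesis
    using gr_repsD[OF assms(1)] gr_repsD[OF assms(2)] E_add
    by (auto simp: gr_reps_def intro: finite_subset)
qed

lemma gr_reps_smult:
  assumes "a \<in> carrier R" "p \<in> gr_reps M E"
  shows "(\<lambda>i. a \<odot>\<^bsub>M\<^esub> p i) \<in> gr_reps M E"
proof -
  have "{i. a \<odot>\<^bsub>M\<^esub> p i \<noteq> \<zero>\<^bsub>M\<^esub>} \<subseteq> {i. p i \<noteq> \<zero>\<^bsub>M\<^esub>}"
    using assms by auto
  then show ?thesis
    using assms gr_repsD[OF assms(2)] E_smult by (auto simp: gr_reps_def intro: finite_subset)
qed

lemma gr_carrier: "carrier (assoc_gr M E) = gr_class M E ` gr_reps M E"
proof (intro subset_antisym subsetI)
  fix f assume "f \<in> carrier (assoc_gr M E)"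
  then have f: "\<And>i. f i \<in> (\<lambda>v. E (Suc i) +>\<^bsub>M\<^esub> v) ` E i" "finite {i. f i \<noteq> E (Suc i)}"
    by (auto simp: assoc_gr_def piece_simps)
  then have "\<forall>i. \<exists>v\<in>E i. f i = E (Suc i) +>\<^bsub>M\<^esub> v \<and> (f i = E (Suc i) \<longrightarrow> v = \<zero>\<^bsub>M\<^esub>)"
    using E_zero submoduleD(1)[OF E_submodule] M.a_coset_add_zero by (metis (no_types, lifting) imageE)
  then obtain p where p: "\<And>i. p i \<in> E i" "\<And>i. f i = E (Suc i) +>\<^bsub>M\<^esub> p i"
      "\<And>i. f i = E (Suc i) \<Longrightarrow> p i = \<zero>\<^bsub>M\<^esub>"
    by metis
  have "{i. p i \<noteq> \<zero>\<^bsub>M\<^esub>} \<subseteq> {i. f i \<noteq> E (Suc i)}"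
    using p(3) by auto
  then have "p \<in> gr_reps M E"
    using p(1) f(2) by (auto simp: gr_reps_def intro: finite_subset)
  moreover have "f = gr_class M E p"
    using p(2) by (auto simp: gr_class_def)
  ultimately show "f \<in> gr_class M E ` gr_reps M E"
    by blast
next
  fix f assume "f \<in> gr_class M E ` gr_reps M E"
  then obtain p where p: "p \<in> gr_reps M E" "f = gr_class M E p" by auto
  have "{i. f i \<noteq> E (Suc i)} \<subseteq> {i. p i \<noteq> \<zero>\<^bsub>M\<^esub>}"
    using p submoduleD(1)[OF E_submodule] by (auto simp: gr_class_def)
  then show "f \<in> carrier (assoc_gr M E)"
    using p gr_repsD[OF p(1)] finite_subset
    by (auto simp: assoc_gr_def piece_simps gr_class_def)
qed

lemma gr_zero: "\<zero>\<^bsub>assoc_gr M E\<^esub> = gr_class M E (\<lambda>_. \<zero>\<^bsub>M\<^esub>)"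
  by (simp add: assoc_gr_def piece_simps gr_class_zero)

lemma gr_add:
  assumes "p \<in> gr_reps M E" "q \<in> gr_reps M E"
  shows "gr_class M E p \<oplus>\<^bsub>assoc_gr M E\<^esub> gr_class M E q = gr_class M E (\<lambda>i. p i \<oplus>\<^bsub>M\<^esub> q i)"
  using gr_repsD[OF assms(1)] gr_repsD[OF assms(2)]
  by (simp add: assoc_gr_def gr_class_def piece_simps)

lemma gr_minus_rep:
  assumes "p \<in> gr_reps M E"
  shows "(\<lambda>i. \<ominus>\<^bsub>M\<^esub> p i) \<in> gr_reps M E"
    "gr_class M E (\<lambda>i. \<ominus>\<^bsub>M\<^esub> p i) \<oplus>\<^bsub>assoc_gr M E\<^esub> gr_class M E p = \<zero>\<^bsub>assoc_gr M E\<^esub>"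
proof -
  have "(\<lambda>i. (\<ominus> \<one>) \<odot>\<^bsub>M\<^esub> p i) \<in> gr_reps M E"
    using assms by (intro gr_reps_smult) auto
  then show *: "(\<lambda>i. \<ominus>\<^bsub>M\<^esub> p i) \<in> gr_reps M E"
    using gr_repsD(3)[OF assms] by (simp add: smult_l_minus)
  show "gr_class M E (\<lambda>i. \<ominus>\<^bsub>M\<^esub> p i) \<oplus>\<^bsub>assoc_gr M E\<^esub> gr_class M E p = \<zero>\<^bsub>assoc_gr M E\<^esub>"
    using gr_repsD(3)[OF assms] by (simp add: gr_add[OF * assms] gr_zero M.l_neg)
qed

lemma gr_abelian_group: "abelian_group (assoc_gr M E)"
proof (rule abelian_groupI)
  fix f assume "f \<in> carrier (assoc_gr M E)"
  then show "\<exists>g\<in>carrier (assoc_gr M E). g \<oplus>\<^bsub>assoc_gr M E\<^esub> f = \<zero>\<^bsub>assoc_gr M E\<^esub>"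
    using gr_minus_rep by (auto simp: gr_carrier)
qed (auto simp: gr_carrier gr_zero gr_add gr_reps_add gr_reps_zero M.a_ac gr_repsD(3))

end

text \<open>The product of sequences; it induces the scalar multiplication on classes.\<close>

definition convolution ::
  "('a, 'b, 'm) module_scheme \<Rightarrow> (nat \<Rightarrow> 'a) \<Rightarrow> (nat \<Rightarrow> 'b) \<Rightarrow> nat \<Rightarrow> 'b" where
  "convolution M r p i = (\<Oplus>\<^bsub>M\<^esub>j\<in>{..i}. r j \<odot>\<^bsub>M\<^esub> p (i - j))"

lemma (in cring) ring_module_module: "module R (ring_module R)"
proof (rule moduleI)
  show "abelian_group (ring_module R)"
  proof (rule abelian_groupI)
    fix a assume "a \<in> carrier (ring_module R)"
    then show "\<exists>b\<in>carrier (ring_module R). b \<oplus>\<^bsub>ring_module R\<^esub> a = \<zero>\<^bsub>ring_module R\<^esub>"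
      by (intro bexI[of _ "\<ominus> a"]) (auto simp: ring_module_def l_neg)
  qed (auto simp: ring_module_def a_ac)
qed (auto simp: ring_module_def l_distr r_distr m_assoc is_cring)

lemma ring_module_simps:
  "carrier (ring_module R) = carrier R" "\<zero>\<^bsub>ring_module R\<^esub> = \<zero>\<^bsub>R\<^esub>"
  "a \<oplus>\<^bsub>ring_module R\<^esub> b = a \<oplus>\<^bsub>R\<^esub> b" "a \<odot>\<^bsub>ring_module R\<^esub> b = a \<otimes>\<^bsub>R\<^esub> b"
  "finsum (ring_module R) = finsum R" "K +>\<^bsub>ring_module R\<^esub> a = K +>\<^bsub>R\<^esub> a"
  by (auto simp: ring_module_def finsum_def finprod_def a_r_coset_def' fun_eq_iff)

lemma (in cring) ideal_submodule_ring_module: "ideal I R \<longleftrightarrow> submodule I R (ring_module R)"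
proof -
  interpret M: module R "ring_module R" by (rule ring_module_module)
  show ?thesis
  proof
    assume "ideal I R"
    then interpret ideal I R .
    show "submodule I R (ring_module R)"
      by (rule M.submoduleI') (auto simp: ring_module_simps I_l_closed a_subset Icarr)
  next
    assume I: "submodule I R (ring_module R)"
    note ID = M.submoduleD[OF I, unfolded ring_module_simps]
    show "ideal I R"
    proof (rule idealI)
      have "\<ominus> a \<in> I" if "a \<in> I" for a
        using ID(5)[of "\<ominus> \<one>" a] ID(6) that by (simp add: l_minus)
      then show "subgroup I (add_monoid R)"
        using ID by (intro add.subgroupI) auto
      fix a b assume "a \<in> I" "b \<in> carrier R"
      then show "b \<otimes> a \<in> I" "a \<otimes> b \<in> I"
        using ID(5)[of b a] ID(6)[of a] by (simp_all add: m_comm)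
    qed (rule ring_axioms)
  qed
qed

context module
begin

lemma convolution_add_left:
  assumes "\<And>i. r i \<in> carrier R" "\<And>i. s i \<in> carrier R" "\<And>i. p i \<in> carrier M"
  shows "convolution M (\<lambda>i. r i \<oplus> s i) p i = convolution M r p i \<oplus>\<^bsub>M\<^esub> convolution M s p i"
proof -
  have "convolution M (\<lambda>i. r i \<oplus> s i) p i
      = (\<Oplus>\<^bsub>M\<^esub>j\<in>{..i}. r j \<odot>\<^bsub>M\<^esub> p (i - j) \<oplus>\<^bsub>M\<^esub> s j \<odot>\<^bsub>M\<^esub> p (i - j))"
    unfolding convolution_def using assms by (intro M.finsum_cong') (auto simp: smult_l_distr)
  also have "\<dots> = convolution M r p i \<oplus>\<^bsub>M\<^esub> convolution M s p i"
    unfolding convolution_def using assms by (intro M.finsum_addf) auto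
  finally show ?thesis .
qed

lemma convolution_add_right:
  assumes "\<And>i. r i \<in> carrier R" "\<And>i. p i \<in> carrier M" "\<And>i. q i \<in> carrier M"
  shows "convolution M r (\<lambda>i. p i \<oplus>\<^bsub>M\<^esub> q i) i = convolution M r p i \<oplus>\<^bsub>M\<^esub> convolution M r q i"
proof -
  have "convolution M r (\<lambda>i. p i \<oplus>\<^bsub>M\<^esub> q i) i
      = (\<Oplus>\<^bsub>M\<^esub>j\<in>{..i}. r j \<odot>\<^bsub>M\<^esub> p (i - j) \<oplus>\<^bsub>M\<^esub> r j \<odot>\<^bsub>M\<^esub> q (i - j))"
    unfolding convolution_def using assms by (intro M.finsum_cong') (auto simp: smult_r_distr)
  also have "\<dots> = convolution M r p i \<oplus>\<^bsub>M\<^esub> convolution M r q i"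
    unfolding convolution_def using assms by (intro M.finsum_addf) auto
  finally show ?thesis .
qed

lemma finsum_smult_rdistr:
  assumes "finite A" "v \<in> carrier M" "\<And>i. i \<in> A \<Longrightarrow> r i \<in> carrier R"
  shows "(\<Oplus>i\<in>A. r i) \<odot>\<^bsub>M\<^esub> v = (\<Oplus>\<^bsub>M\<^esub>i\<in>A. r i \<odot>\<^bsub>M\<^esub> v)"
  using assms
proof (induction A rule: finite_induct)
  case empty
  then show ?case by simp
next
  case (insert j A)
  then show ?case by (simp add: Pi_def smult_l_distr)
qed

text \<open>As for the associativity of the product of polynomials, the upper limit of the outer sums has
  to be separated from the degree for an induction to go through.\<close>

lemma convolution_assoc:
  assumes r: "\<And>i. r i \<in> carrier R" and s: "\<And>i. s i \<in> carrier R" and p: "\<And>i. p i \<in> carrier M"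
  shows "convolution M (convolution (ring_module R) r s) p n = convolution M r (convolution M s p) n"
proof -
  have "(\<Oplus>\<^bsub>M\<^esub>j\<in>{..k}. (\<Oplus>i\<in>{..j}. r i \<otimes> s (j - i)) \<odot>\<^bsub>M\<^esub> p (n - j))
      = (\<Oplus>\<^bsub>M\<^esub>j\<in>{..k}. r j \<odot>\<^bsub>M\<^esub> (\<Oplus>\<^bsub>M\<^esub>i\<in>{..k - j}. s i \<odot>\<^bsub>M\<^esub> p (n - j - i)))" if "k \<le> n" for k
    using that
  proof (induction k)
    case 0
    then show ?case using r s p by (simp add: Pi_def smult_assoc1)
  next
    case (Suc k)
    have A: "(\<Oplus>\<^bsub>M\<^esub>i\<in>{..Suc k - j}. s i \<odot>\<^bsub>M\<^esub> p (n - j - i))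
        = s (Suc k - j) \<odot>\<^bsub>M\<^esub> p (n - Suc k) \<oplus>\<^bsub>M\<^esub> (\<Oplus>\<^bsub>M\<^esub>i\<in>{..k - j}. s i \<odot>\<^bsub>M\<^esub> p (n - j - i))"
      if "j \<le> k" for j
      using that s p by (simp add: Suc_diff_le Pi_def)
    have B: "(\<Oplus>\<^bsub>M\<^esub>j\<in>{..k}. r j \<odot>\<^bsub>M\<^esub> (\<Oplus>\<^bsub>M\<^esub>i\<in>{..Suc k - j}. s i \<odot>\<^bsub>M\<^esub> p (n - j - i)))
        = (\<Oplus>\<^bsub>M\<^esub>j\<in>{..k}. (r j \<otimes> s (Suc k - j)) \<odot>\<^bsub>M\<^esub> p (n - Suc k) \<oplus>\<^bsub>M\<^esub>
             r j \<odot>\<^bsub>M\<^esub> (\<Oplus>\<^bsub>M\<^esub>i\<in>{..k - j}. s i \<odot>\<^bsub>M\<^esub> p (n - j - i)))"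
      using r s p by (intro M.finsum_cong') (auto simp: A smult_r_distr smult_assoc1 simp del: diff_diff_left intro!: M.a_closed)
    also have "\<dots> = (\<Oplus>\<^bsub>M\<^esub>j\<in>{..k}. (r j \<otimes> s (Suc k - j)) \<odot>\<^bsub>M\<^esub> p (n - Suc k)) \<oplus>\<^bsub>M\<^esub>
        (\<Oplus>\<^bsub>M\<^esub>j\<in>{..k}. r j \<odot>\<^bsub>M\<^esub> (\<Oplus>\<^bsub>M\<^esub>i\<in>{..k - j}. s i \<odot>\<^bsub>M\<^esub> p (n - j - i)))"
      using r s p by (intro M.finsum_addf) auto
    also have "(\<Oplus>\<^bsub>M\<^esub>j\<in>{..k}. (r j \<otimes> s (Suc k - j)) \<odot>\<^bsub>M\<^esub> p (n - Suc k))
        = (\<Oplus>j\<in>{..k}. r j \<otimes> s (Suc k - j)) \<odot>\<^bsub>M\<^esub> p (n - Suc k)"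
      using r s p by (intro finsum_smult_rdistr[symmetric]) auto
    also have "(\<Oplus>\<^bsub>M\<^esub>j\<in>{..k}. r j \<odot>\<^bsub>M\<^esub> (\<Oplus>\<^bsub>M\<^esub>i\<in>{..k - j}. s i \<odot>\<^bsub>M\<^esub> p (n - j - i)))
        = (\<Oplus>\<^bsub>M\<^esub>j\<in>{..k}. (\<Oplus>i\<in>{..j}. r i \<otimes> s (j - i)) \<odot>\<^bsub>M\<^esub> p (n - j))"
      using Suc by simp
    finally have C: "(\<Oplus>\<^bsub>M\<^esub>j\<in>{..k}. r j \<odot>\<^bsub>M\<^esub> (\<Oplus>\<^bsub>M\<^esub>i\<in>{..Suc k - j}. s i \<odot>\<^bsub>M\<^esub> p (n - j - i)))
        = (\<Oplus>j\<in>{..k}. r j \<otimes> s (Suc k - j)) \<odot>\<^bsub>M\<^esub> p (n - Suc k) \<oplus>\<^bsub>M\<^esub>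
          (\<Oplus>\<^bsub>M\<^esub>j\<in>{..k}. (\<Oplus>i\<in>{..j}. r i \<otimes> s (j - i)) \<odot>\<^bsub>M\<^esub> p (n - j))" .
    have rs: "(\<Oplus>j\<in>{..l}. r j \<otimes> s (i - j)) \<in> carrier R" for i l
      using r s by (intro R.finsum_closed) auto
    have rsp: "(\<Oplus>\<^bsub>M\<^esub>j\<in>{..k}. (\<Oplus>i\<in>{..j}. r i \<otimes> s (j - i)) \<odot>\<^bsub>M\<^esub> p (n - j)) \<in> carrier M"
      using rs p by (intro M.finsum_closed) auto
    have "(\<Oplus>\<^bsub>M\<^esub>j\<in>{..Suc k}. r j \<odot>\<^bsub>M\<^esub> (\<Oplus>\<^bsub>M\<^esub>i\<in>{..Suc k - j}. s i \<odot>\<^bsub>M\<^esub> p (n - j - i)))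
        = r (Suc k) \<odot>\<^bsub>M\<^esub> (s 0 \<odot>\<^bsub>M\<^esub> p (n - Suc k)) \<oplus>\<^bsub>M\<^esub>
          (\<Oplus>\<^bsub>M\<^esub>j\<in>{..k}. r j \<odot>\<^bsub>M\<^esub> (\<Oplus>\<^bsub>M\<^esub>i\<in>{..Suc k - j}. s i \<odot>\<^bsub>M\<^esub> p (n - j - i)))"
      using r s p by (subst M.finsum_Suc) auto
    also have "\<dots> = (r (Suc k) \<otimes> s 0 \<oplus> (\<Oplus>j\<in>{..k}. r j \<otimes> s (Suc k - j))) \<odot>\<^bsub>M\<^esub> p (n - Suc k) \<oplus>\<^bsub>M\<^esub>
          (\<Oplus>\<^bsub>M\<^esub>j\<in>{..k}. (\<Oplus>i\<in>{..j}. r i \<otimes> s (j - i)) \<odot>\<^bsub>M\<^esub> p (n - j))"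
      using r s p rs rsp
      by (simp add: C smult_l_distr smult_assoc1 M.a_assoc del: diff_diff_left)
    also have "r (Suc k) \<otimes> s 0 \<oplus> (\<Oplus>j\<in>{..k}. r j \<otimes> s (Suc k - j)) = (\<Oplus>j\<in>{..Suc k}. r j \<otimes> s (Suc k - j))"
      using r s by (subst R.finsum_Suc) auto
    also have "(\<Oplus>j\<in>{..Suc k}. r j \<otimes> s (Suc k - j)) \<odot>\<^bsub>M\<^esub> p (n - Suc k) \<oplus>\<^bsub>M\<^esub>
          (\<Oplus>\<^bsub>M\<^esub>j\<in>{..k}. (\<Oplus>i\<in>{..j}. r i \<otimes> s (j - i)) \<odot>\<^bsub>M\<^esub> p (n - j))
        = (\<Oplus>\<^bsub>M\<^esub>j\<in>{..Suc k}. (\<Oplus>i\<in>{..j}. r i \<otimes> s (j - i)) \<odot>\<^bsub>M\<^esub> p (n - j))"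
      using rs p by (subst M.finsum_Suc[of _ k]) (auto simp del: R.finsum_Suc)
    finally show ?case by simp
  qed
  from this[of n] show ?thesis
    by (simp add: convolution_def ring_module_simps)
qed

end

lemma (in cring) convolution_comm:
  assumes r: "\<And>i. r i \<in> carrier R" and s: "\<And>i. s i \<in> carrier R"
  shows "convolution (ring_module R) r s n = convolution (ring_module R) s r n"
proof -
  have "(\<Oplus>j\<in>{..n}. r j \<otimes> s (n - j)) = (\<Oplus>j\<in>(\<lambda>j. n - j) ` {..n}. r j \<otimes> s (n - j))"
  proof -
    have "i \<in> (\<lambda>j. n - j) ` {..n}" if "i \<in> {..n}" for i
      using that by (intro image_eqI[of _ _ "n - i"]) auto
    then have "{..n} = (\<lambda>j. n - j) ` {..n}"
      by auto
    then show ?thesis by simp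
  qed
  also have "\<dots> = (\<Oplus>j\<in>{..n}. r (n - j) \<otimes> s (n - (n - j)))"
    using r s by (intro finsum_reindex) (auto simp: inj_on_def)
  also have "\<dots> = (\<Oplus>j\<in>{..n}. s j \<otimes> r (n - j))"
    using r s by (intro finsum_cong') (auto simp: m_comm)
  finally show ?thesis
    by (simp add: convolution_def ring_module_simps)
qed

text \<open>The conditions under which convolution is compatible with passage to classes. The filtration
  \<open>J\<close> of the ring is abstracted from the powers of the maximal ideal; it also acts on itself, so that
  statements about modules specialise to the associated graded ring.\<close>

locale graded_action = filtration R M E
  for R (structure) and M :: "('a, 'b, 'm) module_scheme" (structure)
    and J :: "nat \<Rightarrow> 'a set" and E :: "nat \<Rightarrow> 'b set" +
  assumes J_ideal: "ideal (J i) R" and J_0: "J 0 = carrier R" and J_Suc: "J (Suc i) \<subseteq> J i"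
    and J_mult: "a \<in> J i \<Longrightarrow> b \<in> J l \<Longrightarrow> a \<otimes> b \<in> J (i + l)"
    and J_smult: "a \<in> J i \<Longrightarrow> v \<in> E l \<Longrightarrow> a \<odot>\<^bsub>M\<^esub> v \<in> E (i + l)"

lemma (in graded_action) ring_action: "graded_action R (ring_module R) J J"
  using R.ring_module_module J_ideal J_0 J_Suc J_mult
  by (intro graded_action.intro filtration.intro filtration_axioms.intro
      graded_action_axioms.intro) (simp_all add: ring_module_simps flip: R.ideal_submodule_ring_module)

sublocale graded_action \<subseteq> ring_filtration: filtration R "ring_module R" J
  using ring_action by (simp add: graded_action_def)

context graded_action
begin

abbreviation (input) "ring_reps \<equiv> gr_reps (ring_module R) J"
abbreviation (input) "gr_ring_class \<equiv> gr_class (ring_module R) J"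

lemma ring_repsD:
  assumes "r \<in> ring_reps"
  shows "\<And>i. r i \<in> J i" "\<And>i. r i \<in> carrier R"
  using ring_filtration.gr_repsD[OF assms] by (auto simp: ring_module_simps)

lemma convolution_reps:
  assumes r: "r \<in> ring_reps" and p: "p \<in> gr_reps M E"
  shows "convolution M r p \<in> gr_reps M E"
proof -
  have "convolution M r p i \<in> E i" for i
    unfolding convolution_def
  proof (rule piece_finsum(2))
    show "r j \<odot>\<^bsub>M\<^esub> p (i - j) \<in> E i" if "j \<in> {..i}" for j
      using J_smult[OF ring_repsD(1)[OF r] gr_repsD(1)[OF p], of j "i - j"] that by simp
  qed simp
  moreover have "{i. convolution M r p i \<noteq> \<zero>\<^bsub>M\<^esub>}
      \<subseteq> (\<lambda>(i, j). i + j) ` ({i. r i \<noteq> \<zero>} \<times> {i. p i \<noteq> \<zero>\<^bsub>M\<^esub>})"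
  proof
    fix i assume i: "i \<in> {i. convolution M r p i \<noteq> \<zero>\<^bsub>M\<^esub>}"
    have "\<exists>j\<le>i. r j \<noteq> \<zero> \<and> p (i - j) \<noteq> \<zero>\<^bsub>M\<^esub>"
    proof (rule ccontr)
      assume "\<not> ?thesis"
      then have "r j \<odot>\<^bsub>M\<^esub> p (i - j) = \<zero>\<^bsub>M\<^esub>" if "j \<le> i" for j
        using that ring_repsD(2)[OF r, of j] gr_repsD(3)[OF p, of "i - j"]
        by (metis smult_l_null smult_r_null)
      then have "convolution M r p i = (\<Oplus>\<^bsub>M\<^esub>j\<in>{..i}. \<zero>\<^bsub>M\<^esub>)"
        unfolding convolution_def by (intro M.finsum_cong') auto
      then show False
        using i by simp
    qed
    then obtain j where "j \<le> i" "r j \<noteq> \<zero>" "p (i - j) \<noteq> \<zero>\<^bsub>M\<^esub>"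
      by blast
    then show "i \<in> (\<lambda>(i, j). i + j) ` ({i. r i \<noteq> \<zero>} \<times> {i. p i \<noteq> \<zero>\<^bsub>M\<^esub>})"
      by (intro image_eqI[of _ _ "(j, i - j)"]) auto
  qed
  \<comment> \<open>the support of a convolution lies in the sum of the supports\<close>
  ultimately show ?thesis
    using ring_filtration.gr_repsD(2)[OF r] gr_repsD(2)[OF p]
    by (auto simp: gr_reps_def ring_module_simps intro: finite_subset)
qed

text \<open>Changing a representative \<open>r\<^sub>j\<close> by an element of \<open>J\<^sub>j\<^sub>+\<^sub>1\<close> and \<open>p\<^sub>i\<^sub>-\<^sub>j\<close> by an element of
  \<open>E\<^sub>i\<^sub>-\<^sub>j\<^sub>+\<^sub>1\<close> changes their product by an element of \<open>E\<^sub>i\<^sub>+\<^sub>1\<close>.\<close>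

lemma gr_smult:
  assumes r: "r \<in> ring_reps" and p: "p \<in> gr_reps M E"
  shows "gr_ring_class r \<odot>\<^bsub>assoc_gr M E\<^esub> gr_class M E p = gr_class M E (convolution M r p)"
proof
  fix i
  have piece: "(\<Union>a\<in>gr_ring_class r j. \<Union>v\<in>gr_class M E p (i - j). E (Suc i) +>\<^bsub>M\<^esub> (a \<odot>\<^bsub>M\<^esub> v))
      = E (Suc i) +>\<^bsub>M\<^esub> (r j \<odot>\<^bsub>M\<^esub> p (i - j))" if j: "j \<le> i" for j
  proof -
    have rj: "r j \<in> J j" "r j \<in> carrier R" and pj: "p (i - j) \<in> E (i - j)" "p (i - j) \<in> carrier M"
      using ring_repsD[OF r] gr_repsD[OF p] by auto
    have "E (Suc i) +>\<^bsub>M\<^esub> (a \<odot>\<^bsub>M\<^esub> v) = E (Suc i) +>\<^bsub>M\<^esub> (r j \<odot>\<^bsub>M\<^esub> p (i - j))"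
      if a: "a \<in> gr_ring_class r j" and v: "v \<in> gr_class M E p (i - j)" for a v
    proof -
      obtain b where b: "b \<in> J (Suc j)" "a = b \<oplus> r j"
        using a by (auto simp: gr_class_def a_r_coset_def' ring_module_simps)
      obtain w where w: "w \<in> E (Suc (i - j))" "v = w \<oplus>\<^bsub>M\<^esub> p (i - j)"
        using v by (auto simp: gr_class_def a_r_coset_def')
      have carr: "b \<in> carrier R" "w \<in> carrier M"
        using b w ideal.Icarr[OF J_ideal] E_carrier by auto
      have v': "v \<in> E (i - j)" "v \<in> carrier M"
        using w(2) E_add[OF subsetD[OF E_Suc w(1)] pj(1)] E_carrier by auto
      have "b \<odot>\<^bsub>M\<^esub> v \<in> E (Suc i)" "r j \<odot>\<^bsub>M\<^esub> w \<in> E (Suc i)"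
        using J_smult[OF b(1) v'(1)] J_smult[OF rj(1) w(1)] j by auto
      then have "b \<odot>\<^bsub>M\<^esub> v \<oplus>\<^bsub>M\<^esub> r j \<odot>\<^bsub>M\<^esub> w \<in> E (Suc i)"
        by (rule E_add)
      moreover have "a \<odot>\<^bsub>M\<^esub> v = (b \<odot>\<^bsub>M\<^esub> v \<oplus>\<^bsub>M\<^esub> r j \<odot>\<^bsub>M\<^esub> w) \<oplus>\<^bsub>M\<^esub> r j \<odot>\<^bsub>M\<^esub> p (i - j)"
        using b(2) w(2) carr rj pj v' by (simp add: smult_l_distr smult_r_distr M.a_ac)
      ultimately show ?thesis
        using carr rj pj v' b(2) E_carrier
        by (subst coset_eq_iff[OF E_submodule])
          (auto simp: a_minus_def M.a_assoc M.r_neg)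
    qed
    moreover have "gr_ring_class r j \<noteq> {}" "gr_class M E p (i - j) \<noteq> {}"
      using ring_filtration.coset_self[OF ring_filtration.E_submodule, of "r j" "Suc j"]
        coset_self[OF E_submodule pj(2)] rj
      by (auto simp: gr_class_def ring_module_simps)
    ultimately show ?thesis
      by (intro UN_eq_const) auto
  qed
  interpret P: module R "gr_piece M E i" by (rule piece_module)
  have E: "r j \<odot>\<^bsub>M\<^esub> p (i - j) \<in> E i" if "j \<le> i" for j
    using J_smult[OF ring_repsD(1)[OF r] gr_repsD(1)[OF p], of j "i - j"] that by simp
  have "(gr_ring_class r \<odot>\<^bsub>assoc_gr M E\<^esub> gr_class M E p) i
      = (\<Oplus>\<^bsub>gr_piece M E i\<^esub>j\<in>{..i}. E (Suc i) +>\<^bsub>M\<^esub> (r j \<odot>\<^bsub>M\<^esub> p (i - j)))"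
    unfolding assoc_gr_def module.simps
    using E by (intro P.finsum_cong') (auto simp: piece piece_simps)
  also have "\<dots> = gr_class M E (convolution M r p) i"
    using E by (subst piece_finsum(1)) (auto simp: gr_class_def convolution_def)
  finally show "(gr_ring_class r \<odot>\<^bsub>assoc_gr M E\<^esub> gr_class M E p) i
      = gr_class M E (convolution M r p) i" .
qed

end

section \<open>Powers of ideals and local rings\<close>

context cring
begin

lemma ideal_power_ideal: "ideal I R \<Longrightarrow> ideal (ideal_power R I n) R"
  by (induction n) (auto intro: ideal_prod_is_ideal oneideal)

lemma ideal_power_Suc_subset: "ideal I R \<Longrightarrow> ideal_power R I (Suc n) \<subseteq> ideal_power R I n"
  using ideal_prod_inter[OF _ ideal_power_ideal] by auto

lemma ideal_power_mult:
  assumes I: "ideal I R" and "a \<in> ideal_power R I i" and b: "b \<in> ideal_power R I j"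
  shows "a \<otimes> b \<in> ideal_power R I (i + j)"
  using assms(2)
proof (induction i arbitrary: a)
  case 0
  then show ?case
    using b ideal.I_l_closed[OF ideal_power_ideal[OF I]] by simp
next
  case (Suc i)
  interpret b: ideal "ideal_power R I j" R by (rule ideal_power_ideal[OF I])
  interpret p: ideal "ideal_power R I i" R by (rule ideal_power_ideal[OF I])
  interpret I: ideal I R by (rule I)
  interpret q: ideal "ideal_power R I (Suc (i + j))" R by (rule ideal_power_ideal[OF I])
  have "a \<in> I \<cdot> ideal_power R I i"
    using Suc.prems by simp
  then have "a \<in> carrier R \<and> a \<otimes> b \<in> ideal_power R I (Suc (i + j))"
  proof (induction a rule: ideal_prod.induct)
    case (prod u v)
    then have "u \<otimes> (v \<otimes> b) \<in> ideal_power R I (Suc (i + j))"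
      using Suc.IH by (auto intro: ideal_prod.prod)
    then show ?case
      using prod b by (simp add: m_assoc I.Icarr p.Icarr b.Icarr)
  next
    case (sum u v)
    then show ?case
      using b by (auto simp: l_distr b.Icarr intro: ideal_prod.sum)
  qed
  then show ?case by simp
qed

lemma ideal_power_1: "ideal I R \<Longrightarrow> ideal_power R I (Suc 0) = I"
  using ideal_prod_inter[OF _ oneideal, of I] ideal_prod.prod[of _ I \<one> "carrier R" R]
  by (fastforce dest: ideal.Icarr)

lemma ideal_power_subset:
  assumes I: "ideal I R" and "i \<le> j" shows "ideal_power R I j \<subseteq> ideal_power R I i"
  by (rule lift_Suc_antimono_le[of "ideal_power R I", OF ideal_power_Suc_subset[OF I] assms(2)])

end

locale local_cring = cring R for R (structure) + fixes \<mm> :: "'a set"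
  assumes m_ideal: "ideal \<mm> R" and m_proper: "\<mm> \<noteq> carrier R"
    and unitI: "a \<in> carrier R \<Longrightarrow> a \<notin> \<mm> \<Longrightarrow> a \<in> Units R"
begin

lemma proper_ideal_subset:
  assumes I: "ideal I R" "I \<noteq> carrier R" shows "I \<subseteq> \<mm>"
proof
  interpret I: ideal I R by (rule I(1))
  fix a assume a: "a \<in> I"
  show "a \<in> \<mm>"
  proof (rule ccontr)
    assume "a \<notin> \<mm>"
    then have "inv a \<otimes> a = \<one>" "inv a \<in> carrier R"
      using unitI[OF I.Icarr[OF a]] by auto
    then have "\<one> \<in> I"
      using I.I_l_closed[OF a] by metis
    then show False
      using I.one_imp_carrier I(2) by auto
  qed
qed

lemma maximalideal_iff: "maximalideal I R \<longleftrightarrow> I = \<mm>"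
proof
  assume I: "maximalideal I R"
  interpret maximalideal I R by (rule I)
  have "I \<subseteq> \<mm>"
    using proper_ideal_subset I_notcarr is_ideal by auto
  then show "I = \<mm>"
    using I_maximal[OF m_ideal] ideal.Icarr[OF m_ideal] m_proper by blast
next
  assume "I = \<mm>"
  then show "maximalideal I R"
    using m_ideal m_proper proper_ideal_subset by (auto intro!: maximalidealI)
qed

lemma max_ideal_eq: "max_ideal R = \<mm>"
  by (simp add: max_ideal_def maximalideal_iff)

lemma local_noetherian: "noetherian_ring R \<Longrightarrow> local_noetherian_ring R"
  by (auto simp: local_noetherian_ring_def maximalideal_iff is_cring)

text \<open>A finite generating set of minimal cardinality gives a cover \<open>R\<^sup>n \<rightarrow> N\<close> whose kernel
  lies in \<open>\<mm>R\<^sup>n\<close>: a unit coordinate of an element of the kernel would make a generator redundant.\<close>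

lemma minimal_cover:
  assumes N: "fg_module R N"
  shows "\<exists>n f. f \<in> module_hom R (free_module R n) N \<and> f ` carrier (free_module R n) = carrier N \<and>
    (\<forall>v\<in>carrier (free_module R n). f v = \<zero>\<^bsub>N\<^esub> \<longrightarrow> (\<forall>i. v i \<in> \<mm>))"
proof -
  interpret N: module R N using N by (simp add: fg_module_def)
  let ?P = "\<lambda>k S. S \<subseteq> carrier N \<and> finite S \<and> card S = k \<and> span_of R N S = carrier N"
  define k where "k = (LEAST k. \<exists>S. ?P k S)"
  have "\<exists>k S. ?P k S"
    using N by (auto simp: fg_module_def)
  then have "\<exists>S. ?P k S"
    unfolding k_def by (rule LeastI_ex)
  then obtain S where S: "S \<subseteq> carrier N" "finite S" "card S = k" "span_of R N S = carrier N"
    by auto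
  obtain z where "bij_betw z {..<k} S"
    using ex_bij_betw_nat_finite[OF S(2)] S(3) by (auto simp: atLeast0LessThan)
  then have z: "z ` {..<k} = S"
    by (auto simp: bij_betw_def)
  then have zN: "\<And>s. s < k \<Longrightarrow> z s \<in> carrier N"
    using S(1) by auto
  interpret f: linear_map R "free_module R k" N "free_map N k z"
    by (rule N.free_linear_map[OF N.free_map_hom[OF zN]])
  have "v s \<in> \<mm>" if v: "v \<in> carrier (free_module R k)" and ker: "free_map N k z v = \<zero>\<^bsub>N\<^esub>" for v s
  proof (rule ccontr)
    assume s: "v s \<notin> \<mm>"
    note vD = v[unfolded free_module_mem]
    have "s < k"
      using s vD additive_subgroup.zero_closed[OF ideal.axioms(1)[OF m_ideal]] by (metis leI)
    have unit: "v s \<in> Units R"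
      using unitI s vD by auto
    define T where "T = z ` ({..<k} - {s})"
    have T: "T \<subseteq> carrier N" "finite T"
      using zN by (auto simp: T_def)
    note H = N.span_of_submodule[OF T(1)]
    note HD = N.submoduleD[OF H]
    have "free_map N k z (v(s := \<zero>)) \<in> span_of R N T"
    proof -
      have mem: "(v(s := \<zero>)) t \<odot>\<^bsub>N\<^esub> z t \<in> span_of R N T" if "t < k" for t
        using that vD HD(2,5) zN N.span_of_superset[of T] by (cases "t = s") (auto simp: T_def)
      have "(\<Oplus>\<^bsub>N\<^esub>t\<in>A. (v(s := \<zero>)) t \<odot>\<^bsub>N\<^esub> z t) \<in> span_of R N T" if "finite A" "A \<subseteq> {..<k}" for A
        using that
      proof (induction A rule: finite_induct)
        case (insert t A)
        then have "(\<Oplus>\<^bsub>N\<^esub>t\<in>insert t A. (v(s := \<zero>)) t \<odot>\<^bsub>N\<^esub> z t)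
            = (v(s := \<zero>)) t \<odot>\<^bsub>N\<^esub> z t \<oplus>\<^bsub>N\<^esub> (\<Oplus>\<^bsub>N\<^esub>t\<in>A. (v(s := \<zero>)) t \<odot>\<^bsub>N\<^esub> z t)"
          using mem HD(6) by (intro N.M.finsum_insert) (auto simp: Pi_def subset_iff)
        then show ?case
          using insert mem HD(3) by auto
      qed (use HD(2) in simp)
      then show ?thesis
        by (auto simp: free_map_def)
    qed
    moreover have "free_map N k z v = free_map N k z (v(s := \<zero>)) \<oplus>\<^bsub>N\<^esub> v s \<odot>\<^bsub>N\<^esub> z s"
    proof -
      have mem: "v(s := \<zero>) \<in> carrier (free_module R k)"
        "(\<lambda>i. v s \<otimes> unit_vector R s i) \<in> carrier (free_module R k)"
        using vD \<open>s < k\<close> by (auto simp: free_module_mem unit_vector_def)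
      have "v = v(s := \<zero>) \<oplus>\<^bsub>free_module R k\<^esub> (\<lambda>i. v s \<otimes> unit_vector R s i)"
        using vD by (auto simp: free_module_simps unit_vector_def)
      then have "free_map N k z v = free_map N k z (v(s := \<zero>))
          \<oplus>\<^bsub>N\<^esub> free_map N k z (v s \<odot>\<^bsub>free_module R k\<^esub> unit_vector R s)"
        using f.add[OF mem] by (simp add: free_module_simps)
      then show ?thesis
        using f.smult[of "v s" "unit_vector R s"] vD \<open>s < k\<close> unit_vector_mem[of s k]
          N.free_map_unit_vector[OF zN \<open>s < k\<close>] by simp
    qed
    \<comment> \<open>the relation \<open>v\<close> expresses \<open>z s\<close> by the other generators, since \<open>v s\<close> is invertible\<close>
    ultimately have "\<ominus>\<^bsub>N\<^esub> free_map N k z (v(s := \<zero>)) \<in> span_of R N T"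
      "\<ominus>\<^bsub>N\<^esub> free_map N k z (v(s := \<zero>)) = v s \<odot>\<^bsub>N\<^esub> z s"
      using ker N.submoduleE(3)[OF H] HD(6) vD zN[OF \<open>s < k\<close>]
      by (auto intro!: N.M.minus_equality simp: N.M.a_comm)
    then have "inv (v s) \<odot>\<^bsub>N\<^esub> (v s \<odot>\<^bsub>N\<^esub> z s) \<in> span_of R N T"
      using HD(5) unit by auto
    moreover have "inv (v s) \<odot>\<^bsub>N\<^esub> (v s \<odot>\<^bsub>N\<^esub> z s) = z s"
      using unit vD zN[OF \<open>s < k\<close>] by (simp flip: N.smult_assoc1)
    ultimately have "S \<subseteq> span_of R N T"
      using z N.span_of_superset[of T] by (auto simp: T_def)
    then have "span_of R N T = carrier N"
      using N.span_of_least[OF H] S(4) HD(1) by auto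
    then have "k \<le> card T"
      unfolding k_def using T by (intro Least_le) auto
    moreover have "card T \<le> card ({..<k} - {s})"
      unfolding T_def by (rule card_image_le) simp
    ultimately show False
      using \<open>s < k\<close> by simp
  qed
  moreover have "free_map N k z ` carrier (free_module R k) = carrier N"
    using N.free_map_image[OF zN] z S(4) by simp
  ultimately show ?thesis
    using f.hom by blast
qed

end

text \<open>A nonunit lies in an ideal that is maximal among the ideals avoiding \<open>\<one>\<close>; such an ideal is
  maximal, hence the unique maximal ideal. Unions of chains of ideals are harmless because the
  chains become stationary.\<close>

lemma local_cring_max_ideal:
  fixes R (structure)
  assumes "local_noetherian_ring R"
  shows "local_cring R (max_ideal R)"
proof -
  interpret cring R using assms by (simp add: local_noetherian_ring_def)
  interpret noetherian_ring R using assms by (simp add: local_noetherian_ring_def)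
  have unique: "\<exists>!\<mm>. maximalideal \<mm> R"
    using assms by (simp add: local_noetherian_ring_def)
  then have max: "maximalideal (max_ideal R) R"
    unfolding max_ideal_def by (rule theI')
  then interpret maximalideal "max_ideal R" R .
  show ?thesis
  proof (intro local_cring.intro local_cring_axioms.intro is_cring is_ideal I_notcarr[symmetric])
    fix a assume a: "a \<in> carrier R" "a \<notin> max_ideal R"
    show "a \<in> Units R"
    proof (rule ccontr)
      assume nonunit: "a \<notin> Units R"
      let ?A = "{I. ideal I R \<and> a \<in> I \<and> \<one> \<notin> I}"
      have "\<one> \<notin> PIdl a"
      proof
        assume "\<one> \<in> PIdl a"
        then obtain b where "b \<in> carrier R" "\<one> = b \<otimes> a"
          by (auto simp: cgenideal_def)
        then show False
          using a(1) nonunit m_comm[of b a] by (auto simp: Units_def)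
      qed
      then have "?A \<noteq> {}"
        using a cgenideal_ideal[of a] cgenideal_self[of a] by blast
      moreover have "\<Union>C \<in> ?A" if C: "C \<noteq> {}" "subset.chain ?A C" for C
      proof -
        have "subset.chain {I. ideal I R} C"
          using C(2) by (auto simp: pred_on.chain_def)
        then have "\<Union>C \<in> C"
          using ideal_chain_is_trivial C(1) by auto
        then show ?thesis
          using C(2) by (auto simp: pred_on.chain_def)
      qed
      ultimately have "\<exists>I\<in>?A. \<forall>K\<in>?A. I \<subseteq> K \<longrightarrow> K = I"
        by (rule subset_Zorn_nonempty)
      then obtain I where I: "I \<in> ?A" "\<And>K. K \<in> ?A \<Longrightarrow> I \<subseteq> K \<Longrightarrow> K = I"
        by blast
      have "maximalideal I R"
      proof (rule maximalidealI)
        show "carrier R \<noteq> I" using I(1) by auto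
        fix K assume K: "ideal K R" "I \<subseteq> K" "K \<subseteq> carrier R"
        show "K = I \<or> K = carrier R"
          using I K ideal.one_imp_carrier[OF K(1)] by blast
      qed (use I in auto)
      then have "I = max_ideal R"
        using unique max by blast
      then show False
        using I(1) a(2) by simp
    qed
  qed
qed

section \<open>Construction of free resolutions\<close>

text \<open>A resolution is built by iterating a cover of the kernel \<open>K\<close> of the last map. The predicate
  \<open>P\<close> is what the construction maintains about \<open>K\<close>, and \<open>Q\<close> is what is recorded about the
  differentials; \<open>a\<close> stands for additional data attached to the free modules.\<close>

lemma free_resolution_by_steps:
  assumes \<epsilon>: "\<epsilon> \<in> module_hom R (free_module R b0) M" "\<epsilon> ` carrier (free_module R b0) = carrier M"
    and init: "P 0 b0 a0 {v \<in> carrier (free_module R b0). \<epsilon> v = \<zero>\<^bsub>M\<^esub>}"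
    and step: "\<And>n b a K. P n b a K \<Longrightarrow> \<exists>b' a' d.
      d \<in> module_hom R (free_module R b') (free_module R b) \<and>
      d ` carrier (free_module R b') = K \<and> Q b a b' a' d \<and>
      P (Suc n) b' a' {v \<in> carrier (free_module R b'). d v = \<zero>\<^bsub>free_module R b\<^esub>}"
  shows "\<exists>b a d. free_resolution R M b d \<epsilon> \<and> b 0 = b0 \<and> a 0 = a0 \<and>
    (\<forall>n. P n (b n) (a n) (d n ` carrier (free_module R (b (Suc n))))) \<and>
    (\<forall>n. Q (b n) (a n) (b (Suc n)) (a (Suc n)) (d n))"
proof -
  let ?F = "\<lambda>b. carrier (free_module R b)"
  define K0 where "K0 = {v \<in> ?F b0. \<epsilon> v = \<zero>\<^bsub>M\<^esub>}"
  define next_state where "next_state = (\<lambda>(b, a, K) (b', a', K') d.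
    d \<in> module_hom R (free_module R b') (free_module R b) \<and> d ` ?F b' = K \<and> Q b a b' a' d \<and>
    K' = {v \<in> ?F b'. d v = \<zero>\<^bsub>free_module R b\<^esub>})"
  have "\<exists>f. \<forall>n. ((case f n of (b, a, K) \<Rightarrow> P n b a K) \<and> (n = 0 \<longrightarrow> f n = (b0, a0, K0))) \<and>
      (\<exists>d. next_state (f n) (f (Suc n)) d)"
  proof (rule dependent_nat_choice)
    show "\<exists>s. (case s of (b, a, K) \<Rightarrow> P 0 b a K) \<and> ((0::nat) = 0 \<longrightarrow> s = (b0, a0, K0))"
      using init by (auto simp: K0_def)
    fix s n assume s: "(case s of (b, a, K) \<Rightarrow> P n b a K) \<and> (n = 0 \<longrightarrow> s = (b0, a0, K0))"
    obtain b a K where [simp]: "s = (b, a, K)" by (cases s) auto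
    from s have "P n b a K" by simp
    from step[OF this] obtain b' a' d where d:
      "d \<in> module_hom R (free_module R b') (free_module R b)" "d ` ?F b' = K" "Q b a b' a' d"
      "P (Suc n) b' a' {v \<in> ?F b'. d v = \<zero>\<^bsub>free_module R b\<^esub>}"
      by blast
    then show "\<exists>s'. ((case s' of (b, a, K) \<Rightarrow> P (Suc n) b a K) \<and> (Suc n = 0 \<longrightarrow> s' = (b0, a0, K0))) \<and>
        (\<exists>d. next_state s s' d)"
      by (intro exI[of _ "(b', a', {v \<in> ?F b'. d v = \<zero>\<^bsub>free_module R b\<^esub>})"])
        (auto simp: next_state_def)
  qed
  then obtain f where *: "\<forall>n. ((case f n of (b, a, K) \<Rightarrow> P n b a K) \<and> (n = 0 \<longrightarrow> f n = (b0, a0, K0))) \<and>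
      (\<exists>d. next_state (f n) (f (Suc n)) d)"
    by (elim exE)
  have f: "case f n of (b, a, K) \<Rightarrow> P n b a K" "\<exists>d. next_state (f n) (f (Suc n)) d" for n
    using *[rule_format, of n] by (rule conjunct1[THEN conjunct1], rule conjunct2)
  have f0: "f 0 = (b0, a0, K0)"
    using *[rule_format, of 0] by simp
  have "\<exists>d. \<forall>n. next_state (f n) (f (Suc n)) (d n)"
    by (intro choice allI f(2))
  then obtain d where d: "\<And>n. next_state (f n) (f (Suc n)) (d n)"
    by (elim exE) auto
  define b where "b = (\<lambda>n. fst (f n))"
  define a where "a = (\<lambda>n. fst (snd (f n)))"
  define K where "K = (\<lambda>n. snd (snd (f n)))"
  have P: "P n (b n) (a n) (K n)" for n
    using f(1)[of n] by (auto simp: b_def a_def K_def split: prod.splits)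
  have D: "d n \<in> module_hom R (free_module R (b (Suc n))) (free_module R (b n))"
      "d n ` ?F (b (Suc n)) = K n" "Q (b n) (a n) (b (Suc n)) (a (Suc n)) (d n)"
      "K (Suc n) = {v \<in> ?F (b (Suc n)). d n v = \<zero>\<^bsub>free_module R (b n)\<^esub>}" for n
    using d[of n] by (auto simp: next_state_def b_def a_def K_def split: prod.splits)
  have 0: "b 0 = b0" "a 0 = a0" "K 0 = K0"
    using f0 by (auto simp: b_def a_def K_def)
  have "free_resolution R M b d \<epsilon>"
    unfolding free_resolution_def
    using \<epsilon> D(1) D(2)[of 0] D(2)[of "Suc _"] D(4) 0 by (auto simp: K0_def)
  then show ?thesis
    using P D(2,3) 0 by (intro exI[of _ b] exI[of _ a] exI[of _ d]) simp
qed

section \<open>Koszul modules over rings with a Conca generator\<close>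

lemma additive_image_subgroup:
  assumes G: "abelian_group G" and H: "abelian_group H"
    and closed: "\<And>v. v \<in> carrier G \<Longrightarrow> f v \<in> carrier H"
    and add: "\<And>v w. v \<in> carrier G \<Longrightarrow> w \<in> carrier G \<Longrightarrow> f (v \<oplus>\<^bsub>G\<^esub> w) = f v \<oplus>\<^bsub>H\<^esub> f w"
  shows "subgroup (f ` carrier G) (add_monoid H)"
proof -
  interpret group_hom "add_monoid G" "add_monoid H" f
    using closed add abelian_group.a_group[OF G] abelian_group.a_group[OF H]
    by (intro group_hom.intro group_hom_axioms.intro) (auto simp: hom_def)
  show ?thesis
    using img_is_subgroup by simp
qed

lemma homology_trivialI:
  assumes C: "abelian_group (C n)" and B: "subgroup (boundaries C d n) (add_monoid (C n))"
    and Z: "cycles C d n \<subseteq> boundaries C d n" "cycles C d n \<noteq> {}"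
  shows "carrier (homology C d n) = {\<zero>\<^bsub>homology C d n\<^esub>}"
proof -
  have "boundaries C d n +>\<^bsub>C n\<^esub> z = boundaries C d n" if "z \<in> cycles C d n" for z
    using abelian_group.a_coset_join2[OF C _ B] that Z(1) subgroup.subset[OF B] by auto
  then show ?thesis
    using Z(2) by (auto simp: homology_def quot_module_def A_RCOSETS_def' coset_restrict_carrier)
qed

lemma (in module) submodule_sum:
  assumes H: "submodule H R M" and K: "submodule K R M"
  shows "submodule {v \<oplus>\<^bsub>M\<^esub> w | v w. v \<in> H \<and> w \<in> K} R M"
proof (rule submoduleI')
  note HD = submoduleD[OF H] and KD = submoduleD[OF K]
  show "{v \<oplus>\<^bsub>M\<^esub> w | v w. v \<in> H \<and> w \<in> K} \<subseteq> carrier M"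
    using HD(6) KD(6) by auto
  show "\<zero>\<^bsub>M\<^esub> \<in> {v \<oplus>\<^bsub>M\<^esub> w | v w. v \<in> H \<and> w \<in> K}"
    using HD(2) KD(2) by (force intro: exI[of _ "\<zero>\<^bsub>M\<^esub>"])
  fix u u' assume "u \<in> {v \<oplus>\<^bsub>M\<^esub> w | v w. v \<in> H \<and> w \<in> K}" "u' \<in> {v \<oplus>\<^bsub>M\<^esub> w | v w. v \<in> H \<and> w \<in> K}"
  then obtain v w v' w' where *: "v \<in> H" "w \<in> K" "u = v \<oplus>\<^bsub>M\<^esub> w" "v' \<in> H" "w' \<in> K" "u' = v' \<oplus>\<^bsub>M\<^esub> w'"
    by auto
  then have "u \<oplus>\<^bsub>M\<^esub> u' = (v \<oplus>\<^bsub>M\<^esub> v') \<oplus>\<^bsub>M\<^esub> (w \<oplus>\<^bsub>M\<^esub> w')"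
    using HD(6) KD(6) by (simp add: M.a_ac)
  then show "u \<oplus>\<^bsub>M\<^esub> u' \<in> {v \<oplus>\<^bsub>M\<^esub> w | v w. v \<in> H \<and> w \<in> K}"
    using * HD(3) KD(3) by blast
next
  note HD = submoduleD[OF H] and KD = submoduleD[OF K]
  fix a u assume a: "a \<in> carrier R" and "u \<in> {v \<oplus>\<^bsub>M\<^esub> w | v w. v \<in> H \<and> w \<in> K}"
  then obtain v w where *: "v \<in> H" "w \<in> K" "u = v \<oplus>\<^bsub>M\<^esub> w"
    by auto
  then have "a \<odot>\<^bsub>M\<^esub> u = a \<odot>\<^bsub>M\<^esub> v \<oplus>\<^bsub>M\<^esub> a \<odot>\<^bsub>M\<^esub> w"
    using a HD(6) KD(6) by (simp add: smult_r_distr)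
  then show "a \<odot>\<^bsub>M\<^esub> u \<in> {v \<oplus>\<^bsub>M\<^esub> w | v w. v \<in> H \<and> w \<in> K}"
    using * a HD(5) KD(5) by blast
qed

lemma (in module) smult_linear_map: "a \<in> carrier R \<Longrightarrow> linear_map R M M (\<lambda>v. a \<odot>\<^bsub>M\<^esub> v)"
  by (intro linear_map.intro linear_map_axioms.intro module_homI module_axioms)
    (auto simp: smult_r_distr R.m_comm simp flip: smult_assoc1)

text \<open>The condition on products is the inclusion \<open>\<mm>\<^sup>2 \<subseteq> x\<mm>\<close> tested on generators. Allowing \<open>x = 0\<close>
  makes the assumptions stable under passing to a quotient ring in which \<open>x\<close> vanishes.\<close>

locale conca_ring = local_cring R \<mm> for R (structure) and \<mm> :: "'a set" + fixes x :: 'a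
  assumes noetherian: "noetherian_ring R"
    and x_mem: "x \<in> \<mm>" and x_square: "x \<otimes> x = \<zero>"
    and m_square: "a \<in> \<mm> \<Longrightarrow> b \<in> \<mm> \<Longrightarrow> \<exists>c\<in>\<mm>. a \<otimes> b = x \<otimes> c"
begin

sublocale m: ideal \<mm> R by (rule m_ideal)

lemma x_carrier: "x \<in> carrier R"
  using x_mem by (rule m.Icarr)

lemma x_x_mult: "a \<in> carrier R \<Longrightarrow> x \<otimes> (x \<otimes> a) = \<zero>"
  using x_square x_carrier by (simp flip: m_assoc)

lemma power2_mem:
  assumes "a \<in> ideal_power R \<mm> (Suc (Suc 0))"
  shows "\<exists>c\<in>\<mm>. a = x \<otimes> c"
proof -
  have "a \<in> \<mm> \<cdot> \<mm>"
    using assms ideal_power_1[OF m_ideal] by simp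
  then show ?thesis
  proof (induction a rule: ideal_prod.induct)
    case (prod i j)
    then show ?case by (rule m_square)
  next
    case (sum a b)
    then obtain c d where cd: "c \<in> \<mm>" "a = x \<otimes> c" "d \<in> \<mm>" "b = x \<otimes> d"
      by auto
    then have "a \<oplus> b = x \<otimes> (c \<oplus> d)"
      using x_carrier m.Icarr by (simp add: r_distr)
    then show ?case
      using cd by (auto intro: bexI[of _ "c \<oplus> d"])
  qed
qed

text \<open>\<open>\<mm>\<^sup>3 = \<mm>(x\<mm>) = x\<mm>\<^sup>2 = x\<^sup>2\<mm> = 0\<close>.\<close>

lemma power3_zero:
  assumes "3 \<le> n" "a \<in> ideal_power R \<mm> n" shows "a = \<zero>"
proof -
  have "a \<in> ideal_power R \<mm> (Suc (Suc (Suc 0)))"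
    using assms ideal_power_subset[OF m_ideal, of 3 n] by (auto simp: numeral_3_eq_3)
  then have "a \<in> \<mm> \<cdot> ideal_power R \<mm> (Suc (Suc 0))"
    by simp
  then show ?thesis
  proof (induction a rule: ideal_prod.induct)
    case (prod a b)
    then obtain c where c: "c \<in> \<mm>" "b = x \<otimes> c" using power2_mem by blast
    then obtain d where d: "d \<in> \<mm>" "a \<otimes> c = x \<otimes> d" using m_square prod by blast
    have "a \<otimes> b = x \<otimes> (a \<otimes> c)"
      using c prod x_carrier m.Icarr by (simp add: m_lcomm)
    then show ?case
      using d x_x_mult m.Icarr by simp
  qed simp
qed

text \<open>The condition \<open>\<mm>N \<subseteq> xN + \<mm>L\<close> with \<open>xL = 0\<close>. It is designed to contain the modules annihilated
  by \<open>x\<close> and the modules \<open>\<mm>N\<close>, and to pass from a module to the kernel of its minimal cover.\<close>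

definition conca_filtered :: "('a, 'n, 'm) module_scheme \<Rightarrow> bool" where
  "conca_filtered N \<longleftrightarrow> (\<exists>L. submodule L R N \<and> (\<forall>v\<in>L. x \<odot>\<^bsub>N\<^esub> v = \<zero>\<^bsub>N\<^esub>) \<and>
     module.smult_span R N \<mm> (carrier N)
       \<subseteq> {x \<odot>\<^bsub>N\<^esub> v \<oplus>\<^bsub>N\<^esub> l | v l. v \<in> carrier N \<and> l \<in> module.smult_span R N \<mm> L})"

text \<open>What is known about the syzygies \<open>K \<subseteq> R\<^sup>n\<close> in a minimal resolution: \<open>K \<subseteq> \<mm>R\<^sup>n\<close>,
  \<open>\<mm>\<^sup>2R\<^sup>n \<subseteq> \<mm>K\<close>, and the property that reproduces these inclusions for the next syzygies.\<close>

definition syzygy_class :: "nat \<Rightarrow> (nat \<Rightarrow> 'a) set \<Rightarrow> bool" where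
  "syzygy_class n K \<longleftrightarrow> submodule K R (free_module R n) \<and> (\<forall>v\<in>K. \<forall>i. v i \<in> \<mm>) \<and>
     {v \<in> carrier (free_module R n). \<forall>i. v i \<in> ideal_power R \<mm> (Suc (Suc 0))}
       \<subseteq> module.smult_span R (free_module R n) \<mm> K \<and>
     conca_filtered ((free_module R n)\<lparr>carrier := K\<rparr>)"

lemma square_vector:
  assumes v: "v \<in> carrier (free_module R n)" "\<forall>i. v i \<in> ideal_power R \<mm> (Suc (Suc 0))"
  shows "\<exists>w\<in>carrier (free_module R n). (\<forall>i. w i \<in> \<mm>) \<and> v = (\<lambda>i. x \<otimes> w i)"
proof -
  have "\<forall>i. \<exists>c. c \<in> \<mm> \<and> v i = x \<otimes> c \<and> (n \<le> i \<longrightarrow> c = \<zero>)"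
  proof
    fix i
    show "\<exists>c. c \<in> \<mm> \<and> v i = x \<otimes> c \<and> (n \<le> i \<longrightarrow> c = \<zero>)"
    proof (cases "n \<le> i")
      case True
      then show ?thesis
        using v x_carrier by (intro exI[of _ \<zero>]) (auto simp: free_module_mem)
    next
      case False
      then show ?thesis
        using power2_mem v(2) by auto
    qed
  qed
  then obtain w where "\<And>i. w i \<in> \<mm> \<and> v i = x \<otimes> w i \<and> (n \<le> i \<longrightarrow> w i = \<zero>)"
    by metis
  then show ?thesis
    by (intro bexI[of _ w]) (auto simp: free_module_mem m.Icarr)
qed

text \<open>With \<open>P\<close> the preimage of \<open>L\<close>, the hypothesis on \<open>N\<close> lifts to \<open>\<mm>F \<subseteq> Z + xF + \<mm>P\<close>. Multiplication
  by \<open>x\<close> annihilates the middle term and moves \<open>P\<close> into \<open>Z\<close>, because \<open>x\<close> annihilates \<open>L\<close>.\<close>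

lemma kernel_syzygy_class:
  assumes N: "conca_filtered N" and f: "linear_map R (free_module R n) N f"
    and surj: "f ` carrier (free_module R n) = carrier N"
    and minimal: "\<forall>v\<in>carrier (free_module R n). f v = \<zero>\<^bsub>N\<^esub> \<longrightarrow> (\<forall>i. v i \<in> \<mm>)"
  shows "syzygy_class n {v \<in> carrier (free_module R n). f v = \<zero>\<^bsub>N\<^esub>}"
proof -
  let ?F = "free_module R n"
  interpret f: linear_map R ?F N f by (rule f)
  have mR: "\<mm> \<subseteq> carrier R" by (rule m.a_subset)
  obtain L where L: "submodule L R N" "\<And>v. v \<in> L \<Longrightarrow> x \<odot>\<^bsub>N\<^esub> v = \<zero>\<^bsub>N\<^esub>"
    "f.N.smult_span \<mm> (carrier N)
       \<subseteq> {x \<odot>\<^bsub>N\<^esub> v \<oplus>\<^bsub>N\<^esub> l | v l. v \<in> carrier N \<and> l \<in> f.N.smult_span \<mm> L}"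
    using N by (auto simp: conca_filtered_def)
  define Z where "Z = {v \<in> carrier ?F. f v = \<zero>\<^bsub>N\<^esub>}"
  define P where "P = {v \<in> carrier ?F. f v \<in> L}"
  define L' where "L' = (\<lambda>v. x \<odot>\<^bsub>?F\<^esub> v) ` P"
  have Z: "submodule Z R ?F" unfolding Z_def by (rule f.kernel_submodule)
  have P: "submodule P R ?F" unfolding P_def by (rule f.preimage_submodule[OF L(1)])
  note ZD = f.M.submoduleD[OF Z] and PD = f.M.submoduleD[OF P]
  interpret x: linear_map R ?F ?F "\<lambda>v. x \<odot>\<^bsub>?F\<^esub> v"
    by (rule f.M.smult_linear_map[OF x_carrier])
  have L': "submodule L' R ?F"
    unfolding L'_def by (rule x.image_submodule[OF P])
  have fP: "f ` P = L"
  proof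
    show "L \<subseteq> f ` P"
    proof
      fix l assume "l \<in> L"
      moreover from this have "l \<in> f ` carrier ?F"
        using surj f.N.submoduleD(6)[OF L(1)] by auto
      ultimately show "l \<in> f ` P" by (auto simp: P_def)
    qed
  qed (auto simp: P_def)
  have L'Z: "L' \<subseteq> Z"
    using x_carrier L(2) by (auto simp: L'_def P_def Z_def f.smult)
  have xL': "x \<odot>\<^bsub>?F\<^esub> v = \<zero>\<^bsub>?F\<^esub>" if "v \<in> L'" for v
    using that x_x_mult PD(6) by (auto simp: L'_def free_module_simps free_module_mem)
  \<comment> \<open>\<open>\<mm>F \<subseteq> Z + xF + \<mm>P\<close>\<close>
  have decomp: "\<exists>g\<in>carrier ?F. \<exists>p\<in>f.M.smult_span \<mm> P. (w \<ominus>\<^bsub>?F\<^esub> x \<odot>\<^bsub>?F\<^esub> g) \<ominus>\<^bsub>?F\<^esub> p \<in> Z"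
    if w: "w \<in> f.M.smult_span \<mm> (carrier ?F)" for w
  proof -
    have "f w \<in> f.N.smult_span \<mm> (carrier N)"
      using f.image_smult_span[OF mR subset_refl] w surj by auto
    then obtain v l where vl: "f w = x \<odot>\<^bsub>N\<^esub> v \<oplus>\<^bsub>N\<^esub> l" "v \<in> carrier N" "l \<in> f.N.smult_span \<mm> L"
      using L(3) by blast
    obtain g where g: "g \<in> carrier ?F" "v = f g"
      using vl(2) surj by auto
    have "l \<in> f ` f.M.smult_span \<mm> P"
      using f.image_smult_span[OF mR PD(1)] vl(3) fP by auto
    then obtain p where p: "p \<in> f.M.smult_span \<mm> P" "l = f p"
      by auto
    have carr: "w \<in> carrier ?F" "p \<in> carrier ?F"
      using w p f.M.submoduleD(6)[OF f.M.smult_span_submodule[OF mR]] PD(1) by blast+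
    have "f ((w \<ominus>\<^bsub>?F\<^esub> x \<odot>\<^bsub>?F\<^esub> g) \<ominus>\<^bsub>?F\<^esub> p) = (f w \<ominus>\<^bsub>N\<^esub> x \<odot>\<^bsub>N\<^esub> f g) \<ominus>\<^bsub>N\<^esub> f p"
      using carr g x_carrier by (simp add: f.diff f.smult)
    also have "\<dots> = \<zero>\<^bsub>N\<^esub>"
      using carr g x_carrier f.closed unfolding vl(1) g(2) p(2) a_minus_def
      by (simp add: f.N.M.a_ac f.N.M.r_neg f.N.M.r_neg1 f.N.M.r_neg2)
    finally show ?thesis
      using carr g p x_carrier by (intro bexI[of _ g] bexI[of _ p]) (auto simp: Z_def)
  qed
  \<comment> \<open>Multiplying by \<open>x\<close>: \<open>\<mm>\<^sup>2F = x\<mm>F \<subseteq> xZ + \<mm>L'\<close>.\<close>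
  have square: "\<exists>z\<in>Z. \<exists>l\<in>f.M.smult_span \<mm> L'. v = x \<odot>\<^bsub>?F\<^esub> z \<oplus>\<^bsub>?F\<^esub> l"
    if v: "v \<in> carrier ?F" "\<forall>i. v i \<in> ideal_power R \<mm> (Suc (Suc 0))" for v
  proof -
    obtain w where w: "w \<in> carrier ?F" "\<forall>i. w i \<in> \<mm>" "v = x \<odot>\<^bsub>?F\<^esub> w"
      using square_vector[OF v] by (auto simp: free_module_simps)
    have "w \<in> f.M.smult_span \<mm> (carrier ?F)"
      using ideal_smult_free_module[OF m_ideal, of n] w by (simp flip: f.M.ideal_smult_eq)
    from decomp[OF this] obtain g p where gp: "g \<in> carrier ?F" "p \<in> f.M.smult_span \<mm> P"
      "(w \<ominus>\<^bsub>?F\<^esub> x \<odot>\<^bsub>?F\<^esub> g) \<ominus>\<^bsub>?F\<^esub> p \<in> Z"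
      by auto
    have carr: "p \<in> carrier ?F"
      using gp f.M.submoduleD(6)[OF f.M.smult_span_submodule[OF mR]] PD(1) by blast
    have "x \<odot>\<^bsub>?F\<^esub> p \<in> f.M.smult_span \<mm> L'"
      using x.image_smult_span[OF mR PD(1)] gp(2) unfolding L'_def by blast
    moreover have "v = x \<odot>\<^bsub>?F\<^esub> ((w \<ominus>\<^bsub>?F\<^esub> x \<odot>\<^bsub>?F\<^esub> g) \<ominus>\<^bsub>?F\<^esub> p) \<oplus>\<^bsub>?F\<^esub> x \<odot>\<^bsub>?F\<^esub> p"
    proof -
      have "x \<odot>\<^bsub>?F\<^esub> (x \<odot>\<^bsub>?F\<^esub> g) = \<zero>\<^bsub>?F\<^esub>"
        using gp(1) x_x_mult by (auto simp: free_module_simps free_module_mem)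
      then have "x \<odot>\<^bsub>?F\<^esub> ((w \<ominus>\<^bsub>?F\<^esub> x \<odot>\<^bsub>?F\<^esub> g) \<ominus>\<^bsub>?F\<^esub> p) = v \<ominus>\<^bsub>?F\<^esub> x \<odot>\<^bsub>?F\<^esub> p"
        using w carr gp(1) x_carrier f.M.M.add.inv_one
        by (simp add: x.diff) (simp add: a_minus_def)
      then show ?thesis
        using w carr x_carrier by (simp add: a_minus_def f.M.M.a_assoc f.M.M.l_neg)
    qed
    ultimately show ?thesis
      using gp(3) by blast
  qed
  have mZ: "submodule (f.M.smult_span \<mm> Z) R ?F"
    using f.M.smult_span_submodule[OF mR ZD(1)] .
  have "conca_filtered (?F\<lparr>carrier := Z\<rparr>)"
  proof -
    interpret Z: module R "?F\<lparr>carrier := Z\<rparr>" by (rule f.M.submodule_module[OF Z])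
    have restrict: "Z.smult_span \<mm> K = f.M.smult_span \<mm> K" if "K \<subseteq> Z" for K
      unfolding Z.smult_span_def f.M.smult_span_def
      using that ZD(5) mR by (subst f.M.span_of_restrict[OF Z, symmetric]) auto
    \<comment> \<open>\<open>\<mm>Z \<subseteq> \<mm>\<^sup>2F \<subseteq> xZ + \<mm>L'\<close>\<close>
    define H where "H = {x \<odot>\<^bsub>?F\<^esub> v \<oplus>\<^bsub>?F\<^esub> l | v l. v \<in> Z \<and> l \<in> f.M.smult_span \<mm> L'}"
    have "H = {u \<oplus>\<^bsub>?F\<^esub> l | u l. u \<in> (\<lambda>v. x \<odot>\<^bsub>?F\<^esub> v) ` Z \<and> l \<in> f.M.smult_span \<mm> L'}"
      unfolding H_def by blast
    then have H: "submodule H R ?F"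
      using f.M.submodule_sum[OF x.image_submodule[OF Z] f.M.smult_span_submodule[OF mR]]
        f.M.submoduleD(1)[OF L'] by auto
    have "f.M.smult_span \<mm> Z \<subseteq> H"
    proof (rule f.M.smult_span_least[OF H])
      fix a v assume a: "a \<in> \<mm>" and v: "v \<in> Z"
      have "a \<otimes> v i \<in> ideal_power R \<mm> (Suc (Suc 0))" for i
        using ideal_power_mult[OF m_ideal, of a "Suc 0" "v i" "Suc 0"] a v minimal
        by (simp add: ideal_power_1[OF m_ideal] Z_def del: ideal_power.simps)
      moreover have "a \<odot>\<^bsub>?F\<^esub> v \<in> carrier ?F"
        using a v ZD(6) m.Icarr by auto
      ultimately show "a \<odot>\<^bsub>?F\<^esub> v \<in> H"
        using square[of "a \<odot>\<^bsub>?F\<^esub> v"] unfolding H_def free_module_simps by blast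
    qed
    then show ?thesis
      unfolding conca_filtered_def
      using L' L'Z xL' f.M.submodule_of_submodule[OF Z] restrict[OF L'Z] restrict[of Z]
      by (intro exI[of _ L']) (auto simp: H_def)
  qed
  moreover have "{v \<in> carrier ?F. \<forall>i. v i \<in> ideal_power R \<mm> (Suc (Suc 0))} \<subseteq> f.M.smult_span \<mm> Z"
  proof
    fix v assume "v \<in> {v \<in> carrier ?F. \<forall>i. v i \<in> ideal_power R \<mm> (Suc (Suc 0))}"
    then obtain z l where "z \<in> Z" "l \<in> f.M.smult_span \<mm> L'" "v = x \<odot>\<^bsub>?F\<^esub> z \<oplus>\<^bsub>?F\<^esub> l"
      using square by blast
    then show "v \<in> f.M.smult_span \<mm> Z"
      using f.M.submoduleD(3)[OF mZ] f.M.smult_span_memI[OF x_mem] f.M.smult_span_mono[OF subset_refl L'Z]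
      by blast
  qed
  ultimately show ?thesis
    using Z minimal unfolding syzygy_class_def Z_def[symmetric] by (auto simp: Z_def)
qed

lemma conca_filtered_resolution:
  assumes fg: "fg_module R N" and N: "conca_filtered N"
  shows "\<exists>b d \<epsilon>. free_resolution R N b d \<epsilon> \<and>
    (\<forall>n. syzygy_class (b n) (d n ` carrier (free_module R (b (Suc n)))))"
proof -
  have modN: "module R N" using fg by (simp add: fg_module_def)
  obtain b0 \<epsilon> where \<epsilon>: "\<epsilon> \<in> module_hom R (free_module R b0) N"
      "\<epsilon> ` carrier (free_module R b0) = carrier N"
      "\<forall>v\<in>carrier (free_module R b0). \<epsilon> v = \<zero>\<^bsub>N\<^esub> \<longrightarrow> (\<forall>i. v i \<in> \<mm>)"
    using minimal_cover[OF fg] by blast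
  have "\<exists>b (a :: nat \<Rightarrow> unit) d. free_resolution R N b d \<epsilon> \<and> b 0 = b0 \<and> a 0 = () \<and>
      (\<forall>n. syzygy_class (b n) (d n ` carrier (free_module R (b (Suc n))))) \<and>
      (\<forall>n. (\<lambda>_ _ _ _ _. True) (b n) (a n) (b (Suc n)) (a (Suc n)) (d n))"
  proof (rule free_resolution_by_steps[where P = "\<lambda>_ n _ K. syzygy_class n K"])
    show "syzygy_class b0 {v \<in> carrier (free_module R b0). \<epsilon> v = \<zero>\<^bsub>N\<^esub>}"
      using \<epsilon> module.free_linear_map[OF modN \<epsilon>(1)] N by (intro kernel_syzygy_class) auto
  next
    fix b K assume K: "syzygy_class b K"
    interpret F: module R "free_module R b" by (rule free_module_module)
    let ?K = "(free_module R b)\<lparr>carrier := K\<rparr>"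
    have sub: "submodule K R (free_module R b)"
      using K by (simp add: syzygy_class_def)
    interpret K: module R ?K by (rule F.submodule_module[OF sub])
    obtain S where "S \<subseteq> K" "finite S" "span_of R (free_module R b) S = K"
      using noetherian_free_module[OF noetherian sub] by auto
    then have "fg_module R ?K"
      using F.span_of_restrict[OF sub] K.module_axioms by (auto simp: fg_module_def)
    from minimal_cover[OF this] obtain b' d where d: "d \<in> module_hom R (free_module R b') ?K"
        "d ` carrier (free_module R b') = K"
        "\<forall>v\<in>carrier (free_module R b'). d v = \<zero>\<^bsub>free_module R b\<^esub> \<longrightarrow> (\<forall>i. v i \<in> \<mm>)"
      by auto
    have "d \<in> module_hom R (free_module R b') (free_module R b)"
      using d(1) F.submoduleD(6)[OF sub] by (auto simp: module_hom_def)
    moreover have "syzygy_class b' {v \<in> carrier (free_module R b'). d v = \<zero>\<^bsub>free_module R b\<^esub>}"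
      using kernel_syzygy_class[of ?K b' d] K.free_linear_map[OF d(1)] d K
      by (simp add: syzygy_class_def)
    ultimately show "\<exists>b' (a' :: unit) d. d \<in> module_hom R (free_module R b') (free_module R b) \<and>
        d ` carrier (free_module R b') = K \<and> True \<and>
        syzygy_class b' {v \<in> carrier (free_module R b'). d v = \<zero>\<^bsub>free_module R b\<^esub>}"
      using d(2) by blast
  qed (use \<epsilon> in auto)
  then show ?thesis
    by blast
qed

end

context conca_ring
begin

text \<open>The inclusion \<open>\<mm>\<^sup>2R\<^sup>n \<subseteq> \<mm>K\<close> read through a cover of \<open>K\<close>, which maps \<open>\<mm>R\<^sup>n\<^sup>'\<close> onto \<open>\<mm>K\<close>.\<close>

lemma syzygy_class_lift:
  assumes K: "syzygy_class n K" and d: "linear_map R (free_module R n') (free_module R n) d"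
    and im: "d ` carrier (free_module R n') = K"
    and v: "v \<in> carrier (free_module R n)" "\<And>i. v i \<in> ideal_power R \<mm> (Suc (Suc 0))"
  shows "\<exists>u\<in>carrier (free_module R n'). (\<forall>i. u i \<in> \<mm>) \<and> d u = v"
proof -
  interpret d: linear_map R "free_module R n'" "free_module R n" d by (rule d)
  have "v \<in> d.N.smult_span \<mm> K"
    using K v by (auto simp: syzygy_class_def)
  also have "d.N.smult_span \<mm> K = d ` d.M.smult_span \<mm> (carrier (free_module R n'))"
    using d.image_smult_span[OF m.a_subset subset_refl] im by simp
  also have "d.M.smult_span \<mm> (carrier (free_module R n'))
      = {u \<in> carrier (free_module R n'). \<forall>i. u i \<in> \<mm>}"
    using ideal_smult_free_module[OF m_ideal, of n'] by (simp flip: d.M.ideal_smult_eq)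
  finally show ?thesis by auto
qed

text \<open>A cycle of the linear part in homological degree \<open>N > 0\<close> and internal degree \<open>i\<close> is represented
  by \<open>p \<in> \<mm>\<^sup>i\<^sup>-\<^sup>N F\<^sub>N\<close> with \<open>d(p) \<in> \<mm>\<^sup>i\<^sup>-\<^sup>N\<^sup>+\<^sup>2 F\<^sub>N\<^sub>-\<^sub>1\<close>, and it is a boundary if \<open>p\<close> agrees with some
  \<open>d(q)\<close>, \<open>q \<in> \<mm>\<^sup>i\<^sup>-\<^sup>N\<^sup>-\<^sup>1 F\<^sub>N\<^sub>+\<^sub>1\<close>, up to \<open>\<mm>\<^sup>i\<^sup>-\<^sup>N\<^sup>+\<^sup>1 F\<^sub>N\<close>. As \<open>\<mm>\<^sup>3 = 0\<close>, only \<open>i - N \<in> {0, 1, 2}\<close> matter.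
  For \<open>1\<close> the exactness of the resolution suffices, and for \<open>2\<close> the inclusion \<open>\<mm>\<^sup>2F\<^sub>N \<subseteq> \<mm>Z\<^sub>N\<close>. For
  \<open>0\<close> the inclusion one step below shows that \<open>p\<close> is a cycle up to \<open>\<mm>F\<^sub>N\<close>, hence lies in \<open>\<mm>F\<^sub>N\<close>.\<close>

lemma koszul_moduleI:
  assumes res: "free_resolution R N b d \<epsilon>"
    and syz: "\<And>n. syzygy_class (b n) (d n ` carrier (free_module R (b (Suc n))))"
  shows "koszul_module R N"
proof -
  define F where "F = (\<lambda>n. free_module R (b n))"
  define E where "E = lin_filtration R F"
  let ?H = "homology (lin_module R F) (lin_diff R F d)"
  have mod: "module R (F n)" for n
    unfolding F_def by (rule free_module_module)
  have d: "linear_map R (F (Suc n)) (F n) (d n)" for n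
    using res module.free_linear_map[OF mod] by (auto simp: F_def free_resolution_def)
  have exact: "v \<in> d (Suc n) ` carrier (F (Suc (Suc n)))"
    if "v \<in> carrier (F (Suc n))" "d n v = \<zero>\<^bsub>F n\<^esub>" for n v
    using res that unfolding free_resolution_def F_def by blast
  have dd: "d n (d (Suc n) v) = \<zero>\<^bsub>F n\<^esub>" if "v \<in> carrier (F (Suc (Suc n)))" for n v
    using res that unfolding free_resolution_def F_def by blast
  have minimal: "d n v i \<in> \<mm>" if "v \<in> carrier (F (Suc n))" for n v i
    using syz[of n] that by (auto simp: syzygy_class_def F_def)
  have m_lift: "\<exists>u\<in>carrier (F (Suc n)). (\<forall>i. u i \<in> \<mm>) \<and> d n u = v"
    if "v \<in> carrier (F n)" "\<And>i. v i \<in> ideal_power R \<mm> (Suc (Suc 0))" for n v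
    using syzygy_class_lift[OF syz d[unfolded F_def] refl] that by (simp add: F_def)
  have E: "E n i = {v \<in> carrier (F n). \<forall>s. v s \<in> ideal_power R \<mm> (i - n)}" for n i
    unfolding E_def lin_filtration_def F_def max_ideal_eq
    by (rule ideal_smult_free_module[OF ideal_power_ideal[OF m_ideal]])
  have E_low: "E n i = carrier (F n)" if "i \<le> n" for n i
    using that by (auto simp: E F_def free_module_mem)
  have filt: "filtration R (F n) (E n)" for n
  proof (intro filtration.intro filtration_axioms.intro mod)
    fix i
    have sub: "ideal_power R \<mm> (i - n) \<subseteq> carrier R"
      using ideal.Icarr[OF ideal_power_ideal[OF m_ideal]] by auto
    have "ideal_smult R (ideal_power R \<mm> (i - n)) (F n) = E n i"
      by (simp add: E_def lin_filtration_def max_ideal_eq)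
    then show "submodule (E n i) R (F n)"
      using module.smult_span_submodule[OF mod sub subset_refl] module.ideal_smult_eq[OF mod] by metis
    have "ideal_power R \<mm> (Suc i - n) \<subseteq> ideal_power R \<mm> (i - n)"
      by (rule ideal_power_subset[OF m_ideal]) simp
    then show "E n (Suc i) \<subseteq> E n i"
      by (auto simp: E)
  qed
  have dE: "d n v \<in> E n i" if v: "v \<in> E (Suc n) i" for n i v
  proof (cases "Suc n \<le> i")
    case False
    then show ?thesis
      using E_low[of i n] v linear_map.closed[OF d] by (auto simp: E)
  next
    case True
    interpret d: linear_map R "F (Suc n)" "F n" "d n" by (rule d)
    interpret En: filtration R "F n" "E n" by (rule filt)
    let ?I = "ideal_power R \<mm> (i - Suc n)"
    have I: "?I \<subseteq> carrier R"
      using ideal.Icarr[OF ideal_power_ideal[OF m_ideal]] by auto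
    have "d n ` E (Suc n) i = d n ` d.M.smult_span ?I (carrier (F (Suc n)))"
      by (simp add: E_def lin_filtration_def max_ideal_eq d.M.ideal_smult_eq)
    also have "\<dots> = d.N.smult_span ?I (d n ` carrier (F (Suc n)))"
      by (rule d.image_smult_span[OF I subset_refl])
    also have "\<dots> \<subseteq> E n i"
    proof (rule d.N.smult_span_least[OF En.E_submodule])
      fix a w assume a: "a \<in> ?I" and "w \<in> d n ` carrier (F (Suc n))"
      then have w: "w \<in> carrier (F n)" "\<And>s. w s \<in> \<mm>"
        using minimal d.closed by auto
      have *: "a \<otimes> w s \<in> ideal_power R \<mm> (i - Suc n + Suc 0)" for s
        using w(2) a by (intro ideal_power_mult m_ideal) (simp_all add: ideal_power_1 m_ideal del: ideal_power.simps)
      have "i - Suc n + Suc 0 = i - n"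
        using True by simp
      note *[unfolded this]
      moreover have "a \<odot>\<^bsub>F n\<^esub> w \<in> carrier (F n)"
        using a I w by auto
      ultimately show "a \<odot>\<^bsub>F n\<^esub> w \<in> E n i"
        by (auto simp: E F_def free_module_simps)
    qed
    finally show ?thesis using v by blast
  qed
  have d_reps: "(\<lambda>i. d n (p i)) \<in> gr_reps (F n) (E n)" if p: "p \<in> gr_reps (F (Suc n)) (E (Suc n))" for n p
  proof -
    interpret En: filtration R "F (Suc n)" "E (Suc n)" by (rule filt)
    have "{i. d n (p i) \<noteq> \<zero>\<^bsub>F n\<^esub>} \<subseteq> {i. p i \<noteq> \<zero>\<^bsub>F (Suc n)\<^esub>}"
      using linear_map.zero[OF d] by auto
    then show ?thesis
      using dE En.gr_repsD[OF p] by (auto simp: gr_reps_def intro: finite_subset)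
  qed
  have lin: "lin_diff R F d n (gr_class (F (Suc n)) (E (Suc n)) p) = gr_class (F n) (E n) (\<lambda>i. d n (p i))"
    if p: "p \<in> gr_reps (F (Suc n)) (E (Suc n))" for n p
  proof -
    interpret En: filtration R "F (Suc n)" "E (Suc n)" by (rule filt)
    interpret En': filtration R "F n" "E n" by (rule filt)
    show ?thesis
      using linear_map.quot_map_coset[OF d En.E_submodule En'.E_submodule _ En.gr_repsD(3)[OF p]] dE
      by (auto simp: lin_diff_def gr_class_def E_def[symmetric] image_subset_iff)
  qed
  have lin_module: "lin_module R F n = assoc_gr (F n) (E n)" for n
    by (simp add: lin_module_def E_def)
  have "carrier (?H (Suc n)) = {\<zero>\<^bsub>?H (Suc n)\<^esub>}" for n
  proof (rule homology_trivialI)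
    let ?N = "Suc n"
    interpret E0: filtration R "F n" "E n" by (rule filt)
    interpret E1: filtration R "F ?N" "E ?N" by (rule filt)
    interpret E2: filtration R "F (Suc ?N)" "E (Suc ?N)" by (rule filt)
    interpret d0: linear_map R "F ?N" "F n" "d n" by (rule d)
    interpret d1: linear_map R "F (Suc ?N)" "F ?N" "d ?N" by (rule d)
    show "abelian_group (lin_module R F ?N)"
      unfolding lin_module by (rule E1.gr_abelian_group)
    show "subgroup (boundaries (lin_module R F) (lin_diff R F d) ?N) (add_monoid (lin_module R F ?N))"
      unfolding boundaries_def lin_module
    proof (rule additive_image_subgroup[OF E2.gr_abelian_group E1.gr_abelian_group])
      fix f assume "f \<in> carrier (assoc_gr (F (Suc ?N)) (E (Suc ?N)))"
      then obtain p where p: "p \<in> gr_reps (F (Suc ?N)) (E (Suc ?N))"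
          "f = gr_class (F (Suc ?N)) (E (Suc ?N)) p"
        by (auto simp: E2.gr_carrier)
      then show "lin_diff R F d ?N f \<in> carrier (assoc_gr (F ?N) (E ?N))"
        using lin[OF p(1)] d_reps[OF p(1)] by (auto simp: E1.gr_carrier)
      fix g assume "g \<in> carrier (assoc_gr (F (Suc ?N)) (E (Suc ?N)))"
      then obtain q where q: "q \<in> gr_reps (F (Suc ?N)) (E (Suc ?N))"
          "g = gr_class (F (Suc ?N)) (E (Suc ?N)) q"
        by (auto simp: E2.gr_carrier)
      show "lin_diff R F d ?N (f \<oplus>\<^bsub>assoc_gr (F (Suc ?N)) (E (Suc ?N))\<^esub> g)
          = lin_diff R F d ?N f \<oplus>\<^bsub>assoc_gr (F ?N) (E ?N)\<^esub> lin_diff R F d ?N g"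
        using E2.gr_repsD(3)[OF p(1)] E2.gr_repsD(3)[OF q(1)]
        by (simp add: p(2) q(2) E2.gr_add[OF p(1) q(1)] lin[OF p(1)] lin[OF q(1)]
            lin[OF E2.gr_reps_add[OF p(1) q(1)]] E1.gr_add[OF d_reps[OF p(1)] d_reps[OF q(1)]] d1.add)
    qed
    have zero_cycle: "\<zero>\<^bsub>assoc_gr (F ?N) (E ?N)\<^esub> \<in> cycles (lin_module R F) (lin_diff R F d) ?N"
      using E1.gr_reps_zero lin[OF E1.gr_reps_zero] d0.zero
      by (simp add: cycles_def lin_module E1.gr_zero E0.gr_zero E1.gr_carrier)
    then show "cycles (lin_module R F) (lin_diff R F d) ?N \<noteq> {}"
      by auto
    show "cycles (lin_module R F) (lin_diff R F d) ?N \<subseteq> boundaries (lin_module R F) (lin_diff R F d) ?N"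
    proof
      fix f assume "f \<in> cycles (lin_module R F) (lin_diff R F d) ?N"
      then obtain p where p: "p \<in> gr_reps (F ?N) (E ?N)" "f = gr_class (F ?N) (E ?N) p"
        and cycle: "gr_class (F n) (E n) (\<lambda>i. d n (p i)) = gr_class (F n) (E n) (\<lambda>_. \<zero>\<^bsub>F n\<^esub>)"
        using lin[of _ n] by (auto simp: cycles_def lin_module E1.gr_carrier E0.gr_zero)
      have pE: "p i \<in> E ?N i" "p i \<in> carrier (F ?N)" for i
        using E1.gr_repsD[OF p(1)] by auto
      have dp: "d n (p i) \<in> E n (Suc i)" for i
        using cycle E0.gr_class_eq_iff[of "\<lambda>i. d n (p i)" "\<lambda>_. \<zero>\<^bsub>F n\<^esub>"]
          dE[OF pE(1)] E0.E_zero d0.closed[OF pE(2)] E0.coset_eq_self_iff[OF E0.E_submodule]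
        by (simp add: gr_class_def fun_eq_iff E0.coset_eq_self_iff[OF E0.E_submodule]
              E0.M.a_coset_add_zero E0.submoduleD(1)[OF E0.E_submodule])
      have "\<exists>q. q \<in> E (Suc ?N) i \<and> p i \<ominus>\<^bsub>F ?N\<^esub> d ?N q \<in> E ?N (Suc i) \<and>
          (p i = \<zero>\<^bsub>F ?N\<^esub> \<longrightarrow> q = \<zero>\<^bsub>F (Suc ?N)\<^esub>)" for i
      proof -
        have triv: ?thesis if "p i \<in> E ?N (Suc i)"
          using that pE[of i] E2.E_zero d1.zero E1.E_zero E1.E_diff
          by (intro exI[of _ "\<zero>\<^bsub>F (Suc ?N)\<^esub>"]) auto
        have exact_triv: ?thesis if "q \<in> E (Suc ?N) i" "d ?N q = p i" "p i \<noteq> \<zero>\<^bsub>F ?N\<^esub>" for q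
          using that pE[of i] E1.E_zero by (intro exI[of _ q]) (auto simp: a_minus_def E1.M.r_neg)
        consider "p i = \<zero>\<^bsub>F ?N\<^esub>" | "i < ?N" | "i = ?N" | "p i \<noteq> \<zero>\<^bsub>F ?N\<^esub>" "i = Suc ?N"
          | "p i \<noteq> \<zero>\<^bsub>F ?N\<^esub>" "i = Suc (Suc ?N)" | "i \<ge> ?N + 3"
          by linarith
        then show ?thesis
        proof cases
          case 1
          then show ?thesis using triv E1.E_zero by simp
        next
          case 2
          then show ?thesis using triv E_low[of "Suc i" ?N] pE(2) by simp
        next
          case 3
          \<comment> \<open>\<open>d(p) \<in> \<mm>\<^sup>2F\<^sub>n\<close> is the image of some \<open>u \<in> \<mm>F\<^sub>n\<^sub>+\<^sub>1\<close>, and \<open>p - u\<close> is a boundary, hence in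
            \<open>\<mm>F\<^sub>n\<^sub>+\<^sub>1\<close> by minimality\<close>
          have "d n (p i) \<in> carrier (F n)" "\<And>s. d n (p i) s \<in> ideal_power R \<mm> (Suc (Suc 0))"
            using dp[of i] 3 by (auto simp: E numeral_2_eq_2)
          from m_lift[OF this] obtain u where u: "u \<in> carrier (F ?N)" "\<And>s. u s \<in> \<mm>" "d n u = d n (p i)"
            by auto
          have "d n (p i \<ominus>\<^bsub>F ?N\<^esub> u) = \<zero>\<^bsub>F n\<^esub>"
            using u pE d0.closed by (simp add: d0.diff) (simp add: a_minus_def E0.M.r_neg)
          then obtain y where y: "y \<in> carrier (F (Suc ?N))" "p i \<ominus>\<^bsub>F ?N\<^esub> u = d ?N y"
            using exact[of "p i \<ominus>\<^bsub>F ?N\<^esub> u" n] u(1) pE by auto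
          have "u \<in> E ?N (Suc i)" "d ?N y \<in> E ?N (Suc i)"
            using u 3 minimal[OF y(1)] d1.closed[OF y(1)]
            by (auto simp: E ideal_power_1 m_ideal Suc_diff_le simp del: ideal_power.simps)
          then have "(p i \<ominus>\<^bsub>F ?N\<^esub> u) \<oplus>\<^bsub>F ?N\<^esub> u \<in> E ?N (Suc i)"
            using y(2) E1.E_add by auto
          then show ?thesis
            using triv pE u(1) by (simp add: a_minus_def E1.M.a_assoc E1.M.l_neg)
        next
          case 4
          have "\<forall>s. d n (p i) s = \<zero>"
            using dp[of i] 4 power3_zero[of 3] by (auto simp: E numeral_3_eq_3)
          then have "d n (p i) = \<zero>\<^bsub>F n\<^esub>"
            by (auto simp: F_def free_module_simps)
          then obtain q where "q \<in> carrier (F (Suc ?N))" "p i = d ?N q"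
            using exact[OF pE(2)] by auto
          then show ?thesis
            using exact_triv[of q] 4 E_low[of i "Suc ?N"] by auto
        next
          case 5
          have "p i \<in> carrier (F ?N)" "\<And>s. p i s \<in> ideal_power R \<mm> (Suc (Suc 0))"
            using pE(1)[of i] 5 by (auto simp: E numeral_2_eq_2)
          from m_lift[OF this] obtain q where "q \<in> carrier (F (Suc ?N))" "\<And>s. q s \<in> \<mm>" "d ?N q = p i"
            by auto
          then show ?thesis
            using exact_triv[of q] 5
            by (auto simp: E ideal_power_1 m_ideal Suc_diff_le simp del: ideal_power.simps)
        next
          case 6
          then have "\<forall>s. p i s = \<zero>"
            using pE(1)[of i] power3_zero[of "i - ?N"] by (auto simp: E)
          then have "p i = \<zero>\<^bsub>F ?N\<^esub>"
            by (auto simp: F_def free_module_simps)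
          then show ?thesis using triv E1.E_zero by simp
        qed
      qed
      then obtain q where q: "\<And>i. q i \<in> E (Suc ?N) i" "\<And>i. p i \<ominus>\<^bsub>F ?N\<^esub> d ?N (q i) \<in> E ?N (Suc i)"
          "\<And>i. p i = \<zero>\<^bsub>F ?N\<^esub> \<Longrightarrow> q i = \<zero>\<^bsub>F (Suc ?N)\<^esub>"
        by metis
      have "{i. q i \<noteq> \<zero>\<^bsub>F (Suc ?N)\<^esub>} \<subseteq> {i. p i \<noteq> \<zero>\<^bsub>F ?N\<^esub>}"
        using q(3) by auto
      then have q_reps: "q \<in> gr_reps (F (Suc ?N)) (E (Suc ?N))"
        using q(1) E1.gr_repsD(2)[OF p(1)] by (auto simp: gr_reps_def intro: finite_subset)
      have "f = lin_diff R F d ?N (gr_class (F (Suc ?N)) (E (Suc ?N)) q)"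
        using E1.gr_class_eq_iff[of p "\<lambda>i. d ?N (q i)"] pE(1) dE q
        by (simp add: p(2) lin[OF q_reps])
      then show "f \<in> boundaries (lin_module R F) (lin_diff R F d) ?N"
        using q_reps by (auto simp: boundaries_def lin_module E2.gr_carrier)
    qed
  qed
  then have H: "\<forall>i>0. carrier (?H i) = {\<zero>\<^bsub>?H i\<^esub>}"
    by (metis gr0_implies_Suc)
  have "minimal_free_resolution R N b d \<epsilon>"
    unfolding minimal_free_resolution_def minimal_complex_def max_ideal_eq
    using res minimal linear_map.closed[OF d] ideal_smult_free_module[OF m_ideal]
    by (auto simp: F_def)
  then show ?thesis
    using H unfolding koszul_module_def Let_def F_def by blast
qed

lemma conca_filtered_koszul: "fg_module R N \<Longrightarrow> conca_filtered N \<Longrightarrow> koszul_module R N"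
  using conca_filtered_resolution koszul_moduleI by blast

end

section \<open>Modules and quotient rings covered by the criterion\<close>

lemma (in ring_hom_ring) noetherian_image:
  assumes noeth: "noetherian_ring R" and surj: "h ` carrier R = carrier S"
  shows "noetherian_ring S"
proof (rule S.noetherian_ringI)
  fix J assume J: "ideal J S"
  have J_S: "J \<subseteq> carrier S"
    using ideal.Icarr[OF J] by auto
  obtain A where A: "A \<subseteq> carrier R" "finite A" "{r \<in> carrier R. h r \<in> J} = Idl A"
    using noetherian_ring.finetely_gen[OF noeth ideal_vimage[OF J]] by auto
  have hA: "h ` A \<subseteq> J"
    using A R.genideal_self[OF A(1)] by auto
  have "ideal (Idl\<^bsub>S\<^esub> (h ` A)) S"
    using hA J_S by (intro S.genideal_ideal) auto
  then have "ideal {r \<in> carrier R. h r \<in> Idl\<^bsub>S\<^esub> (h ` A)} R"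
    by (rule ideal_vimage)
  moreover have "A \<subseteq> {r \<in> carrier R. h r \<in> Idl\<^bsub>S\<^esub> (h ` A)}"
    using A(1) hA J_S S.genideal_self[of "h ` A"] by auto
  ultimately have incl: "Idl A \<subseteq> {r \<in> carrier R. h r \<in> Idl\<^bsub>S\<^esub> (h ` A)}"
    by (rule R.genideal_minimal)
  have "J \<subseteq> Idl\<^bsub>S\<^esub> (h ` A)"
  proof
    fix s assume s: "s \<in> J"
    then obtain r where "r \<in> carrier R" "s = h r"
      using J_S surj by auto
    then show "s \<in> Idl\<^bsub>S\<^esub> (h ` A)"
      using s A(3) incl by blast
  qed
  then show "\<exists>A\<subseteq>carrier S. finite A \<and> J = Idl\<^bsub>S\<^esub> A"
    using hA J_S A(2) S.genideal_minimal[OF J hA] by (intro exI[of _ "h ` A"]) auto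
qed

context conca_ring
begin

text \<open>Take \<open>L = N\<close>.\<close>

lemma conca_filtered_if_annihilated:
  assumes "module R N" and "\<And>v. v \<in> carrier N \<Longrightarrow> x \<odot>\<^bsub>N\<^esub> v = \<zero>\<^bsub>N\<^esub>"
  shows "conca_filtered N"
proof -
  interpret N: module R N by fact
  have "N.smult_span \<mm> (carrier N) \<subseteq> carrier N"
    using N.submoduleD(1)[OF N.smult_span_submodule[OF m.a_subset subset_refl]] .
  then have "v = x \<odot>\<^bsub>N\<^esub> \<zero>\<^bsub>N\<^esub> \<oplus>\<^bsub>N\<^esub> v" if "v \<in> N.smult_span \<mm> (carrier N)" for v
    using that x_carrier by auto
  then show ?thesis
    unfolding conca_filtered_def using assms(2) N.carrier_is_submodule by blast
qed

text \<open>Take \<open>L = 0\<close>: the condition becomes \<open>\<mm>(\<mm>N) \<subseteq> x(\<mm>N)\<close>, which follows from \<open>\<mm>\<^sup>2 \<subseteq> x\<mm>\<close>.\<close>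

lemma conca_filtered_m_smult:
  assumes "module R N"
  shows "conca_filtered (N\<lparr>carrier := ideal_smult R \<mm> N\<rparr>)"
proof -
  interpret N: module R N by fact
  define K where "K = N.smult_span \<mm> (carrier N)"
  have K: "submodule K R N"
    unfolding K_def by (rule N.smult_span_submodule[OF m.a_subset subset_refl])
  note KD = N.submoduleD[OF K]
  interpret K: module R "N\<lparr>carrier := K\<rparr>" by (rule N.submodule_module[OF K])
  interpret x: linear_map R N N "\<lambda>v. x \<odot>\<^bsub>N\<^esub> v" by (rule N.smult_linear_map[OF x_carrier])
  let ?xK = "(\<lambda>v. x \<odot>\<^bsub>N\<^esub> v) ` K"
  have xK: "submodule ?xK R N"
    by (rule x.image_submodule[OF K])
  have "N.smult_span \<mm> K \<subseteq> ?xK"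
  proof (rule N.smult_span_least[OF xK])
    fix a v assume a: "a \<in> \<mm>" and v: "v \<in> K"
    \<comment> \<open>\<open>a(bw) = (xc)w\<close> for suitable \<open>c \<in> \<mm>\<close>\<close>
    have "K \<subseteq> {v \<in> carrier N. a \<odot>\<^bsub>N\<^esub> v \<in> ?xK}"
      unfolding K_def
    proof (rule N.smult_span_least)
      show "submodule {v \<in> carrier N. a \<odot>\<^bsub>N\<^esub> v \<in> (\<lambda>v. x \<odot>\<^bsub>N\<^esub> v) ` N.smult_span \<mm> (carrier N)} R N"
        using linear_map.preimage_submodule[OF N.smult_linear_map[OF m.Icarr[OF a]] xK]
        by (simp add: K_def)
      fix b w assume b: "b \<in> \<mm>" and w: "w \<in> carrier N"
      obtain c where c: "c \<in> \<mm>" "a \<otimes> b = x \<otimes> c"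
        using m_square[OF a b] by auto
      have "a \<odot>\<^bsub>N\<^esub> (b \<odot>\<^bsub>N\<^esub> w) = x \<odot>\<^bsub>N\<^esub> (c \<odot>\<^bsub>N\<^esub> w)"
        using a b c w x_carrier m.Icarr by (simp flip: N.smult_assoc1)
      then show "b \<odot>\<^bsub>N\<^esub> w \<in> {v \<in> carrier N. a \<odot>\<^bsub>N\<^esub> v \<in> (\<lambda>v. x \<odot>\<^bsub>N\<^esub> v) ` N.smult_span \<mm> (carrier N)}"
        using b w c m.Icarr N.smult_span_memI[of c \<mm> w "carrier N"] by auto
    qed
    then show "a \<odot>\<^bsub>N\<^esub> v \<in> ?xK"
      using v by blast
  qed
  moreover have "K.smult_span \<mm> K = N.smult_span \<mm> K"
    unfolding K.smult_span_def N.smult_span_def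
    using KD(5) m.Icarr by (subst N.span_of_restrict[OF K, symmetric]) auto
  moreover have "\<zero>\<^bsub>N\<^esub> \<in> K.smult_span \<mm> {\<zero>\<^bsub>N\<^esub>}"
    using K.submoduleD(2)[OF K.smult_span_submodule[OF m.a_subset]] KD(2) by auto
  ultimately have "K.smult_span \<mm> K
      \<subseteq> {x \<odot>\<^bsub>N\<^esub> v \<oplus>\<^bsub>N\<^esub> l | v l. v \<in> K \<and> l \<in> K.smult_span \<mm> {\<zero>\<^bsub>N\<^esub>}}"
    using KD(6) x_carrier by (force intro: exI[of _ "\<zero>\<^bsub>N\<^esub>"])
  then have "conca_filtered (N\<lparr>carrier := K\<rparr>)"
    unfolding conca_filtered_def using K.zero_submodule x_carrier
    by (intro exI[of _ "{\<zero>\<^bsub>N\<^esub>}"]) auto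
  then show ?thesis
    by (simp add: K_def N.ideal_smult_eq)
qed

lemma fg_module_m_smult:
  assumes "fg_module R N"
  shows "fg_module R (N\<lparr>carrier := ideal_smult R \<mm> N\<rparr>)"
proof -
  interpret N: module R N using assms by (simp add: fg_module_def)
  have K: "submodule (ideal_smult R \<mm> N) R N"
    unfolding N.ideal_smult_eq by (rule N.smult_span_submodule[OF m.a_subset subset_refl])
  obtain S where S: "S \<subseteq> ideal_smult R \<mm> N" "finite S" "span_of R N S = ideal_smult R \<mm> N"
    using N.noetherian_submodule_fg[OF noetherian assms K] by auto
  then have "span_of R (N\<lparr>carrier := ideal_smult R \<mm> N\<rparr>) S = ideal_smult R \<mm> N"
    using N.span_of_restrict[OF K] by simp
  then show ?thesis
    using S N.submodule_module[OF K] by (auto simp: fg_module_def)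
qed

text \<open>The residue field is generated by the class of \<open>\<one>\<close> and annihilated by \<open>x\<close>.\<close>

lemma koszul_ring: "koszul_ring R"
proof -
  interpret RM: module R "ring_module R" by (rule ring_module_module)
  have sub: "submodule \<mm> R (ring_module R)"
    using m_ideal by (simp add: ideal_submodule_ring_module)
  let ?k = "residue_module R"
  have k: "?k = quot_module (ring_module R) \<mm>"
    by (simp add: residue_module_def max_ideal_eq)
  interpret k: module R ?k
    unfolding k by (rule RM.quot_module_module[OF sub])
  have carr: "carrier ?k = (\<lambda>a. \<mm> +>\<^bsub>R\<^esub> a) ` carrier R" and zero: "\<zero>\<^bsub>?k\<^esub> = \<mm>"
    unfolding k by (simp_all add: RM.quot_module_carrier RM.quot_module_zero ring_module_simps)
  have smult: "a \<odot>\<^bsub>?k\<^esub> (\<mm> +>\<^bsub>R\<^esub> b) = \<mm> +>\<^bsub>R\<^esub> (a \<otimes> b)" if "a \<in> carrier R" "b \<in> carrier R" for a b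
    using RM.quot_module_smult[OF sub] that by (simp add: k ring_module_simps)
  have "span_of R ?k {\<mm> +>\<^bsub>R\<^esub> \<one>} = carrier ?k"
  proof
    have sub1: "{\<mm> +>\<^bsub>R\<^esub> \<one>} \<subseteq> carrier ?k"
      by (auto simp: carr)
    note H = k.span_of_submodule[OF this]
    show "span_of R ?k {\<mm> +>\<^bsub>R\<^esub> \<one>} \<subseteq> carrier ?k"
      by (rule k.submoduleD(1)[OF H])
    show "carrier ?k \<subseteq> span_of R ?k {\<mm> +>\<^bsub>R\<^esub> \<one>}"
    proof
      fix u assume "u \<in> carrier ?k"
      then obtain a where a: "a \<in> carrier R" "u = \<mm> +>\<^bsub>R\<^esub> a" by (auto simp: carr)
      then have "u = a \<odot>\<^bsub>?k\<^esub> (\<mm> +>\<^bsub>R\<^esub> \<one>)"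
        by (simp add: smult)
      then show "u \<in> span_of R ?k {\<mm> +>\<^bsub>R\<^esub> \<one>}"
        using k.submoduleD(5)[OF H a(1)] k.span_of_superset[of "{\<mm> +>\<^bsub>R\<^esub> \<one>}"] by auto
    qed
  qed
  then have "fg_module R ?k"
    using k.module_axioms by (auto simp: fg_module_def carr intro!: exI[of _ "{\<mm> +>\<^bsub>R\<^esub> \<one>}"])
  moreover have "conca_filtered ?k"
  proof (rule conca_filtered_if_annihilated[OF k.module_axioms])
    fix v assume "v \<in> carrier ?k"
    then obtain a where a: "a \<in> carrier R" "v = \<mm> +>\<^bsub>R\<^esub> a" by (auto simp: carr)
    have "x \<otimes> a \<in> \<mm>"
      using m.I_r_closed[OF x_mem a(1)] .
    then show "x \<odot>\<^bsub>?k\<^esub> v = \<zero>\<^bsub>?k\<^esub>"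
      using a x_carrier m.a_rcos_const by (simp add: smult zero)
  qed
  ultimately show ?thesis
    using local_noetherian[OF noetherian] conca_filtered_koszul by (simp add: koszul_ring_def)
qed

lemma quotient_conca_ring:
  assumes I: "ideal I R" "I \<noteq> carrier R"
  shows "conca_ring (R Quot I) ((+>) I ` \<mm>) (I +> x)"
proof -
  interpret I: ideal I R by (rule I(1))
  interpret h: ring_hom_ring R "R Quot I" "(+>) I" by (rule I.rcos_ring_hom_ring)
  interpret Q: cring "R Quot I" by (rule I.quotient_is_cring[OF is_cring])
  have surj: "(+>) I ` carrier R = carrier (R Quot I)"
    unfolding FactRing_def A_RCOSETS_def' by simp blast
  have coset: "a \<in> \<mm>" if "a \<in> carrier R" "b \<in> \<mm>" "I +> a = I +> b" for a b
  proof -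
    have "a \<in> I +> b"
      using I.a_rcos_self[OF that(1)] that(3) by simp
    then obtain i where "i \<in> I" "a = i \<oplus> b"
      by (auto simp: a_r_coset_def')
    then show ?thesis
      using proper_ideal_subset[OF I] that(2) by auto
  qed
  show ?thesis
  proof (intro conca_ring.intro local_cring.intro local_cring_axioms.intro conca_ring_axioms.intro)
    show "cring (R Quot I)" by (rule Q.is_cring)
    show "ideal ((+>) I ` \<mm>) (R Quot I)"
      by (rule ring_ideal_imp_quot_ideal[OF I(1) m_ideal])
    show "(+>) I ` \<mm> \<noteq> carrier (R Quot I)"
    proof
      assume "(+>) I ` \<mm> = carrier (R Quot I)"
      then have "I +> \<one> \<in> (+>) I ` \<mm>"
        using surj one_closed by blast
      then have "\<one> \<in> \<mm>"
        using coset[OF one_closed] by auto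
      then show False
        using m.one_imp_carrier m_proper by auto
    qed
    show "noetherian_ring (R Quot I)"
      by (rule h.noetherian_image[OF noetherian surj])
    show "I +> x \<in> (+>) I ` \<mm>"
      using x_mem by auto
    show "(I +> x) \<otimes>\<^bsub>R Quot I\<^esub> (I +> x) = \<zero>\<^bsub>R Quot I\<^esub>"
      using x_carrier x_square by (simp flip: h.hom_mult)
  next
    fix u assume u: "u \<in> carrier (R Quot I)" "u \<notin> (+>) I ` \<mm>"
    from u(1) have "u \<in> (+>) I ` carrier R"
      by (simp only: surj)
    then obtain a where a: "a \<in> carrier R" "u = I +> a"
      by (elim imageE)
    then have "a \<in> Units R"
      using unitI u(2) by auto
    then have "(I +> inv a) \<otimes>\<^bsub>R Quot I\<^esub> (I +> a) = \<one>\<^bsub>R Quot I\<^esub>" "I +> inv a \<in> carrier (R Quot I)"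
      using a(1) h.hom_mult[of "inv a" a] h.hom_one h.hom_closed[of "inv a"] by simp_all
    then show "u \<in> Units (R Quot I)"
      using u(1) a(2) Q.m_comm[of u "I +> inv a"] unfolding Units_def by auto
  next
    fix u v assume "u \<in> (+>) I ` \<mm>" "v \<in> (+>) I ` \<mm>"
    then obtain a b where ab: "a \<in> \<mm>" "b \<in> \<mm>" "u = I +> a" "v = I +> b" by auto
    then obtain c where "c \<in> \<mm>" "a \<otimes> b = x \<otimes> c"
      using m_square by blast
    then show "\<exists>c\<in>(+>) I ` \<mm>. u \<otimes>\<^bsub>R Quot I\<^esub> v = (I +> x) \<otimes>\<^bsub>R Quot I\<^esub> c"
      using ab x_carrier m.Icarr by (intro bexI[of _ "I +> c"]) (simp_all flip: h.hom_mult)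
  qed
qed

end

lemma conca_generator_conca_ring:
  fixes R (structure)
  assumes "local_noetherian_ring R" "conca_generator R x"
  shows "conca_ring R (max_ideal R) x"
proof -
  interpret local_cring R "max_ideal R" by (rule local_cring_max_ideal[OF assms(1)])
  have x: "x \<in> max_ideal R" "x [^] (2::nat) = \<zero>"
    "{x \<otimes> a | a. a \<in> max_ideal R} = ideal_power R (max_ideal R) 2"
    using assms(2) by (auto simp: conca_generator_def)
  have xR: "x \<in> carrier R"
    using x(1) ideal.Icarr[OF m_ideal] by auto
  show ?thesis
  proof (intro conca_ring.intro conca_ring_axioms.intro local_cring_axioms x(1))
    show "noetherian_ring R"
      using assms(1) by (simp add: local_noetherian_ring_def)
    show "x \<otimes> x = \<zero>"
      using x(2) xR by (simp add: numeral_2_eq_2)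
    fix a b assume "a \<in> max_ideal R" "b \<in> max_ideal R"
    then have "a \<otimes> b \<in> ideal_power R (max_ideal R) (Suc 0 + Suc 0)"
      by (intro ideal_power_mult m_ideal) (simp_all add: ideal_power_1 m_ideal del: ideal_power.simps)
    then have "a \<otimes> b \<in> {x \<otimes> a | a. a \<in> max_ideal R}"
      unfolding x(3) by (simp add: numeral_2_eq_2)
    then show "\<exists>c\<in>max_ideal R. a \<otimes> b = x \<otimes> c"
      by blast
  qed
qed

section \<open>Graded modules\<close>

text \<open>A grading is given by its components together with the projections onto them. An element is
  determined by its finitely many nonzero projections, which replaces direct sum decompositions.\<close>

locale graded_module = module A N
  for A (structure) and N :: "('c, 'd, 'm) module_scheme" (structure) +
  fixes AG :: "int \<Rightarrow> 'c set" and NG :: "int \<Rightarrow> 'd set" and pr :: "int \<Rightarrow> 'd \<Rightarrow> 'd"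
  assumes NG_carrier: "v \<in> NG j \<Longrightarrow> v \<in> carrier N"
    and AG_carrier: "a \<in> AG j \<Longrightarrow> a \<in> carrier A"
    and pr_mem: "v \<in> carrier N \<Longrightarrow> pr j v \<in> NG j"
    and pr_add: "v \<in> carrier N \<Longrightarrow> w \<in> carrier N \<Longrightarrow> pr j (v \<oplus>\<^bsub>N\<^esub> w) = pr j v \<oplus>\<^bsub>N\<^esub> pr j w"
    and pr_id: "v \<in> NG j \<Longrightarrow> pr i v = (if i = j then v else \<zero>\<^bsub>N\<^esub>)"
    and pr_support: "v \<in> carrier N \<Longrightarrow> finite {j. pr j v \<noteq> \<zero>\<^bsub>N\<^esub>}"
    and pr_zeroD: "v \<in> carrier N \<Longrightarrow> (\<And>j. pr j v = \<zero>\<^bsub>N\<^esub>) \<Longrightarrow> v = \<zero>\<^bsub>N\<^esub>"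
    and act: "a \<in> AG i \<Longrightarrow> v \<in> NG j \<Longrightarrow> a \<odot>\<^bsub>N\<^esub> v \<in> NG (i + j)"
begin

lemma pr_closed: "v \<in> carrier N \<Longrightarrow> pr j v \<in> carrier N"
  using pr_mem NG_carrier by blast

lemma pr_zero: "pr j \<zero>\<^bsub>N\<^esub> = \<zero>\<^bsub>N\<^esub>"
  using pr_add[of "\<zero>\<^bsub>N\<^esub>" "\<zero>\<^bsub>N\<^esub>" j] pr_closed[of "\<zero>\<^bsub>N\<^esub>" j] by (simp add: M.add.r_cancel_one')

lemma pr_minus: "v \<in> carrier N \<Longrightarrow> pr j (\<ominus>\<^bsub>N\<^esub> v) = \<ominus>\<^bsub>N\<^esub> pr j v"
  using pr_add[of "\<ominus>\<^bsub>N\<^esub> v" v j] by (intro M.minus_equality[symmetric]) (auto simp: M.l_neg pr_zero pr_closed)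

lemma pr_diff: "v \<in> carrier N \<Longrightarrow> w \<in> carrier N \<Longrightarrow> pr j (v \<ominus>\<^bsub>N\<^esub> w) = pr j v \<ominus>\<^bsub>N\<^esub> pr j w"
  by (simp add: a_minus_def pr_add pr_minus)

lemma NG_iff: "v \<in> NG j \<longleftrightarrow> v \<in> carrier N \<and> pr j v = v"
  using pr_mem[of v j] pr_id[of v j j] NG_carrier by auto

lemma NG_zero: "\<zero>\<^bsub>N\<^esub> \<in> NG j"
  by (simp add: NG_iff pr_zero)

lemma NG_add: "v \<in> NG j \<Longrightarrow> w \<in> NG j \<Longrightarrow> v \<oplus>\<^bsub>N\<^esub> w \<in> NG j"
  by (simp add: NG_iff pr_add)

lemma NG_diff: "v \<in> NG j \<Longrightarrow> w \<in> NG j \<Longrightarrow> v \<ominus>\<^bsub>N\<^esub> w \<in> NG j"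
  by (simp add: NG_iff pr_diff)

text \<open>Splitting off one nonzero component at a time, by induction on their number.\<close>

lemma mem_of_components:
  assumes H: "\<zero>\<^bsub>N\<^esub> \<in> H" "\<And>v w. v \<in> H \<Longrightarrow> w \<in> H \<Longrightarrow> v \<oplus>\<^bsub>N\<^esub> w \<in> H"
    and v: "v \<in> carrier N" "\<And>j. pr j v \<in> H"
  shows "v \<in> H"
proof -
  have "\<forall>v\<in>carrier N. (\<forall>j. pr j v \<in> H) \<and> card {j. pr j v \<noteq> \<zero>\<^bsub>N\<^esub>} = n \<longrightarrow> v \<in> H" for n
  proof (induction n rule: less_induct)
    case (less n)
    show ?case
    proof (intro ballI impI)
      fix v assume v: "v \<in> carrier N" and *: "(\<forall>j. pr j v \<in> H) \<and> card {j. pr j v \<noteq> \<zero>\<^bsub>N\<^esub>} = n"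
      show "v \<in> H"
      proof (cases "\<exists>j. pr j v \<noteq> \<zero>\<^bsub>N\<^esub>")
        case False
        then have "v = \<zero>\<^bsub>N\<^esub>"
          using pr_zeroD[OF v] by blast
        then show ?thesis using H(1) by simp
      next
        case True
        then obtain j where j: "pr j v \<noteq> \<zero>\<^bsub>N\<^esub>" by auto
        define w where "w = v \<ominus>\<^bsub>N\<^esub> pr j v"
        have w: "w \<in> carrier N" "v = w \<oplus>\<^bsub>N\<^esub> pr j v"
          using v pr_closed[OF v, of j] by (simp_all add: w_def a_minus_def M.a_assoc M.l_neg)
        have pr_w: "pr i w = (if i = j then \<zero>\<^bsub>N\<^esub> else pr i v)" for i
        proof -
          have "pr i w = pr i v \<oplus>\<^bsub>N\<^esub> \<ominus>\<^bsub>N\<^esub> pr i (pr j v)"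
            using v pr_closed[OF v] by (simp add: w_def a_minus_def pr_add pr_minus)
          moreover have "pr i (pr j v) = (if i = j then pr j v else \<zero>\<^bsub>N\<^esub>)"
            by (rule pr_id[OF pr_mem[OF v]])
          moreover have "\<ominus>\<^bsub>N\<^esub> \<zero>\<^bsub>N\<^esub> = \<zero>\<^bsub>N\<^esub>"
            by (rule M.minus_equality) auto
          ultimately show ?thesis
            using pr_closed[OF v] by (cases "i = j") (simp_all add: M.r_neg)
        qed
        have "{i. pr i w \<noteq> \<zero>\<^bsub>N\<^esub>} \<subset> {i. pr i v \<noteq> \<zero>\<^bsub>N\<^esub>}"
          using j by (auto simp: pr_w)
        then have "card {i. pr i w \<noteq> \<zero>\<^bsub>N\<^esub>} < n"
          using psubset_card_mono[OF pr_support[OF v]] * by auto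
        moreover have "\<forall>i. pr i w \<in> H"
          using * H(1) by (simp add: pr_w)
        ultimately have "w \<in> H"
          using less w(1) by blast
        then show ?thesis
          using w(2) * H(2) by metis
      qed
    qed
  qed
  then show ?thesis
    using v by blast
qed

end

locale graded_linear_map = M: graded_module A M AG MG prM + N: graded_module A N AG NG prN
  for A (structure) and M :: "('c, 'e, 'k) module_scheme" and N :: "('c, 'd, 'm) module_scheme"
    and AG MG prM NG prN +
  fixes f assumes hom: "f \<in> module_hom A M N" and degree: "v \<in> MG j \<Longrightarrow> f v \<in> NG j"

sublocale graded_linear_map \<subseteq> linear_map A M N f
  by (intro linear_map.intro linear_map_axioms.intro M.module_axioms N.module_axioms hom)

context graded_linear_map
begin

text \<open>The set where both sides agree is closed under addition and contains the homogeneous elements.\<close>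

lemma pr_commute:
  assumes v: "v \<in> carrier M" shows "prN j (f v) = f (prM j v)"
proof -
  let ?H = "{v \<in> carrier M. \<forall>j. prN j (f v) = f (prM j v)}"
  have "prM i v \<in> ?H" for i
  proof -
    have "prN j (f (prM i v)) = f (prM j (prM i v))" for j
      using N.pr_id[OF degree[OF M.pr_mem[OF v]], of j i] M.pr_id[OF M.pr_mem[OF v], of j i]
      by (simp add: zero)
    then show ?thesis
      using M.pr_closed[OF v] by simp
  qed
  moreover have "u \<oplus>\<^bsub>M\<^esub> w \<in> ?H" if "u \<in> ?H" "w \<in> ?H" for u w
    using that by (simp add: add M.pr_add N.pr_add closed M.pr_closed)
  moreover have "\<zero>\<^bsub>M\<^esub> \<in> ?H"
    by (simp add: zero M.pr_zero N.pr_zero)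
  ultimately have "v \<in> ?H"
    by (intro M.mem_of_components[OF _ _ v])
  then show ?thesis by simp
qed

lemma homogeneous_preimage:
  assumes "w \<in> NG j" "w \<in> f ` carrier M"
  shows "\<exists>v\<in>MG j. f v = w"
proof -
  obtain v where v: "v \<in> carrier M" "w = f v" using assms(2) by auto
  have "prN j w = w"
    using assms(1) N.NG_iff by blast
  then have "f (prM j v) = w"
    using pr_commute[OF v(1), of j] v(2) by metis
  then show ?thesis
    by (rule bexI[OF _ M.pr_mem[OF v(1)]])
qed

lemma kernel_graded: "v \<in> carrier M \<Longrightarrow> f v = \<zero>\<^bsub>N\<^esub> \<Longrightarrow> f (prM j v) = \<zero>\<^bsub>N\<^esub>"
  using pr_commute[of v j] N.pr_zero by simp

end

locale graded_cring = cring A for A :: "('c, 'r) ring_scheme" (structure) +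
  fixes AG :: "int \<Rightarrow> 'c set" and prA :: "int \<Rightarrow> 'c \<Rightarrow> 'c"
  assumes graded_ring_module: "graded_module A (ring_module A) AG AG prA"
    and one_degree: "\<one> \<in> AG 0"
begin

sublocale A: graded_module A "ring_module A" AG AG prA
  by (rule graded_ring_module)

definition free_pr :: "(nat \<Rightarrow> int) \<Rightarrow> int \<Rightarrow> (nat \<Rightarrow> 'c) \<Rightarrow> nat \<Rightarrow> 'c" where
  "free_pr a j v = (\<lambda>s. prA (j - a s) (v s))"

lemma AG_carrier: "u \<in> AG j \<Longrightarrow> u \<in> carrier A"
  by (rule A.AG_carrier)

lemma free_graded_module:
  "graded_module A (free_module A b) AG (shifted_free A AG b a) (free_pr a)"
proof (intro graded_module.intro graded_module_axioms.intro free_module_module)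
  note simps = ring_module_simps[of A]
  have prA_zero: "prA j \<zero> = \<zero>" for j
    using A.pr_zero[of j] by (simp add: simps)
  have prA_mem: "prA j u \<in> AG j" "prA j u \<in> carrier A" if "u \<in> carrier A" for u j
    using A.pr_mem[of u j] that AG_carrier by (auto simp: simps)
  fix v j
  show "v \<in> carrier (free_module A b)" if "v \<in> shifted_free A AG b a j"
    using that by (simp add: shifted_free_def)
  show "u \<in> carrier A" if "u \<in> AG j" for u
    using that by (rule AG_carrier)
  show "free_pr a j v \<in> shifted_free A AG b a j" if "v \<in> carrier (free_module A b)"
    using that by (auto simp: shifted_free_def free_pr_def free_module_mem prA_zero prA_mem)
  show "free_pr a i v = (if i = j then v else \<zero>\<^bsub>free_module A b\<^esub>)"
    if v: "v \<in> shifted_free A AG b a j" for i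
  proof -
    have "prA (i - a s) (v s) = (if i = j then v s else \<zero>)" for s
    proof (cases "s < b")
      case True
      then show ?thesis
        using v A.pr_id[of "v s" "j - a s" "i - a s"] by (auto simp: shifted_free_def simps)
    next
      case False
      then show ?thesis
        using v prA_zero by (auto simp: shifted_free_def free_module_mem)
    qed
    then show ?thesis
      by (auto simp: free_pr_def free_module_simps)
  qed
  show "free_pr a j (v \<oplus>\<^bsub>free_module A b\<^esub> w)
      = free_pr a j v \<oplus>\<^bsub>free_module A b\<^esub> free_pr a j w"
    if "v \<in> carrier (free_module A b)" "w \<in> carrier (free_module A b)" for w
    using that A.pr_add by (auto simp: free_pr_def free_module_simps free_module_mem simps)
  show "finite {j. free_pr a j v \<noteq> \<zero>\<^bsub>free_module A b\<^esub>}" if v: "v \<in> carrier (free_module A b)"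
  proof -
    have "{j. free_pr a j v \<noteq> \<zero>\<^bsub>free_module A b\<^esub>}
        \<subseteq> (\<Union>s\<in>{..<b}. (\<lambda>i. i + a s) ` {i. prA i (v s) \<noteq> \<zero>})"
    proof
      fix j assume "j \<in> {j. free_pr a j v \<noteq> \<zero>\<^bsub>free_module A b\<^esub>}"
      then obtain s where s: "prA (j - a s) (v s) \<noteq> \<zero>"
        by (auto simp: free_pr_def free_module_simps)
      then have "s < b"
        using v prA_zero by (metis free_module_mem leI)
      then show "j \<in> (\<Union>s\<in>{..<b}. (\<lambda>i. i + a s) ` {i. prA i (v s) \<noteq> \<zero>})"
        using s by (auto intro!: bexI[of _ s] image_eqI[of _ _ "j - a s"])
    qed
    moreover have "finite {i. prA i (v s) \<noteq> \<zero>}" for s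
      using A.pr_support[of "v s"] v by (simp add: simps free_module_mem)
    ultimately show ?thesis
      by (auto intro: finite_subset)
  qed
  show "v = \<zero>\<^bsub>free_module A b\<^esub>"
    if v: "v \<in> carrier (free_module A b)" "\<And>j. free_pr a j v = \<zero>\<^bsub>free_module A b\<^esub>"
  proof -
    have "v s = \<zero>" for s
    proof -
      have "prA i (v s) = \<zero>" for i
        using fun_cong[OF v(2)[of "i + a s"], of s] by (simp add: free_pr_def free_module_simps)
      then show ?thesis
        using A.pr_zeroD[of "v s"] v(1) by (simp add: simps free_module_mem)
    qed
    then show ?thesis
      by (auto simp: free_module_simps)
  qed
  show "u \<odot>\<^bsub>free_module A b\<^esub> v \<in> shifted_free A AG b a (i + j)"
    if "u \<in> AG i" "v \<in> shifted_free A AG b a j" for u i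
    using that A.act[of u i "v _" "j - a _"] AG_carrier
    by (auto simp: shifted_free_def free_module_simps free_module_mem simps algebra_simps)
qed

lemma unit_vector_degree: "s < b \<Longrightarrow> unit_vector A s \<in> shifted_free A AG b a (a s)"
  using unit_vector_mem[of s b] one_degree A.NG_zero
  by (auto simp: shifted_free_def unit_vector_def ring_module_simps)

lemma free_map_degree:
  assumes N: "graded_module A N AG NG prN"
    and f: "f \<in> module_hom A (free_module A b) N"
    and e: "\<And>s. s < b \<Longrightarrow> f (unit_vector A s) \<in> NG (a s)"
    and v: "v \<in> shifted_free A AG b a j"
  shows "f v \<in> NG j"
proof -
  interpret N: graded_module A N AG NG prN by (rule N)
  have vc: "v \<in> carrier (free_module A b)" and vs: "\<And>s. s < b \<Longrightarrow> v s \<in> AG (j - a s)"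
    using v by (auto simp: shifted_free_def)
  let ?z = "\<lambda>s. f (unit_vector A s)"
  have z: "\<And>s. s < b \<Longrightarrow> ?z s \<in> carrier N"
    using e N.NG_carrier by blast
  have mem: "v s \<odot>\<^bsub>N\<^esub> ?z s \<in> NG j" if "s < b" for s
    using N.act[OF vs[OF that] e[OF that]] by simp
  have "f v = free_map N b ?z v"
    using N.free_map_hom[OF z] N.free_map_unit_vector[OF z] by (intro N.free_hom_eqI[OF f _ _ vc]) auto
  moreover have "(\<Oplus>\<^bsub>N\<^esub>s\<in>B. v s \<odot>\<^bsub>N\<^esub> ?z s) \<in> NG j" if "finite B" "B \<subseteq> {..<b}" for B
    using that
  proof (induction B rule: finite_induct)
    case (insert s B)
    then have "(\<Oplus>\<^bsub>N\<^esub>s\<in>insert s B. v s \<odot>\<^bsub>N\<^esub> ?z s) = v s \<odot>\<^bsub>N\<^esub> ?z s \<oplus>\<^bsub>N\<^esub> (\<Oplus>\<^bsub>N\<^esub>s\<in>B. v s \<odot>\<^bsub>N\<^esub> ?z s)"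
      using mem N.NG_carrier by (intro N.M.finsum_insert) (auto simp: Pi_def subset_iff)
    then show ?case
      using insert mem N.NG_add by auto
  qed (simp add: N.NG_zero)
  ultimately show ?thesis
    by (simp add: free_map_def)
qed

end

section \<open>Comparison of graded resolutions\<close>

text \<open>Free modules are projective. The predicate \<open>C\<close> records conditions on the lifts of the unit
  vectors, such as homogeneity.\<close>

lemma (in cring) free_module_lift:
  assumes \<phi>: "\<phi> \<in> module_hom R (free_module R n) X" and \<psi>: "\<psi> \<in> module_hom R G X"
    and X: "module R X" and G: "module R G"
    and lift: "\<And>s. s < n \<Longrightarrow> \<exists>g\<in>carrier G. \<psi> g = \<phi> (unit_vector R s) \<and> C s g"
  shows "\<exists>\<alpha>\<in>module_hom R (free_module R n) G. (\<forall>v\<in>carrier (free_module R n). \<psi> (\<alpha> v) = \<phi> v) \<and>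
    (\<forall>s<n. C s (\<alpha> (unit_vector R s)))"
proof -
  interpret X: module R X by (rule X)
  interpret G: module R G by (rule G)
  obtain z where z: "\<And>s. s < n \<Longrightarrow> z s \<in> carrier G" "\<And>s. s < n \<Longrightarrow> \<psi> (z s) = \<phi> (unit_vector R s)"
      "\<And>s. s < n \<Longrightarrow> C s (z s)"
    using lift by metis
  let ?\<alpha> = "free_map G n z"
  have \<alpha>: "?\<alpha> \<in> module_hom R (free_module R n) G"
    by (rule G.free_map_hom[OF z(1)])
  have e: "?\<alpha> (unit_vector R s) = z s" if "s < n" for s
    using G.free_map_unit_vector[OF z(1) that] .
  have "(\<lambda>v. \<psi> (?\<alpha> v)) \<in> module_hom R (free_module R n) X"
    using module_homD[OF \<alpha>] module_homD[OF \<psi>] by (intro module_homI) auto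
  then have "\<psi> (?\<alpha> v) = \<phi> v" if "v \<in> carrier (free_module R n)" for v
    using X.free_hom_eqI[OF _ \<phi> _ that] e z(2) by simp
  then show ?thesis
    using \<alpha> e z(3) by (intro bexI[of _ ?\<alpha>]) auto
qed

context graded_cring
begin

lemma graded_res_linear_maps:
  assumes N: "graded_module A N AG NG prN" and res: "graded_free_resolution A AG N NG (b, a, d, \<epsilon>)"
  shows "graded_linear_map A (free_module A (b 0)) N AG (shifted_free A AG (b 0) (a 0)) (free_pr (a 0)) NG prN \<epsilon>"
    and "graded_linear_map A (free_module A (b (Suc n))) (free_module A (b n)) AG
      (shifted_free A AG (b (Suc n)) (a (Suc n))) (free_pr (a (Suc n)))
      (shifted_free A AG (b n) (a n)) (free_pr (a n)) (d n)"
  using res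
  by (auto simp: free_resolution_def image_subset_iff
      intro!: graded_linear_map.intro graded_linear_map_axioms.intro free_graded_module N)

text \<open>The usual lifting argument. Each lift can be chosen homogeneous, because a homogeneous element
  in the image of a graded map has a homogeneous preimage of the same degree. The recursion
  maintains that \<open>\<alpha>\<^sub>n\<close> maps boundaries to boundaries, which makes the next lift possible.\<close>

lemma graded_chain_map:
  assumes N: "graded_module A N AG NG prN"
    and F: "graded_free_resolution A AG N NG (b, a, d, \<epsilon>)"
    and G: "graded_free_resolution A AG N NG (b', a', d', \<epsilon>')"
  shows "\<exists>\<alpha>. (\<forall>n. \<alpha> n \<in> module_hom A (free_module A (b n)) (free_module A (b' n))) \<and>
    (\<forall>n j. \<alpha> n ` shifted_free A AG (b n) (a n) j \<subseteq> shifted_free A AG (b' n) (a' n) j) \<and>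
    (\<forall>v\<in>carrier (free_module A (b 0)). \<epsilon>' (\<alpha> 0 v) = \<epsilon> v) \<and>
    (\<forall>n. \<forall>v\<in>carrier (free_module A (b (Suc n))). d' n (\<alpha> (Suc n) v) = \<alpha> n (d n v))"
proof -
  let ?F = "\<lambda>n. free_module A (b n)" and ?G = "\<lambda>n. free_module A (b' n)"
  let ?FG = "\<lambda>n. shifted_free A AG (b n) (a n)" and ?GG = "\<lambda>n. shifted_free A AG (b' n) (a' n)"
  define hom where "hom = (\<lambda>n \<alpha>. \<alpha> \<in> module_hom A (?F n) (?G n) \<and> (\<forall>s<b n. \<alpha> (unit_vector A s) \<in> ?GG n (a n s)))"
  define P where "P = (\<lambda>n \<alpha>. hom n \<alpha> \<and> (\<forall>v\<in>carrier (?F (Suc n)). \<alpha> (d n v) \<in> d' n ` carrier (?G (Suc n))) \<and>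
    (n = 0 \<longrightarrow> (\<forall>v\<in>carrier (?F 0). \<epsilon>' (\<alpha> v) = \<epsilon> v)))"
  have res: "free_resolution A N b d \<epsilon>" "free_resolution A N b' d' \<epsilon>'"
    using F G by auto
  have N': "module A N" using N by (rule graded_module.axioms)
  have "\<exists>\<alpha>. \<forall>n. P n (\<alpha> n) \<and> (\<forall>v\<in>carrier (?F (Suc n)). d' n (\<alpha> (Suc n) v) = \<alpha> n (d n v))"
  proof (rule dependent_nat_choice)
    interpret \<epsilon>: graded_linear_map A "?F 0" N AG "?FG 0" "free_pr (a 0)" NG prN \<epsilon>
      by (rule graded_res_linear_maps[OF N F])
    interpret \<epsilon>': graded_linear_map A "?G 0" N AG "?GG 0" "free_pr (a' 0)" NG prN \<epsilon>'
      by (rule graded_res_linear_maps[OF N G])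
    have "\<exists>g\<in>carrier (?G 0). \<epsilon>' g = \<epsilon> (unit_vector A s) \<and> g \<in> ?GG 0 (a 0 s)" if "s < b 0" for s
    proof -
      have "\<epsilon> (unit_vector A s) \<in> NG (a 0 s)"
        using \<epsilon>.degree unit_vector_degree[OF that] by blast
      moreover from this have "\<epsilon> (unit_vector A s) \<in> \<epsilon>' ` carrier (?G 0)"
        using res(2) \<epsilon>.N.NG_carrier by (auto simp: free_resolution_def)
      ultimately show ?thesis
        using \<epsilon>'.homogeneous_preimage \<epsilon>'.M.NG_carrier by blast
    qed
    from free_module_lift[OF \<epsilon>.hom \<epsilon>'.hom N' free_module_module this]
    obtain \<alpha> where \<alpha>: "\<alpha> \<in> module_hom A (?F 0) (?G 0)" "\<forall>v\<in>carrier (?F 0). \<epsilon>' (\<alpha> v) = \<epsilon> v"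
        "\<forall>s<b 0. \<alpha> (unit_vector A s) \<in> ?GG 0 (a 0 s)"
      by auto
    have "\<alpha> (d 0 v) \<in> d' 0 ` carrier (?G 1)" if v: "v \<in> carrier (?F 1)" for v
    proof -
      have dv: "d 0 v \<in> {v \<in> carrier (?F 0). \<epsilon> v = \<zero>\<^bsub>N\<^esub>}"
        using res(1) v unfolding free_resolution_def by auto
      then have "\<alpha> (d 0 v) \<in> {v \<in> carrier (?G 0). \<epsilon>' v = \<zero>\<^bsub>N\<^esub>}"
        using \<alpha>(2) module_homD(1)[OF \<alpha>(1)] by simp
      then show ?thesis
        using res(2) unfolding free_resolution_def by auto
    qed
    then show "\<exists>\<alpha>. P 0 \<alpha>"
      using \<alpha> by (intro exI[of _ \<alpha>]) (auto simp: P_def hom_def)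
  next
    fix \<alpha> n assume \<alpha>: "P n \<alpha>"
    then have \<alpha>_hom: "\<alpha> \<in> module_hom A (?F n) (?G n)" and \<alpha>_e: "\<And>s. s < b n \<Longrightarrow> \<alpha> (unit_vector A s) \<in> ?GG n (a n s)"
      and \<alpha>_im: "\<And>v. v \<in> carrier (?F (Suc n)) \<Longrightarrow> \<alpha> (d n v) \<in> d' n ` carrier (?G (Suc n))"
      by (auto simp: P_def hom_def)
    interpret d: graded_linear_map A "?F (Suc n)" "?F n" AG "?FG (Suc n)" "free_pr (a (Suc n))" "?FG n" "free_pr (a n)" "d n"
      by (rule graded_res_linear_maps[OF N F])
    interpret d': graded_linear_map A "?G (Suc n)" "?G n" AG "?GG (Suc n)" "free_pr (a' (Suc n))" "?GG n" "free_pr (a' n)" "d' n"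
      by (rule graded_res_linear_maps[OF N G])
    have \<alpha>d: "(\<lambda>v. \<alpha> (d n v)) \<in> module_hom A (?F (Suc n)) (?G n)"
      using module_homD[OF \<alpha>_hom] module_homD[OF d.hom] by (intro module_homI) auto
    have "\<exists>g\<in>carrier (?G (Suc n)). d' n g = \<alpha> (d n (unit_vector A s)) \<and> g \<in> ?GG (Suc n) (a (Suc n) s)"
      if "s < b (Suc n)" for s
    proof -
      have "\<alpha> (d n (unit_vector A s)) \<in> ?GG n (a (Suc n) s)"
        by (rule free_map_degree[OF free_graded_module \<alpha>_hom])
          (rule \<alpha>_e d.degree[OF unit_vector_degree[OF that]], assumption?)+
      moreover have "\<alpha> (d n (unit_vector A s)) \<in> d' n ` carrier (?G (Suc n))"
        by (rule \<alpha>_im[OF unit_vector_mem[OF that]])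
      ultimately show ?thesis
        using d'.homogeneous_preimage d'.M.NG_carrier by blast
    qed
    from free_module_lift[OF \<alpha>d d'.hom free_module_module free_module_module this]
    obtain \<beta> where \<beta>: "\<beta> \<in> module_hom A (?F (Suc n)) (?G (Suc n))"
        "\<forall>v\<in>carrier (?F (Suc n)). d' n (\<beta> v) = \<alpha> (d n v)"
        "\<forall>s<b (Suc n). \<beta> (unit_vector A s) \<in> ?GG (Suc n) (a (Suc n) s)"
      by auto
    have "\<beta> (d (Suc n) v) \<in> d' (Suc n) ` carrier (?G (Suc (Suc n)))" if v: "v \<in> carrier (?F (Suc (Suc n)))" for v
    proof -
      have "d (Suc n) v \<in> {v \<in> carrier (?F (Suc n)). d n v = \<zero>\<^bsub>?F n\<^esub>}"
        using res(1) v unfolding free_resolution_def by blast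
      moreover have "\<alpha> \<zero>\<^bsub>?F n\<^esub> = \<zero>\<^bsub>?G n\<^esub>"
        using linear_map.zero[OF module.free_linear_map[OF free_module_module \<alpha>_hom]] .
      ultimately have "\<beta> (d (Suc n) v) \<in> {v \<in> carrier (?G (Suc n)). d' n v = \<zero>\<^bsub>?G n\<^esub>}"
        using \<beta>(2) module_homD(1)[OF \<beta>(1)] by simp
      then show ?thesis
        using res(2) unfolding free_resolution_def by blast
    qed
    then show "\<exists>\<beta>. P (Suc n) \<beta> \<and> (\<forall>v\<in>carrier (?F (Suc n)). d' n (\<beta> v) = \<alpha> (d n v))"
      using \<beta> by (intro exI[of _ \<beta>]) (auto simp: P_def hom_def)
  qed
  then obtain \<alpha> where \<alpha>: "\<And>n. P n (\<alpha> n)"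
    "\<And>n v. v \<in> carrier (?F (Suc n)) \<Longrightarrow> d' n (\<alpha> (Suc n) v) = \<alpha> n (d n v)"
    by blast
  have "\<alpha> n v \<in> ?GG n j" if "v \<in> ?FG n j" for n j v
    using free_map_degree[OF free_graded_module _ _ that] \<alpha>(1)[of n] by (auto simp: P_def hom_def)
  then show ?thesis
    using \<alpha> by (intro exI[of _ \<alpha>]) (auto simp: P_def hom_def)
qed

text \<open>A chain map over the identity of \<open>N\<close> is homotopic to the identity. With \<open>\<delta>\<close> their difference,
  the next component of the homotopy lifts \<open>\<delta>\<^sub>n\<^sub>+\<^sub>1 - h\<^sub>n d\<^sub>n\<close>, which takes values in cycles.\<close>

lemma chain_homotopy:
  assumes N: "module A N" and F: "free_resolution A N b d \<epsilon>"
    and \<phi>: "\<And>n. \<phi> n \<in> module_hom A (free_module A (b n)) (free_module A (b n))"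
    and \<phi>\<epsilon>: "\<And>v. v \<in> carrier (free_module A (b 0)) \<Longrightarrow> \<epsilon> (\<phi> 0 v) = \<epsilon> v"
    and \<phi>d: "\<And>n v. v \<in> carrier (free_module A (b (Suc n))) \<Longrightarrow> d n (\<phi> (Suc n) v) = \<phi> n (d n v)"
  shows "\<exists>h. (\<forall>n. h n \<in> module_hom A (free_module A (b n)) (free_module A (b (Suc n)))) \<and>
    (\<forall>v\<in>carrier (free_module A (b 0)). d 0 (h 0 v) = \<phi> 0 v \<ominus>\<^bsub>free_module A (b 0)\<^esub> v) \<and>
    (\<forall>n. \<forall>v\<in>carrier (free_module A (b (Suc n))). d (Suc n) (h (Suc n) v)
      = (\<phi> (Suc n) v \<ominus>\<^bsub>free_module A (b (Suc n))\<^esub> v) \<ominus>\<^bsub>free_module A (b (Suc n))\<^esub> h n (d n v))"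
proof -
  let ?F = "\<lambda>n. free_module A (b n)"
  define \<delta> where "\<delta> = (\<lambda>n v. \<phi> n v \<ominus>\<^bsub>?F n\<^esub> v)"
  interpret F: module A "?F n" for n by (rule free_module_module)
  have d: "linear_map A (?F (Suc n)) (?F n) (d n)" for n
    using F by (intro F.free_linear_map) (simp add: free_resolution_def)
  have \<epsilon>: "linear_map A (?F 0) N \<epsilon>"
    using F by (intro module.free_linear_map[OF N]) (simp add: free_resolution_def)
  note \<phi>D = module_homD[OF \<phi>]
  have \<delta>: "\<delta> n \<in> module_hom A (?F n) (?F n)" for n
  proof (rule module_homI)
    fix v w assume v: "v \<in> carrier (?F n)" and w: "w \<in> carrier (?F n)"
    show "\<delta> n v \<in> carrier (?F n)"
      using v \<phi>D by (simp add: \<delta>_def)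
    show "\<delta> n (v \<oplus>\<^bsub>?F n\<^esub> w) = \<delta> n v \<oplus>\<^bsub>?F n\<^esub> \<delta> n w"
      using v w \<phi>D by (simp add: \<delta>_def a_minus_def F.M.minus_add F.M.a_ac)
  next
    fix u v assume "u \<in> carrier A" "v \<in> carrier (?F n)"
    then show "\<delta> n (u \<odot>\<^bsub>?F n\<^esub> v) = u \<odot>\<^bsub>?F n\<^esub> \<delta> n v"
      using \<phi>D by (simp add: \<delta>_def a_minus_def F.smult_r_distr F.smult_r_minus)
  qed
  note \<delta>D = module_homD[OF \<delta>]
  have d\<delta>: "d n (\<delta> (Suc n) v) = \<delta> n (d n v)" if "v \<in> carrier (?F (Suc n))" for n v
    using that \<phi>D(1) linear_map.diff[OF d] \<phi>d by (simp add: \<delta>_def)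
  have exact: "v \<in> d (Suc n) ` carrier (?F (Suc (Suc n)))"
    if "v \<in> carrier (?F (Suc n))" "d n v = \<zero>\<^bsub>?F n\<^esub>" for n v
    using F that unfolding free_resolution_def by blast
  have dd: "d n (d (Suc n) v) = \<zero>\<^bsub>?F n\<^esub>" if "v \<in> carrier (?F (Suc (Suc n)))" for n v
    using F that unfolding free_resolution_def by blast
  define P where "P = (\<lambda>n h. h \<in> module_hom A (?F n) (?F (Suc n)) \<and>
    (\<forall>v\<in>carrier (?F (Suc n)). \<delta> (Suc n) v \<ominus>\<^bsub>?F (Suc n)\<^esub> h (d n v) \<in> d (Suc n) ` carrier (?F (Suc (Suc n)))) \<and>
    (n = 0 \<longrightarrow> (\<forall>v\<in>carrier (?F 0). d 0 (h v) = \<delta> 0 v)))"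
  have "\<exists>h. \<forall>n. P n (h n) \<and> (\<forall>v\<in>carrier (?F (Suc n)).
      d (Suc n) (h (Suc n) v) = \<delta> (Suc n) v \<ominus>\<^bsub>?F (Suc n)\<^esub> h n (d n v))"
  proof (rule dependent_nat_choice)
    have "\<exists>g\<in>carrier (?F (Suc 0)). d 0 g = \<delta> 0 (unit_vector A s) \<and> True" if "s < b 0" for s
    proof -
      have e: "unit_vector A s \<in> carrier (?F 0)" by (rule unit_vector_mem[OF that])
      have "\<epsilon> (\<delta> 0 (unit_vector A s)) = \<zero>\<^bsub>N\<^esub>"
        using e \<phi>D(1) linear_map.diff[OF \<epsilon>] \<phi>\<epsilon> linear_map.closed[OF \<epsilon> e]
          abelian_group.r_neg[OF module.axioms(2)[OF N]]
        by (simp add: \<delta>_def) (simp add: a_minus_def)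
      then have "\<delta> 0 (unit_vector A s) \<in> {v \<in> carrier (?F 0). \<epsilon> v = \<zero>\<^bsub>N\<^esub>}"
        using \<delta>D(1) e by simp
      also have "\<dots> = d 0 ` carrier (?F (Suc 0))"
        using F by (simp add: free_resolution_def)
      finally have "\<delta> 0 (unit_vector A s) \<in> d 0 ` carrier (?F (Suc 0))" .
      then show ?thesis by auto
    qed
    from free_module_lift[OF \<delta> linear_map.hom[OF d] free_module_module free_module_module this]
    obtain h where h: "h \<in> module_hom A (?F 0) (?F (Suc 0))" "\<forall>v\<in>carrier (?F 0). d 0 (h v) = \<delta> 0 v"
      by auto
    have "\<delta> (Suc 0) v \<ominus>\<^bsub>?F (Suc 0)\<^esub> h (d 0 v) \<in> d (Suc 0) ` carrier (?F (Suc (Suc 0)))"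
      if v: "v \<in> carrier (?F (Suc 0))" for v
    proof (rule exact)
      have dv: "d 0 v \<in> carrier (?F 0)" using linear_map.closed[OF d v] .
      show "\<delta> (Suc 0) v \<ominus>\<^bsub>?F (Suc 0)\<^esub> h (d 0 v) \<in> carrier (?F (Suc 0))"
        using v dv \<delta>D(1) module_homD(1)[OF h(1)] by simp
      show "d 0 (\<delta> (Suc 0) v \<ominus>\<^bsub>?F (Suc 0)\<^esub> h (d 0 v)) = \<zero>\<^bsub>?F 0\<^esub>"
        using v dv \<delta>D(1) module_homD(1)[OF h(1)] linear_map.diff[OF d] d\<delta> h(2)
        by simp (simp add: a_minus_def F.M.r_neg)
    qed
    then show "\<exists>h. P 0 h"
      using h by (auto simp: P_def)
  next
    fix h n assume h: "P n h"
    then have h_hom: "h \<in> module_hom A (?F n) (?F (Suc n))"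
      and h_im: "\<And>v. v \<in> carrier (?F (Suc n)) \<Longrightarrow> \<delta> (Suc n) v \<ominus>\<^bsub>?F (Suc n)\<^esub> h (d n v) \<in> d (Suc n) ` carrier (?F (Suc (Suc n)))"
      by (auto simp: P_def)
    interpret h: linear_map A "?F n" "?F (Suc n)" h by (rule F.free_linear_map[OF h_hom])
    interpret d: linear_map A "?F (Suc n)" "?F n" "d n" by (rule d)
    let ?\<psi> = "\<lambda>v. \<delta> (Suc n) v \<ominus>\<^bsub>?F (Suc n)\<^esub> h (d n v)"
    have \<psi>: "?\<psi> \<in> module_hom A (?F (Suc n)) (?F (Suc n))"
    proof (rule module_homI)
      fix v w assume v: "v \<in> carrier (?F (Suc n))" and w: "w \<in> carrier (?F (Suc n))"
      show "?\<psi> v \<in> carrier (?F (Suc n))"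
        using v \<delta>D(1) h.closed d.closed by simp
      show "?\<psi> (v \<oplus>\<^bsub>?F (Suc n)\<^esub> w) = ?\<psi> v \<oplus>\<^bsub>?F (Suc n)\<^esub> ?\<psi> w"
        using v w \<delta>D h.closed d.closed h.add d.add by (simp add: a_minus_def F.M.minus_add F.M.a_ac)
    next
      fix u v assume "u \<in> carrier A" "v \<in> carrier (?F (Suc n))"
      then show "?\<psi> (u \<odot>\<^bsub>?F (Suc n)\<^esub> v) = u \<odot>\<^bsub>?F (Suc n)\<^esub> ?\<psi> v"
        using \<delta>D h.closed d.closed h.smult d.smult
        by (simp add: a_minus_def F.smult_r_distr F.smult_r_minus)
    qed
    have "\<exists>g\<in>carrier (?F (Suc (Suc n))). d (Suc n) g = ?\<psi> (unit_vector A s) \<and> True" if "s < b (Suc n)" for s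
      using h_im[OF unit_vector_mem[OF that]] by auto
    from free_module_lift[OF \<psi> linear_map.hom[OF d] free_module_module free_module_module this]
    obtain h' where h': "h' \<in> module_hom A (?F (Suc n)) (?F (Suc (Suc n)))"
        "\<forall>v\<in>carrier (?F (Suc n)). d (Suc n) (h' v) = ?\<psi> v"
      by auto
    have "\<delta> (Suc (Suc n)) v \<ominus>\<^bsub>?F (Suc (Suc n))\<^esub> h' (d (Suc n) v)
        \<in> d (Suc (Suc n)) ` carrier (?F (Suc (Suc (Suc n))))"
      if v: "v \<in> carrier (?F (Suc (Suc n)))" for v
    proof (rule exact)
      have dv: "d (Suc n) v \<in> carrier (?F (Suc n))" using linear_map.closed[OF d v] .
      have *: "h (d n (d (Suc n) v)) = \<zero>\<^bsub>?F (Suc n)\<^esub>"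
        using dd[OF v] h.zero by simp
      have "\<ominus>\<^bsub>?F (Suc n)\<^esub> \<zero>\<^bsub>?F (Suc n)\<^esub> = \<zero>\<^bsub>?F (Suc n)\<^esub>"
        by (rule F.M.minus_equality) auto
      then have **: "?\<psi> (d (Suc n) v) = \<delta> (Suc n) (d (Suc n) v)"
        using \<delta>D(1)[OF dv] unfolding * a_minus_def by simp
      show "\<delta> (Suc (Suc n)) v \<ominus>\<^bsub>?F (Suc (Suc n))\<^esub> h' (d (Suc n) v) \<in> carrier (?F (Suc (Suc n)))"
        using v dv \<delta>D(1) module_homD(1)[OF h'(1)] by simp
      have "d (Suc n) (\<delta> (Suc (Suc n)) v \<ominus>\<^bsub>?F (Suc (Suc n))\<^esub> h' (d (Suc n) v))
          = \<delta> (Suc n) (d (Suc n) v) \<ominus>\<^bsub>?F (Suc n)\<^esub> ?\<psi> (d (Suc n) v)"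
        using v dv \<delta>D(1) module_homD(1)[OF h'(1)] linear_map.diff[OF d] d\<delta> h'(2) by simp
      then show "d (Suc n) (\<delta> (Suc (Suc n)) v \<ominus>\<^bsub>?F (Suc (Suc n))\<^esub> h' (d (Suc n) v)) = \<zero>\<^bsub>?F (Suc n)\<^esub>"
        unfolding ** using \<delta>D(1)[OF dv] by (simp add: a_minus_def F.M.r_neg)
    qed
    then show "\<exists>h'. P (Suc n) h' \<and> (\<forall>v\<in>carrier (?F (Suc n)). d (Suc n) (h' v) = ?\<psi> v)"
      using h' by (auto simp: P_def)
  qed
  then obtain h where h: "\<And>n. P n (h n)" "\<And>n v. v \<in> carrier (?F (Suc n)) \<Longrightarrow>
      d (Suc n) (h (Suc n) v) = \<delta> (Suc n) v \<ominus>\<^bsub>?F (Suc n)\<^esub> h n (d n v)"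
    by blast
  show ?thesis
    using h by (intro exI[of _ h]) (auto simp: P_def \<delta>_def)
qed

end

section \<open>Regularity from a resolution\<close>

lemma (in linear_map) ideal_smult_closed:
  assumes I: "I \<subseteq> carrier R" and v: "v \<in> ideal_smult R I M" shows "f v \<in> ideal_smult R I N"
proof -
  have "f v \<in> N.smult_span I (f ` carrier M)"
    using image_smult_span[OF I subset_refl] v M.ideal_smult_eq by blast
  then show ?thesis
    using N.smult_span_mono[OF subset_refl, of "f ` carrier M" "carrier N" I] closed
    by (auto simp: N.ideal_smult_eq)
qed

context graded_cring
begin

text \<open>Here \<open>v\<close> is a cycle of degree \<open>j\<close> in \<open>F/IF\<close>. Choose graded chain maps \<open>\<alpha> : F \<rightarrow> G\<close>,
  \<open>\<beta> : G \<rightarrow> F\<close> and a homotopy \<open>h\<close> from \<open>\<beta>\<alpha>\<close> to the identity. If the generators of \<open>G\<^sub>i\<close> have degree less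
  than \<open>j\<close>, then \<open>\<alpha>(v) \<in> IG\<^sub>i\<close>. Hence \<open>\<beta>\<alpha>(v) \<in> IF\<^sub>i\<close>, also \<open>h(d(v)) \<in> IF\<^sub>i\<close>, and
  \<open>v = \<beta>\<alpha>(v) - h(d(v)) - d(h(v))\<close> is a boundary modulo \<open>IF\<^sub>i\<close>.\<close>

lemma cycle_is_boundary:
  assumes N: "graded_module A N AG NG prN"
    and F: "graded_free_resolution A AG N NG (b, a, d, \<epsilon>)"
    and G: "graded_free_resolution A AG N NG (b', a', d', \<epsilon>')"
    and I: "ideal I A" "\<And>j. 0 < j \<Longrightarrow> AG j \<subseteq> I"
    and j: "\<And>s. s < b' i \<Longrightarrow> a' i s < j"
    and v: "v \<in> shifted_free A AG (b i) (a i) j"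
    and cycle: "\<And>p. i = Suc p \<Longrightarrow> d p v \<in> ideal_smult A I (free_module A (b p))"
  shows "\<exists>w\<in>carrier (free_module A (b (Suc i))). \<exists>u\<in>ideal_smult A I (free_module A (b i)).
    v = d i w \<oplus>\<^bsub>free_module A (b i)\<^esub> u"
proof -
  let ?F = "\<lambda>n. free_module A (b n)" and ?G = "\<lambda>n. free_module A (b' n)"
  interpret I: ideal I A by (rule I(1))
  interpret F: module A "?F n" for n by (rule free_module_module)
  have N': "module A N" using N by (rule graded_module.axioms)
  have resF: "free_resolution A N b d \<epsilon>"
    using F by simp
  obtain \<alpha> where \<alpha>: "\<And>n. \<alpha> n \<in> module_hom A (?F n) (?G n)"
      "\<And>n j. \<alpha> n ` shifted_free A AG (b n) (a n) j \<subseteq> shifted_free A AG (b' n) (a' n) j"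
      "\<And>v. v \<in> carrier (?F 0) \<Longrightarrow> \<epsilon>' (\<alpha> 0 v) = \<epsilon> v"
      "\<And>n v. v \<in> carrier (?F (Suc n)) \<Longrightarrow> d' n (\<alpha> (Suc n) v) = \<alpha> n (d n v)"
    using graded_chain_map[OF N F G] by blast
  obtain \<beta> where \<beta>: "\<And>n. \<beta> n \<in> module_hom A (?G n) (?F n)"
      "\<And>v. v \<in> carrier (?G 0) \<Longrightarrow> \<epsilon> (\<beta> 0 v) = \<epsilon>' v"
      "\<And>n v. v \<in> carrier (?G (Suc n)) \<Longrightarrow> d n (\<beta> (Suc n) v) = \<beta> n (d' n v)"
    using graded_chain_map[OF N G F] by blast
  define \<phi> where "\<phi> = (\<lambda>n v. \<beta> n (\<alpha> n v))"
  have \<phi>: "\<phi> n \<in> module_hom A (?F n) (?F n)" for n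
    unfolding \<phi>_def using module_homD[OF \<alpha>(1)[of n]] module_homD[OF \<beta>(1)[of n]]
    by (intro module_homI) auto
  obtain h where h: "\<And>n. h n \<in> module_hom A (?F n) (?F (Suc n))"
      "\<And>v. v \<in> carrier (?F 0) \<Longrightarrow> d 0 (h 0 v) = \<phi> 0 v \<ominus>\<^bsub>?F 0\<^esub> v"
      "\<And>n v. v \<in> carrier (?F (Suc n)) \<Longrightarrow>
        d (Suc n) (h (Suc n) v) = (\<phi> (Suc n) v \<ominus>\<^bsub>?F (Suc n)\<^esub> v) \<ominus>\<^bsub>?F (Suc n)\<^esub> h n (d n v)"
  proof -
    have "\<epsilon> (\<phi> 0 v) = \<epsilon> v" if "v \<in> carrier (?F 0)" for v
      using that \<alpha>(3) \<beta>(2) module_homD(1)[OF \<alpha>(1)] by (simp add: \<phi>_def)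
    moreover have "d n (\<phi> (Suc n) v) = \<phi> n (d n v)" if "v \<in> carrier (?F (Suc n))" for n v
      using that \<alpha>(4) \<beta>(3) module_homD(1)[OF \<alpha>(1)] by (simp add: \<phi>_def)
    ultimately show thesis
      using chain_homotopy[OF N' resF \<phi>] that by blast
  qed
  have vF: "v \<in> carrier (?F i)"
    using v by (simp add: shifted_free_def)
  \<comment> \<open>in degree \<open>j\<close> all coordinates with respect to the second resolution have positive degree\<close>
  have "\<alpha> i v \<in> ideal_smult A I (?G i)"
  proof -
    have \<alpha>v: "\<alpha> i v \<in> shifted_free A AG (b' i) (a' i) j"
      using \<alpha>(2) v by blast
    have "\<alpha> i v s \<in> I" for s
    proof (cases "s < b' i")
      case True
      then have "\<alpha> i v s \<in> AG (j - a' i s)"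
        using \<alpha>v by (simp add: shifted_free_def)
      then show ?thesis
        using I(2)[of "j - a' i s"] j[OF True] by auto
    next
      case False
      then show ?thesis
        using \<alpha>v by (simp add: shifted_free_def free_module_mem)
    qed
    then show ?thesis
      using \<alpha>v by (simp add: ideal_smult_free_module[OF I(1)] shifted_free_def)
  qed
  then have \<phi>v: "\<phi> i v \<in> ideal_smult A I (?F i)"
    unfolding \<phi>_def
    by (rule linear_map.ideal_smult_closed[OF F.free_linear_map[OF \<beta>(1)] I.a_subset])
  have sub: "submodule (ideal_smult A I (?F n)) A (?F n)" for n
    unfolding F.ideal_smult_eq by (rule F.smult_span_submodule[OF I.a_subset subset_refl])
  have d: "linear_map A (?F (Suc n)) (?F n) (d n)" for n
    using resF by (intro F.free_linear_map) (simp add: free_resolution_def)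
  have hv: "h i v \<in> carrier (?F (Suc i))" "d i (h i v) \<in> carrier (?F i)" "\<phi> i v \<in> carrier (?F i)"
    using module_homD(1)[OF h(1) vF] linear_map.closed[OF d] module_homD(1)[OF \<phi> vF] by auto
  have dm: "d i (\<ominus>\<^bsub>?F (Suc i)\<^esub> h i v) = \<ominus>\<^bsub>?F i\<^esub> d i (h i v)"
    by (rule linear_map.minus[OF d hv(1)])
  show ?thesis
  proof (cases i)
    case 0
    have "d i (h i v) = \<phi> i v \<ominus>\<^bsub>?F i\<^esub> v"
      using h(2) vF 0 by simp
    then have "v = d i (\<ominus>\<^bsub>?F (Suc i)\<^esub> h i v) \<oplus>\<^bsub>?F i\<^esub> \<phi> i v"
      using hv vF by (simp add: dm) (simp add: a_minus_def F.M.minus_add F.M.minus_minus F.M.a_ac F.M.r_neg1 F.M.r_neg2 F.M.l_neg F.M.r_neg)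
    then show ?thesis
      using \<phi>v hv(1) by blast
  next
    case (Suc p)
    let ?u = "h p (d p v)"
    have u: "?u \<in> ideal_smult A I (?F i)"
      unfolding Suc
      by (rule linear_map.ideal_smult_closed[OF F.free_linear_map[OF h(1)] I.a_subset cycle[OF Suc]])
    have uF: "?u \<in> carrier (?F i)"
      using F.submoduleD(6)[OF sub u] .
    have "d i (h i v) = (\<phi> i v \<ominus>\<^bsub>?F i\<^esub> v) \<ominus>\<^bsub>?F i\<^esub> ?u"
      using h(3)[of v p] vF Suc by simp
    then have "v = d i (\<ominus>\<^bsub>?F (Suc i)\<^esub> h i v) \<oplus>\<^bsub>?F i\<^esub> (\<phi> i v \<ominus>\<^bsub>?F i\<^esub> ?u)"
      using hv vF uF by (simp add: dm) (simp add: a_minus_def F.M.minus_add F.M.minus_minus F.M.a_ac F.M.r_neg1 F.M.r_neg2 F.M.l_neg F.M.r_neg)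
    then show ?thesis
      using F.submoduleD(4)[OF sub \<phi>v u] hv(1) by blast
  qed
qed

text \<open>Tor is computed from some chosen resolution about which nothing is known beyond its being a
  graded free resolution. The previous lemma transfers to it the bound visible in \<open>G\<close>.\<close>

theorem graded_regularity_le:
  assumes N: "graded_module A N AG NG prN"
    and G: "graded_free_resolution A AG N NG (b', a', d', \<epsilon>')"
    and c: "\<And>i s. s < b' i \<Longrightarrow> a' i s \<le> int i + c"
  shows "graded_regularity A AG N NG \<le> ereal (real_of_int c)"
proof -
  obtain b a d \<epsilon> where chosen: "chosen_resolution A AG N NG = (b, a, d, \<epsilon>)"
    by (cases "chosen_resolution A AG N NG") auto
  have F: "graded_free_resolution A AG N NG (b, a, d, \<epsilon>)"
    using someI[of "graded_free_resolution A AG N NG", OF G]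
    by (simp only: chosen[symmetric] chosen_resolution_def)
  define I where "I = irrelevant_ideal A AG"
  have pos: "(\<Union>j\<in>{0<..}. AG j) \<subseteq> carrier A"
    using AG_carrier by auto
  have I: "ideal I A"
    unfolding I_def irrelevant_ideal_def by (rule genideal_ideal[OF pos])
  interpret I: ideal I A by (rule I)
  have I_pos: "AG j \<subseteq> I" if "0 < j" for j
    using genideal_self[OF pos] that unfolding I_def irrelevant_ideal_def by auto
  let ?F = "\<lambda>n. free_module A (b n)"
  define K where "K = (\<lambda>n. ideal_smult A I (?F n))"
  interpret F: module A "?F n" for n by (rule free_module_module)
  have K: "submodule (K n) A (?F n)" for n
    unfolding K_def F.ideal_smult_eq by (rule F.smult_span_submodule[OF I.a_subset subset_refl])
  have d: "linear_map A (?F (Suc n)) (?F n) (d n)" for n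
    using F by (intro F.free_linear_map) (simp add: free_resolution_def)
  have dK: "d n ` K (Suc n) \<subseteq> K n" for n
    using linear_map.ideal_smult_closed[OF d I.a_subset] by (auto simp: K_def)
  define C where "C = tor_complex A AG N NG"
  define D where "D = tor_diff A AG N NG"
  have C: "C n = quot_module (?F n) (K n)" for n
    by (simp add: C_def tor_complex_def chosen tensor_k_def K_def I_def)
  have D: "D n (K (Suc n) +>\<^bsub>?F (Suc n)\<^esub> v) = K n +>\<^bsub>?F n\<^esub> d n v" if "v \<in> carrier (?F (Suc n))" for n v
    using linear_map.quot_map_coset[OF d K K dK that]
    by (simp add: D_def tor_diff_def chosen tensor_k_map_def K_def I_def)
  have C_module: "module A (C n)" for n
    unfolding C by (rule F.quot_module_module[OF K])
  have C_group: "abelian_group (C n)" for n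
    using C_module by (rule module.axioms)
  have C_zero: "\<zero>\<^bsub>C n\<^esub> = K n" for n
    by (simp add: C F.quot_module_zero)
  define B where "B = boundaries C D"
  have B_carrier: "B n = (\<lambda>v. K n +>\<^bsub>?F n\<^esub> d n v) ` carrier (?F (Suc n))" for n
    using D by (simp add: B_def boundaries_def C F.quot_module_carrier image_image)
  have B: "subgroup (B n) (add_monoid (C n))" for n
    unfolding B_def boundaries_def
  proof (rule additive_image_subgroup[OF C_group C_group])
    fix X assume "X \<in> carrier (C (Suc n))"
    then obtain v where v: "v \<in> carrier (?F (Suc n))" "X = K (Suc n) +>\<^bsub>?F (Suc n)\<^esub> v"
      by (auto simp: C F.quot_module_carrier)
    show "D n X \<in> carrier (C n)"
      using v D linear_map.closed[OF d v(1)] by (auto simp: C F.quot_module_carrier)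
    fix Y assume "Y \<in> carrier (C (Suc n))"
    then obtain w where w: "w \<in> carrier (?F (Suc n))" "Y = K (Suc n) +>\<^bsub>?F (Suc n)\<^esub> w"
      by (auto simp: C F.quot_module_carrier)
    have "X \<oplus>\<^bsub>C (Suc n)\<^esub> Y = K (Suc n) +>\<^bsub>?F (Suc n)\<^esub> (v \<oplus>\<^bsub>?F (Suc n)\<^esub> w)"
      unfolding v(2) w(2) C by (rule F.quot_module_add[OF K v(1) w(1)])
    moreover have "D n X \<oplus>\<^bsub>C n\<^esub> D n Y = K n +>\<^bsub>?F n\<^esub> (d n v \<oplus>\<^bsub>?F n\<^esub> d n w)"
      unfolding v(2) w(2) C D[OF v(1)] D[OF w(1)]
      by (rule F.quot_module_add[OF K linear_map.closed[OF d v(1)] linear_map.closed[OF d w(1)]])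
    ultimately show "D n (X \<oplus>\<^bsub>C (Suc n)\<^esub> Y) = D n X \<oplus>\<^bsub>C n\<^esub> D n Y"
      using D[of "v \<oplus>\<^bsub>?F (Suc n)\<^esub> w" n] v(1) w(1) by (simp add: linear_map.add[OF d v(1) w(1)])
  qed
  have Tor: "Tor_component A AG N NG i j
      = (\<lambda>X. B i +>\<^bsub>C i\<^esub> X) ` (cycles C D i \<inter> (\<lambda>v. K i +>\<^bsub>?F i\<^esub> v) ` shifted_free A AG (b i) (a i) j)"
    for i j
    by (simp add: Tor_component_def tor_complex_component_def chosen Let_def C_def D_def B_def K_def I_def)
  have Tor_zero: "\<zero>\<^bsub>Tor A AG N NG i\<^esub> = B i" for i
    by (simp add: Tor_def homology_def quot_module_def B_def C_def D_def)
  have "Tor_component A AG N NG i j = {\<zero>\<^bsub>Tor A AG N NG i\<^esub>}" if j: "int i + c < j" for i j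
  proof -
    have "B i +>\<^bsub>C i\<^esub> X = B i"
      if X: "X \<in> cycles C D i" "X \<in> (\<lambda>v. K i +>\<^bsub>?F i\<^esub> v) ` shifted_free A AG (b i) (a i) j" for X
    proof -
      obtain v where v: "v \<in> shifted_free A AG (b i) (a i) j" "X = K i +>\<^bsub>?F i\<^esub> v"
        using X(2) by auto
      have vF: "v \<in> carrier (?F i)"
        using v(1) by (simp add: shifted_free_def)
      have "d p v \<in> ideal_smult A I (?F p)" if i: "i = Suc p" for p
      proof -
        have "K p +>\<^bsub>?F p\<^esub> d p v = K p"
          using X(1) D[of v p] v(2) vF i by (simp add: cycles_def C_zero)
        then have "d p v \<in> K p"
          using F.coset_eq_self_iff[OF K] linear_map.closed[OF d] vF i by auto
        then show ?thesis by (simp add: K_def)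
      qed
      moreover have "a' i s < j" if "s < b' i" for s
        using c[OF that] j by linarith
      ultimately obtain w u where wu: "w \<in> carrier (?F (Suc i))" "u \<in> K i" "v = d i w \<oplus>\<^bsub>?F i\<^esub> u"
        using cycle_is_boundary[OF N F G I I_pos _ v(1)] unfolding K_def by blast
      have carr: "d i w \<in> carrier (?F i)" "u \<in> carrier (?F i)"
        using linear_map.closed[OF d wu(1)] F.submoduleD(6)[OF K wu(2)] by auto
      have "v \<ominus>\<^bsub>?F i\<^esub> d i w = u"
        using carr unfolding wu(3) a_minus_def by (simp add: F.M.a_ac F.M.r_neg1 F.M.r_neg2 F.M.r_neg)
      then have "X = K i +>\<^bsub>?F i\<^esub> d i w"
        unfolding v(2) using F.coset_eq_iff[OF K vF carr(1)] wu(2) by simp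
      then have "X \<in> B i"
        using wu(1) by (auto simp: B_carrier)
      then show ?thesis
        using abelian_group.a_coset_join2[OF C_group _ B] subgroup.subset[OF B] by auto
    qed
    moreover have "K i \<in> cycles C D i \<inter> (\<lambda>v. K i +>\<^bsub>?F i\<^esub> v) ` shifted_free A AG (b i) (a i) j"
    proof
      interpret FG: graded_module A "?F i" AG "shifted_free A AG (b i) (a i)" "free_pr (a i)"
        by (rule free_graded_module)
      have K0: "K n +>\<^bsub>?F n\<^esub> \<zero>\<^bsub>?F n\<^esub> = K n" for n
        using F.M.a_coset_add_zero F.submoduleD(1)[OF K] by simp
      show "K i \<in> (\<lambda>v. K i +>\<^bsub>?F i\<^esub> v) ` shifted_free A AG (b i) (a i) j"
        using K0 FG.NG_zero by (auto intro: image_eqI[of _ _ "\<zero>\<^bsub>?F i\<^esub>"])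
      have "K i \<in> carrier (C i)"
        using K0[of i] by (auto simp: C F.quot_module_carrier intro: image_eqI[of _ _ "\<zero>\<^bsub>?F i\<^esub>"])
      moreover have "D p (K (Suc p)) = K p" for p
        using D[of "\<zero>\<^bsub>?F (Suc p)\<^esub>" p] K0 linear_map.zero[OF d] by simp
      ultimately show "K i \<in> cycles C D i"
        by (auto simp: cycles_def C_zero split: nat.split)
    qed
    ultimately show ?thesis
      unfolding Tor Tor_zero by (auto simp: image_iff)
  qed
  then have bound: "j - int i \<le> c"
    if "Tor_component A AG N NG i j \<noteq> {\<zero>\<^bsub>Tor A AG N NG i\<^esub>}" for i j
    using that by force
  show ?thesis
    unfolding graded_regularity_def
  proof (rule Sup_least)
    fix e assume "e \<in> {ereal (real_of_int (j - int i)) | i j.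
      Tor_component A AG N NG i j \<noteq> {\<zero>\<^bsub>Tor A AG N NG i\<^esub>}}"
    then obtain i j where e: "e = ereal (real_of_int (j - int i))"
      and "Tor_component A AG N NG i j \<noteq> {\<zero>\<^bsub>Tor A AG N NG i\<^esub>}"
      by blast
    then have "real_of_int (j - int i) \<le> real_of_int c"
      using bound of_int_le_iff by blast
    then show "e \<le> ereal (real_of_int c)"
      by (simp only: e ereal_less_eq)
  qed
qed

end

section \<open>Resolutions over graded rings with a Conca generator\<close>

locale graded_conca_ring = graded_cring A AG prA for A (structure) and AG prA + fixes x
  assumes noetherian: "noetherian_ring A" and x_degree: "x \<in> AG 1" and x_square: "x \<otimes> x = \<zero>"
    and x_generates: "2 \<le> j \<Longrightarrow> u \<in> AG j \<Longrightarrow> \<exists>w\<in>AG (j - 1). u = x \<otimes> w"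
begin

lemma x_carrier: "x \<in> carrier A"
  using x_degree by (rule AG_carrier)

text \<open>The state of the construction of the resolution: a graded submodule \<open>K\<close> of a graded free module
  \<open>F\<close> with generators of degree at most \<open>n + 1\<close>, such that \<open>K\<^sub>j = xK\<^sub>j\<^sub>-\<^sub>1\<close> for \<open>j \<ge> n + 3\<close>.\<close>

definition syzygy_invariant :: "nat \<Rightarrow> nat \<Rightarrow> (nat \<Rightarrow> int) \<Rightarrow> (nat \<Rightarrow> 'a) set \<Rightarrow> bool" where
  "syzygy_invariant n b a K \<longleftrightarrow> submodule K A (free_module A b) \<and>
     (\<forall>v\<in>K. \<forall>j. free_pr a j v \<in> K) \<and> (\<forall>s<b. a s \<le> int n + 1) \<and>
     (\<forall>j\<ge>int n + 3. \<forall>v\<in>K \<inter> shifted_free A AG b a j.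
        \<exists>w\<in>K \<inter> shifted_free A AG b a (j - 1). v = x \<odot>\<^bsub>free_module A b\<^esub> w)"

text \<open>An element \<open>z\<close> of the kernel of degree \<open>j \<ge> n + 3\<close> is \<open>z = xg\<close>, because its coordinates have
  degree at least \<open>2\<close>. The image of \<open>g\<close> has degree at least \<open>n + 2\<close>, so it is \<open>x f(g')\<close> for some
  homogeneous \<open>g'\<close>. Then \<open>g - xg'\<close> lies in the kernel, and \<open>x(g - xg') = z\<close> as \<open>x\<^sup>2 = 0\<close>.\<close>

lemma kernel_syzygy_invariant:
  assumes f: "graded_linear_map A (free_module A b) X AG (shifted_free A AG b a) (free_pr a) XG prX f"
    and a: "\<And>s. s < b \<Longrightarrow> a s \<le> int n + 1"
    and im: "\<And>j y. int n + 2 \<le> j \<Longrightarrow> y \<in> XG j \<Longrightarrow> y \<in> f ` carrier (free_module A b) \<Longrightarrow>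
      \<exists>y'. y' \<in> XG (j - 1) \<and> y' \<in> f ` carrier (free_module A b) \<and> y = x \<odot>\<^bsub>X\<^esub> y'"
  shows "syzygy_invariant n b a {v \<in> carrier (free_module A b). f v = \<zero>\<^bsub>X\<^esub>}"
proof -
  let ?F = "free_module A b" and ?FG = "shifted_free A AG b a"
  interpret f: graded_linear_map A ?F X AG ?FG "free_pr a" XG prX f by (rule f)
  have step: "\<exists>w. w \<in> carrier ?F \<and> f w = \<zero>\<^bsub>X\<^esub> \<and> w \<in> ?FG (j - 1) \<and> z = x \<odot>\<^bsub>?F\<^esub> w"
    if j: "int n + 3 \<le> j" and z: "z \<in> ?FG j" "f z = \<zero>\<^bsub>X\<^esub>" for j z
  proof -
    have "\<exists>g. (s < b \<longrightarrow> g \<in> AG (j - 1 - a s)) \<and> (b \<le> s \<longrightarrow> g = \<zero>) \<and> z s = x \<otimes> g" for s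
    proof (cases "s < b")
      case True
      then have "2 \<le> j - a s" "z s \<in> AG (j - a s)"
        using a[of s] j z(1) by (auto simp: shifted_free_def)
      from x_generates[OF this] show ?thesis
        using True by (auto simp: algebra_simps)
    next
      case False
      then show ?thesis
        using z(1) x_carrier by (intro exI[of _ \<zero>]) (auto simp: shifted_free_def free_module_mem)
    qed
    then obtain g where g: "\<And>s. s < b \<Longrightarrow> g s \<in> AG (j - 1 - a s)" "\<And>s. b \<le> s \<Longrightarrow> g s = \<zero>"
      "\<And>s. z s = x \<otimes> g s"
      by metis
    have "g s \<in> carrier A" for s
      using g(1,2) AG_carrier by (cases "s < b") auto
    then have gF: "g \<in> ?FG (j - 1)" "g \<in> carrier ?F" and zg: "z = x \<odot>\<^bsub>?F\<^esub> g"
      using g by (auto simp: shifted_free_def free_module_mem free_module_simps)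
    obtain y where y: "y \<in> XG (j - 1 - 1)" "y \<in> f ` carrier ?F" "f g = x \<odot>\<^bsub>X\<^esub> y"
      using im[of "j - 1" "f g"] j f.degree[OF gF(1)] gF(2) by auto
    obtain g' where g': "g' \<in> ?FG (j - 1 - 1)" "f g' = y"
      using f.homogeneous_preimage[OF y(1,2)] by auto
    have xg': "x \<odot>\<^bsub>?F\<^esub> g' \<in> ?FG (j - 1)" and g'F: "g' \<in> carrier ?F"
      using f.M.act[OF x_degree g'(1)] f.M.NG_carrier[OF g'(1)] by auto
    let ?w = "g \<ominus>\<^bsub>?F\<^esub> x \<odot>\<^bsub>?F\<^esub> g'"
    have "f ?w = \<zero>\<^bsub>X\<^esub>"
      using gF(2) g'F g'(2) y(3) x_carrier f.closed[OF gF(2)]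
      by (simp add: f.diff f.smult) (simp add: a_minus_def f.N.M.r_neg)
    moreover have "x \<odot>\<^bsub>?F\<^esub> ?w = z"
    proof -
      have "x \<odot>\<^bsub>?F\<^esub> (x \<odot>\<^bsub>?F\<^esub> g') = \<zero>\<^bsub>?F\<^esub>"
        using x_carrier g'F x_square by (simp flip: f.M.smult_assoc1)
      then show ?thesis
        using x_carrier gF(2) g'F zg
        by (simp add: a_minus_def f.M.smult_r_distr f.M.smult_r_minus f.M.M.minus_equality)
    qed
    ultimately show ?thesis
      using f.M.NG_diff[OF gF(1) xg'] gF(2) g'F x_carrier by (intro exI[of _ ?w]) auto
  qed
  show ?thesis
    unfolding syzygy_invariant_def
  proof (intro conjI ballI allI impI)
    fix j v assume "int n + 3 \<le> j" "v \<in> {v \<in> carrier ?F. f v = \<zero>\<^bsub>X\<^esub>} \<inter> ?FG j"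
    then show "\<exists>w\<in>{v \<in> carrier ?F. f v = \<zero>\<^bsub>X\<^esub>} \<inter> ?FG (j - 1). v = x \<odot>\<^bsub>?F\<^esub> w"
      using step[of j v] by blast
  qed (use f.kernel_submodule f.kernel_graded f.M.pr_closed a in auto)
qed

text \<open>The homogeneous elements of degree at most \<open>n + 2\<close> generate \<open>K\<close>, because those of higher degree
  are multiples of them by powers of \<open>x\<close>; finitely many suffice because \<open>A\<close> is Noetherian.\<close>

lemma syzygy_invariant_cover:
  assumes K: "syzygy_invariant n b a K"
  shows "\<exists>b' a' d. graded_linear_map A (free_module A b') (free_module A b) AG
      (shifted_free A AG b' a') (free_pr a') (shifted_free A AG b a) (free_pr a) d \<and>
    d ` carrier (free_module A b') = K \<and>
    syzygy_invariant (Suc n) b' a' {v \<in> carrier (free_module A b'). d v = \<zero>\<^bsub>free_module A b\<^esub>}"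
proof -
  let ?F = "free_module A b" and ?FG = "shifted_free A AG b a"
  interpret F: graded_module A ?F AG ?FG "free_pr a" by (rule free_graded_module)
  have sub: "submodule K A ?F" and pr: "\<And>v j. v \<in> K \<Longrightarrow> free_pr a j v \<in> K"
    and step: "\<And>j v. int n + 3 \<le> j \<Longrightarrow> v \<in> K \<Longrightarrow> v \<in> ?FG j \<Longrightarrow>
      \<exists>w. w \<in> K \<and> w \<in> ?FG (j - 1) \<and> v = x \<odot>\<^bsub>?F\<^esub> w"
    using K unfolding syzygy_invariant_def by blast+
  note KD = F.submoduleD[OF sub]
  define S where "S = {v \<in> K. \<exists>j\<le>int n + 2. v \<in> ?FG j}"
  have S: "S \<subseteq> carrier ?F" "S \<subseteq> K"
    using KD(1) by (auto simp: S_def)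
  note H = F.span_of_submodule[OF S(1)]
  note HD = F.submoduleD[OF H]
  have homog: "v \<in> span_of A ?F S" if "v \<in> K" "v \<in> ?FG j" "j \<le> int n + 2 + int m" for v j m
    using that
  proof (induction m arbitrary: v j)
    case 0
    then show ?case
      using F.span_of_superset[of S] by (auto simp: S_def)
  next
    case (Suc m)
    show ?case
    proof (cases "j \<le> int n + 2 + int m")
      case True
      then show ?thesis using Suc by blast
    next
      case False
      then obtain w where w: "w \<in> K" "w \<in> ?FG (j - 1)" "v = x \<odot>\<^bsub>?F\<^esub> w"
        using step[of j v] Suc.prems by auto
      then show ?thesis
        using Suc.IH[of w "j - 1"] Suc.prems(3) HD(5) x_carrier by auto
    qed
  qed
  have "K \<subseteq> span_of A ?F S"
  proof
    fix v assume v: "v \<in> K"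
    show "v \<in> span_of A ?F S"
    proof (rule F.mem_of_components[OF HD(2,3) KD(6)[OF v]])
      fix j
      show "free_pr a j v \<in> span_of A ?F S"
        using homog[OF pr[OF v] F.pr_mem[OF KD(6)[OF v]], of j "nat (j - int n - 2)"] by auto
    qed
  qed
  moreover have "span_of A ?F S \<subseteq> K"
    by (rule F.span_of_least[OF sub S(2)])
  ultimately have span: "span_of A ?F S = K" by auto
  obtain T where T: "T \<subseteq> K" "finite T" "span_of A ?F T = K"
    using noetherian_free_module[OF noetherian sub] by auto
  obtain S0 where S0: "S0 \<subseteq> S" "finite S0" "T \<subseteq> span_of A ?F S0"
    using F.span_of_finite_subset[OF S(1) T(2)] T(1) span by auto
  have span0: "span_of A ?F S0 = K"
  proof
    show "span_of A ?F S0 \<subseteq> K"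
      using F.span_of_mono[OF S0(1)] span by simp
    have "submodule (span_of A ?F S0) A ?F"
      using S0(1) S(1) by (intro F.span_of_submodule) auto
    then show "K \<subseteq> span_of A ?F S0"
      using F.span_of_least S0(3) T(3) by blast
  qed
  define b' where "b' = card S0"
  obtain z where "bij_betw z {..<b'} S0"
    using ex_bij_betw_nat_finite[OF S0(2)] by (auto simp: atLeast0LessThan b'_def)
  then have z: "z ` {..<b'} = S0"
    by (auto simp: bij_betw_def)
  then have zS: "z s \<in> S" if "s < b'" for s
    using S0(1) that by auto
  have "\<exists>j. s < b' \<longrightarrow> j \<le> int n + 2 \<and> z s \<in> ?FG j" for s
    using zS[of s] by (auto simp: S_def)
  then obtain a' where a': "\<And>s. s < b' \<Longrightarrow> a' s \<le> int n + 2" "\<And>s. s < b' \<Longrightarrow> z s \<in> ?FG (a' s)"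
    by metis
  have zF: "\<And>s. s < b' \<Longrightarrow> z s \<in> carrier ?F"
    using zS S(1) by auto
  let ?d = "free_map ?F b' z"
  have d_hom: "?d \<in> module_hom A (free_module A b') ?F"
    by (rule F.free_map_hom[OF zF])
  have d_degree: "?d v \<in> ?FG j" if "v \<in> shifted_free A AG b' a' j" for v j
    using free_map_degree[OF F.graded_module_axioms d_hom _ that] F.free_map_unit_vector[OF zF] a'(2) by auto
  have d: "graded_linear_map A (free_module A b') ?F AG (shifted_free A AG b' a') (free_pr a') ?FG (free_pr a) ?d"
    by (intro graded_linear_map.intro graded_linear_map_axioms.intro free_graded_module d_hom d_degree)
  have im: "?d ` carrier (free_module A b') = K"
    using F.free_map_image[OF zF] z span0 by simp
  have "syzygy_invariant (Suc n) b' a' {v \<in> carrier (free_module A b'). ?d v = \<zero>\<^bsub>?F\<^esub>}"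
  proof (rule kernel_syzygy_invariant[OF d])
    show "a' s \<le> int (Suc n) + 1" if "s < b'" for s
      using a'(1)[OF that] by simp
    show "\<exists>y'. y' \<in> ?FG (j - 1) \<and> y' \<in> ?d ` carrier (free_module A b') \<and> y = x \<odot>\<^bsub>?F\<^esub> y'"
      if "int (Suc n) + 2 \<le> j" "y \<in> ?FG j" "y \<in> ?d ` carrier (free_module A b')" for j y
      using step[of j y] that unfolding im by auto
  qed
  then show ?thesis
    using d im by blast
qed

text \<open>Start the construction with a cover by generators of degree \<open>0\<close>.\<close>

theorem graded_regularity_le_1:
  assumes N: "graded_module A N AG NG prN"
    and S: "S \<subseteq> NG 0" "finite S" "span_of A N S = carrier N"
    and gen: "\<And>j v. 2 \<le> j \<Longrightarrow> v \<in> NG j \<Longrightarrow> \<exists>w\<in>NG (j - 1). v = x \<odot>\<^bsub>N\<^esub> w"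
  shows "graded_regularity A AG N NG \<le> 1"
proof -
  interpret N: graded_module A N AG NG prN by (rule N)
  define b0 where "b0 = card S"
  obtain z where "bij_betw z {..<b0} S"
    using ex_bij_betw_nat_finite[OF S(2)] by (auto simp: atLeast0LessThan b0_def)
  then have z: "z ` {..<b0} = S"
    by (auto simp: bij_betw_def)
  then have z0: "\<And>s. s < b0 \<Longrightarrow> z s \<in> NG 0"
    using S(1) by auto
  then have zN: "\<And>s. s < b0 \<Longrightarrow> z s \<in> carrier N"
    using N.NG_carrier by blast
  let ?\<epsilon> = "free_map N b0 z" and ?a0 = "\<lambda>_::nat. 0::int"
  have \<epsilon>_hom: "?\<epsilon> \<in> module_hom A (free_module A b0) N"
    by (rule N.free_map_hom[OF zN])
  have \<epsilon>_degree: "?\<epsilon> v \<in> NG j" if "v \<in> shifted_free A AG b0 ?a0 j" for v j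
    using free_map_degree[OF N \<epsilon>_hom _ that] N.free_map_unit_vector[OF zN] z0 by auto
  have \<epsilon>: "graded_linear_map A (free_module A b0) N AG (shifted_free A AG b0 ?a0) (free_pr ?a0) NG prN ?\<epsilon>"
    by (intro graded_linear_map.intro graded_linear_map_axioms.intro free_graded_module N \<epsilon>_hom \<epsilon>_degree)
  have surj: "?\<epsilon> ` carrier (free_module A b0) = carrier N"
    using N.free_map_image[OF zN] z S(3) by simp
  have "\<exists>b a d. free_resolution A N b d ?\<epsilon> \<and> b 0 = b0 \<and> a 0 = ?a0 \<and>
      (\<forall>n. syzygy_invariant n (b n) (a n) (d n ` carrier (free_module A (b (Suc n))))) \<and>
      (\<forall>n. graded_linear_map A (free_module A (b (Suc n))) (free_module A (b n)) AG
        (shifted_free A AG (b (Suc n)) (a (Suc n))) (free_pr (a (Suc n)))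
        (shifted_free A AG (b n) (a n)) (free_pr (a n)) (d n))"
  proof (rule free_resolution_by_steps[OF \<epsilon>_hom surj, where P = syzygy_invariant and Q = "\<lambda>b a b' a' d.
        graded_linear_map A (free_module A b') (free_module A b) AG
        (shifted_free A AG b' a') (free_pr a') (shifted_free A AG b a) (free_pr a) d"])
    show "syzygy_invariant 0 b0 ?a0 {v \<in> carrier (free_module A b0). ?\<epsilon> v = \<zero>\<^bsub>N\<^esub>}"
    proof (rule kernel_syzygy_invariant[OF \<epsilon>])
      fix j y assume "int 0 + 2 \<le> j" "y \<in> NG j"
      then obtain w where "w \<in> NG (j - 1)" "y = x \<odot>\<^bsub>N\<^esub> w"
        using gen[of j y] by auto
      then show "\<exists>y'. y' \<in> NG (j - 1) \<and> y' \<in> ?\<epsilon> ` carrier (free_module A b0) \<and> y = x \<odot>\<^bsub>N\<^esub> y'"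
        using N.NG_carrier unfolding surj by blast
    qed simp
  next
    fix n b a K assume "syzygy_invariant n b a K"
    from syzygy_invariant_cover[OF this]
    show "\<exists>b' a' d. d \<in> module_hom A (free_module A b') (free_module A b) \<and>
        d ` carrier (free_module A b') = K \<and>
        graded_linear_map A (free_module A b') (free_module A b) AG
          (shifted_free A AG b' a') (free_pr a') (shifted_free A AG b a) (free_pr a) d \<and>
        syzygy_invariant (Suc n) b' a' {v \<in> carrier (free_module A b'). d v = \<zero>\<^bsub>free_module A b\<^esub>}"
      using graded_linear_map.hom by blast
  qed
  then obtain b a d where G: "free_resolution A N b d ?\<epsilon>" "b 0 = b0" "a 0 = ?a0"
      "\<And>n. syzygy_invariant n (b n) (a n) (d n ` carrier (free_module A (b (Suc n))))"
      "\<And>n. graded_linear_map A (free_module A (b (Suc n))) (free_module A (b n)) AG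
        (shifted_free A AG (b (Suc n)) (a (Suc n))) (free_pr (a (Suc n)))
        (shifted_free A AG (b n) (a n)) (free_pr (a n)) (d n)"
    by blast
  have "graded_free_resolution A AG N NG (b, a, d, ?\<epsilon>)"
    using G(1-3) \<epsilon>_degree graded_linear_map.degree[OF G(5)] by auto
  moreover have "a i s \<le> int i + 1" if "s < b i" for i s
    using G(4)[of i] that by (simp add: syzygy_invariant_def)
  ultimately have "graded_regularity A AG N NG \<le> ereal (real_of_int 1)"
    by (rule graded_regularity_le[OF N])
  then show ?thesis
    by (simp add: one_ereal_def)
qed

end

section \<open>Associated graded rings and modules are graded\<close>

definition single_entry :: "('a, 'b, 'm) module_scheme \<Rightarrow> nat \<Rightarrow> 'b \<Rightarrow> nat \<Rightarrow> 'b" where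
  "single_entry M l v = (\<lambda>i. if i = l then v else \<zero>\<^bsub>M\<^esub>)"

definition gr_pr :: "(nat \<Rightarrow> 'b set) \<Rightarrow> int \<Rightarrow> (nat \<Rightarrow> 'b set) \<Rightarrow> nat \<Rightarrow> 'b set" where
  "gr_pr E j f = (\<lambda>l. if int l = j then f l else E (Suc l))"

context filtration
begin

lemma single_entry_reps: "v \<in> E l \<Longrightarrow> single_entry M l v \<in> gr_reps M E"
  by (auto simp: gr_reps_def single_entry_def E_zero)

lemma gr_component_single:
  "gr_component M E (int l) = (\<lambda>v. gr_class M E (single_entry M l v)) ` E l"
proof (intro subset_antisym subsetI)
  fix f assume f: "f \<in> gr_component M E (int l)"
  then obtain p where p: "p \<in> gr_reps M E" "f = gr_class M E p"
    by (auto simp: gr_component_def gr_carrier)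
  have "f i = gr_class M E (single_entry M l (p l)) i" for i
    using f p(2) submoduleD(1)[OF E_submodule]
    by (cases "i = l") (auto simp: gr_component_def piece_simps gr_class_def single_entry_def)
  then show "f \<in> (\<lambda>v. gr_class M E (single_entry M l v)) ` E l"
    using gr_repsD(1)[OF p(1), of l] by blast
next
  fix f assume "f \<in> (\<lambda>v. gr_class M E (single_entry M l v)) ` E l"
  then show "f \<in> gr_component M E (int l)"
    using single_entry_reps submoduleD(1)[OF E_submodule]
    by (auto simp: gr_component_def gr_carrier piece_simps) (auto simp: gr_class_def single_entry_def)
qed

lemma gr_component_negative:
  assumes "j < 0" shows "gr_component M E j = {\<zero>\<^bsub>assoc_gr M E\<^esub>}"
proof -
  have "(\<lambda>i. E (Suc i)) \<in> carrier (assoc_gr M E)"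
    using gr_reps_zero by (auto simp: gr_carrier gr_class_zero intro!: image_eqI[OF _ gr_reps_zero])
  then show ?thesis
    using assms by (auto simp: gr_component_def piece_simps gr_zero gr_class_zero)
qed

lemma gr_pr_class:
  "gr_pr E j (gr_class M E p) = gr_class M E (\<lambda>l. if int l = j then p l else \<zero>\<^bsub>M\<^esub>)"
  using submoduleD(1)[OF E_submodule] by (auto simp: gr_pr_def gr_class_def fun_eq_iff)

lemma gr_pr_reps: "p \<in> gr_reps M E \<Longrightarrow> (\<lambda>l. if int l = j then p l else \<zero>\<^bsub>M\<^esub>) \<in> gr_reps M E"
  by (auto simp: gr_reps_def E_zero elim!: rev_finite_subset)

end

lemma (in module) convolution_single:
  assumes a: "a \<in> carrier R" and v: "v \<in> carrier M"
  shows "convolution M (single_entry (ring_module R) i a) (single_entry M j v)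
    = single_entry M (i + j) (a \<odot>\<^bsub>M\<^esub> v)"
proof
  fix n
  have "convolution M (single_entry (ring_module R) i a) (single_entry M j v) n
      = (\<Oplus>\<^bsub>M\<^esub>k\<in>{..n}. if i = k then (if n = i + j then a \<odot>\<^bsub>M\<^esub> v else \<zero>\<^bsub>M\<^esub>) else \<zero>\<^bsub>M\<^esub>)"
    unfolding convolution_def using a v
    by (intro M.finsum_cong') (auto simp: single_entry_def ring_module_simps)
  also have "\<dots> = single_entry M (i + j) (a \<odot>\<^bsub>M\<^esub> v) n"
  proof (cases "i \<le> n")
    case True
    then show ?thesis
      using M.finsum_singleton[of i "{..n}" "\<lambda>_. if n = i + j then a \<odot>\<^bsub>M\<^esub> v else \<zero>\<^bsub>M\<^esub>"] a v
      by (simp add: single_entry_def)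
  next
    case False
    then have "(\<Oplus>\<^bsub>M\<^esub>k\<in>{..n}. if i = k then (if n = i + j then a \<odot>\<^bsub>M\<^esub> v else \<zero>\<^bsub>M\<^esub>) else \<zero>\<^bsub>M\<^esub>)
        = (\<Oplus>\<^bsub>M\<^esub>k\<in>{..n}. \<zero>\<^bsub>M\<^esub>)"
      by (intro M.finsum_cong') auto
    then show ?thesis
      using False by (simp add: single_entry_def)
  qed
  finally show "convolution M (single_entry (ring_module R) i a) (single_entry M j v) n
      = single_entry M (i + j) (a \<odot>\<^bsub>M\<^esub> v) n" .
qed

lemma (in module) convolution_scalar:
  assumes a: "a \<in> carrier R" and p: "\<And>i. p i \<in> carrier M"
  shows "convolution M (single_entry (ring_module R) 0 a) p = (\<lambda>i. a \<odot>\<^bsub>M\<^esub> p i)"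
proof
  fix n
  have "convolution M (single_entry (ring_module R) 0 a) p n
      = (\<Oplus>\<^bsub>M\<^esub>k\<in>{..n}. if 0 = k then a \<odot>\<^bsub>M\<^esub> p (n - k) else \<zero>\<^bsub>M\<^esub>)"
    unfolding convolution_def using a p
    by (intro M.finsum_cong') (auto simp: single_entry_def ring_module_simps)
  also have "\<dots> = a \<odot>\<^bsub>M\<^esub> p n"
    using M.finsum_singleton[of 0 "{..n}" "\<lambda>k. a \<odot>\<^bsub>M\<^esub> p (n - k)"] a p by simp
  finally show "convolution M (single_entry (ring_module R) 0 a) p n = a \<odot>\<^bsub>M\<^esub> p n" .
qed

text \<open>The ring \<open>\<Oplus>\<^sub>i J\<^sub>i/J\<^sub>i\<^sub>+\<^sub>1\<close> for an arbitrary filtration; \<open>R\<^sup>g\<close> is the case of the powers of the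
  maximal ideal.\<close>

definition assoc_gr_ring :: "('a, 'r) ring_scheme \<Rightarrow> (nat \<Rightarrow> 'a set) \<Rightarrow> (nat \<Rightarrow> 'a set) ring" where
  "assoc_gr_ring R J =
     \<lparr>carrier = carrier (assoc_gr (ring_module R) J),
      monoid.mult = (\<odot>\<^bsub>assoc_gr (ring_module R) J\<^esub>),
      one = (\<lambda>i. if i = 0 then J 1 +>\<^bsub>R\<^esub> \<one>\<^bsub>R\<^esub> else J (Suc i)),
      zero = \<zero>\<^bsub>assoc_gr (ring_module R) J\<^esub>, add = (\<oplus>\<^bsub>assoc_gr (ring_module R) J\<^esub>)\<rparr>"

text \<open>Thus the grading of the ring is an instance of the grading of modules.\<close>

lemma ring_module_assoc_gr_ring: "ring_module (assoc_gr_ring R J) = assoc_gr (ring_module R) J"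
  by (subst ring_module_def) (simp add: assoc_gr_ring_def assoc_gr_def)

context graded_action
begin

abbreviation (input) "gr_A \<equiv> assoc_gr_ring R J"

interpretation ring: graded_action R "ring_module R" J J
  by (rule ring_action)

lemma gr_ring_simps:
  "carrier gr_A = gr_ring_class ` ring_reps"
  "\<zero>\<^bsub>gr_A\<^esub> = gr_ring_class (\<lambda>_. \<zero>)"
  "\<one>\<^bsub>gr_A\<^esub> = gr_ring_class (single_entry (ring_module R) 0 \<one>)"
  "r \<in> ring_reps \<Longrightarrow> s \<in> ring_reps \<Longrightarrow>
    gr_ring_class r \<oplus>\<^bsub>gr_A\<^esub> gr_ring_class s = gr_ring_class (\<lambda>i. r i \<oplus> s i)"
  "r \<in> ring_reps \<Longrightarrow> s \<in> ring_reps \<Longrightarrow>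
    gr_ring_class r \<otimes>\<^bsub>gr_A\<^esub> gr_ring_class s = gr_ring_class (convolution (ring_module R) r s)"
proof -
  have "J i +>\<^bsub>R\<^esub> \<zero> = J i" for i
    using R.a_coset_add_zero ideal.Icarr[OF J_ideal] by (simp add: subset_iff)
  then show "\<one>\<^bsub>gr_A\<^esub> = gr_ring_class (single_entry (ring_module R) 0 \<one>)"
    by (auto simp: assoc_gr_ring_def gr_class_def single_entry_def ring_module_simps fun_eq_iff)
qed (use ring_filtration.gr_add ring.gr_smult ring_filtration.gr_carrier ring_filtration.gr_zero in
      \<open>simp_all add: assoc_gr_ring_def ring_module_simps\<close>)

lemma one_reps: "single_entry (ring_module R) 0 \<one> \<in> ring_reps"
  using J_0 by (intro ring_filtration.single_entry_reps) simp

lemma gr_ring_cring: "cring gr_A"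
proof (rule cringI)
  interpret G: abelian_group "assoc_gr (ring_module R) J"
    by (rule ring_filtration.gr_abelian_group)
  show "abelian_group gr_A"
  proof (rule abelian_groupI)
    fix f assume "f \<in> carrier gr_A"
    then show "\<exists>g\<in>carrier gr_A. g \<oplus>\<^bsub>gr_A\<^esub> f = \<zero>\<^bsub>gr_A\<^esub>"
      using G.l_neg[of f] G.a_inv_closed[of f] by (auto simp: assoc_gr_ring_def)
  qed (auto simp: assoc_gr_ring_def G.a_ac)
  show "comm_monoid gr_A"
  proof (rule comm_monoidI)
    show "\<one>\<^bsub>gr_A\<^esub> \<in> carrier gr_A"
      using one_reps by (auto simp: gr_ring_simps)
    fix f assume "f \<in> carrier gr_A"
    then obtain r where r: "r \<in> ring_reps" "f = gr_ring_class r" by (auto simp: gr_ring_simps)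
    note rR = ring_repsD(2)[OF r(1)]
    show "\<one>\<^bsub>gr_A\<^esub> \<otimes>\<^bsub>gr_A\<^esub> f = f"
      using rR ring_filtration.convolution_scalar[OF R.one_closed, of r] one_reps r
      by (simp add: gr_ring_simps ring_module_simps)
    fix g assume "g \<in> carrier gr_A"
    then obtain s where s: "s \<in> ring_reps" "g = gr_ring_class s" by (auto simp: gr_ring_simps)
    note sR = ring_repsD(2)[OF s(1)]
    show "f \<otimes>\<^bsub>gr_A\<^esub> g \<in> carrier gr_A"
      using r s ring.convolution_reps by (auto simp: gr_ring_simps)
    have "convolution (ring_module R) r s = convolution (ring_module R) s r"
      using R.convolution_comm[OF rR sR] by auto
    then show "f \<otimes>\<^bsub>gr_A\<^esub> g = g \<otimes>\<^bsub>gr_A\<^esub> f"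
      using r s by (simp add: gr_ring_simps)
    fix h assume "h \<in> carrier gr_A"
    then obtain t where t: "t \<in> ring_reps" "h = gr_ring_class t" by (auto simp: gr_ring_simps)
    note tR = ring_repsD(2)[OF t(1)]
    have "convolution (ring_module R) (convolution (ring_module R) r s) t
        = convolution (ring_module R) r (convolution (ring_module R) s t)"
      using ring_filtration.convolution_assoc[of r s t] rR sR tR by (auto simp: ring_module_simps)
    then show "(f \<otimes>\<^bsub>gr_A\<^esub> g) \<otimes>\<^bsub>gr_A\<^esub> h = f \<otimes>\<^bsub>gr_A\<^esub> (g \<otimes>\<^bsub>gr_A\<^esub> h)"
      using r s t ring.convolution_reps by (simp add: gr_ring_simps)
  qed
  fix f g h assume "f \<in> carrier gr_A" "g \<in> carrier gr_A" "h \<in> carrier gr_A"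
  then obtain r s t where *: "r \<in> ring_reps" "f = gr_ring_class r" "s \<in> ring_reps" "g = gr_ring_class s"
      "t \<in> ring_reps" "h = gr_ring_class t"
    by (auto simp: gr_ring_simps)
  have "convolution (ring_module R) (\<lambda>i. r i \<oplus> s i) t
      = (\<lambda>i. convolution (ring_module R) r t i \<oplus> convolution (ring_module R) s t i)"
    using ring_filtration.convolution_add_left[of r s t] ring_repsD(2)[OF *(1)] ring_repsD(2)[OF *(3)]
      ring_repsD(2)[OF *(5)] by (auto simp: ring_module_simps)
  moreover have "(\<lambda>i. r i \<oplus> s i) \<in> ring_reps"
    using ring_filtration.gr_reps_add[OF *(1,3)] by (simp add: ring_module_simps)
  ultimately show "(f \<oplus>\<^bsub>gr_A\<^esub> g) \<otimes>\<^bsub>gr_A\<^esub> h = f \<otimes>\<^bsub>gr_A\<^esub> h \<oplus>\<^bsub>gr_A\<^esub> g \<otimes>\<^bsub>gr_A\<^esub> h"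
    using * ring.convolution_reps by (simp add: gr_ring_simps)
qed

lemma gr_module_module: "module gr_A (assoc_gr M E)"
proof (rule moduleI[OF gr_ring_cring gr_abelian_group])
  fix f v assume "f \<in> carrier gr_A" "v \<in> carrier (assoc_gr M E)"
  then obtain r p where r: "r \<in> ring_reps" "f = gr_ring_class r"
      and p: "p \<in> gr_reps M E" "v = gr_class M E p"
    by (auto simp: gr_ring_simps gr_carrier)
  note rR = ring_repsD(2)[OF r(1)] and pM = gr_repsD(3)[OF p(1)]
  show "f \<odot>\<^bsub>assoc_gr M E\<^esub> v \<in> carrier (assoc_gr M E)"
    using r p convolution_reps by (auto simp: gr_smult gr_carrier)
  fix g assume "g \<in> carrier gr_A"
  then obtain s where s: "s \<in> ring_reps" "g = gr_ring_class s" by (auto simp: gr_ring_simps)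
  note sR = ring_repsD(2)[OF s(1)]
  have "convolution M (\<lambda>i. r i \<oplus> s i) p = (\<lambda>i. convolution M r p i \<oplus>\<^bsub>M\<^esub> convolution M s p i)"
    using convolution_add_left[of r s p] rR sR pM by auto
  moreover have "(\<lambda>i. r i \<oplus> s i) \<in> ring_reps"
    using ring_filtration.gr_reps_add[OF r(1) s(1)] by (simp add: ring_module_simps)
  ultimately show "(f \<oplus>\<^bsub>gr_A\<^esub> g) \<odot>\<^bsub>assoc_gr M E\<^esub> v
      = f \<odot>\<^bsub>assoc_gr M E\<^esub> v \<oplus>\<^bsub>assoc_gr M E\<^esub> g \<odot>\<^bsub>assoc_gr M E\<^esub> v"
    using r s p convolution_reps by (simp add: gr_ring_simps gr_smult gr_add)
  have "convolution M (convolution (ring_module R) r s) p = convolution M r (convolution M s p)"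
    using convolution_assoc[of r s p] rR sR pM by auto
  then show "(f \<otimes>\<^bsub>gr_A\<^esub> g) \<odot>\<^bsub>assoc_gr M E\<^esub> v = f \<odot>\<^bsub>assoc_gr M E\<^esub> (g \<odot>\<^bsub>assoc_gr M E\<^esub> v)"
    using r s p convolution_reps ring.convolution_reps by (simp add: gr_ring_simps gr_smult)
next
  fix f v w assume "f \<in> carrier gr_A" "v \<in> carrier (assoc_gr M E)" "w \<in> carrier (assoc_gr M E)"
  then obtain r p q where *: "r \<in> ring_reps" "f = gr_ring_class r"
      "p \<in> gr_reps M E" "v = gr_class M E p" "q \<in> gr_reps M E" "w = gr_class M E q"
    by (auto simp: gr_ring_simps gr_carrier)
  have "convolution M r (\<lambda>i. p i \<oplus>\<^bsub>M\<^esub> q i) = (\<lambda>i. convolution M r p i \<oplus>\<^bsub>M\<^esub> convolution M r q i)"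
    using convolution_add_right[of r p q] ring_repsD(2)[OF *(1)] gr_repsD(3)[OF *(3)]
      gr_repsD(3)[OF *(5)] by auto
  then show "f \<odot>\<^bsub>assoc_gr M E\<^esub> (v \<oplus>\<^bsub>assoc_gr M E\<^esub> w)
      = f \<odot>\<^bsub>assoc_gr M E\<^esub> v \<oplus>\<^bsub>assoc_gr M E\<^esub> f \<odot>\<^bsub>assoc_gr M E\<^esub> w"
    using * convolution_reps gr_reps_add by (simp add: gr_smult gr_add)
next
  fix v assume "v \<in> carrier (assoc_gr M E)"
  then obtain p where p: "p \<in> gr_reps M E" "v = gr_class M E p" by (auto simp: gr_carrier)
  show "\<one>\<^bsub>gr_A\<^esub> \<odot>\<^bsub>assoc_gr M E\<^esub> v = v"
    using p one_reps convolution_scalar[OF R.one_closed, of p] gr_repsD(3)[OF p(1)]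
    by (simp add: gr_ring_simps gr_smult)
qed

lemma gr_single_smult:
  assumes "a \<in> J i" "v \<in> E l"
  shows "gr_ring_class (single_entry (ring_module R) i a) \<odot>\<^bsub>assoc_gr M E\<^esub> gr_class M E (single_entry M l v)
    = gr_class M E (single_entry M (i + l) (a \<odot>\<^bsub>M\<^esub> v))"
  using assms ideal.Icarr[OF J_ideal] E_carrier
  by (simp add: gr_smult ring_filtration.single_entry_reps single_entry_reps convolution_single)

lemma gr_graded_module:
  "graded_module gr_A (assoc_gr M E) (gr_component (ring_module R) J) (gr_component M E) (gr_pr E)"
proof (intro graded_module.intro graded_module_axioms.intro gr_module_module)
  interpret G: module gr_A "assoc_gr M E" by (rule gr_module_module)
  show comp: "v \<in> carrier (assoc_gr M E)" if "v \<in> gr_component M E j" for v j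
    using that by (simp add: gr_component_def)
  show "a \<in> carrier gr_A" if "a \<in> gr_component (ring_module R) J j" for a j
    using that by (simp add: gr_component_def assoc_gr_ring_def)
  show "gr_pr E j v \<in> gr_component M E j" if v: "v \<in> carrier (assoc_gr M E)" for v j
  proof -
    obtain p where p: "p \<in> gr_reps M E" "v = gr_class M E p" using v by (auto simp: gr_carrier)
    have "gr_pr E j v \<in> carrier (assoc_gr M E)"
      using p gr_pr_reps by (auto simp: gr_pr_class gr_carrier)
    then show ?thesis
      by (auto simp: gr_component_def piece_simps) (auto simp: gr_pr_def)
  qed
  show "gr_pr E j (v \<oplus>\<^bsub>assoc_gr M E\<^esub> w) = gr_pr E j v \<oplus>\<^bsub>assoc_gr M E\<^esub> gr_pr E j w"
    if vw: "v \<in> carrier (assoc_gr M E)" "w \<in> carrier (assoc_gr M E)" for v w j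
  proof -
    obtain p q where p: "p \<in> gr_reps M E" "v = gr_class M E p" and q: "q \<in> gr_reps M E" "w = gr_class M E q"
      using vw by (auto simp: gr_carrier)
    have "(\<lambda>l. if int l = j then p l \<oplus>\<^bsub>M\<^esub> q l else \<zero>\<^bsub>M\<^esub>)
        = (\<lambda>l. (if int l = j then p l else \<zero>\<^bsub>M\<^esub>) \<oplus>\<^bsub>M\<^esub> (if int l = j then q l else \<zero>\<^bsub>M\<^esub>))"
      by auto
    then show ?thesis
      using p q gr_pr_reps by (simp add: gr_add gr_pr_class)
  qed
  show "gr_pr E i v = (if i = j then v else \<zero>\<^bsub>assoc_gr M E\<^esub>)" if v: "v \<in> gr_component M E j" for v i j
    using v by (auto simp: gr_component_def gr_pr_def gr_zero gr_class_zero piece_simps fun_eq_iff)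
  show "finite {j. gr_pr E j v \<noteq> \<zero>\<^bsub>assoc_gr M E\<^esub>}" if v: "v \<in> carrier (assoc_gr M E)" for v
  proof -
    obtain p where p: "p \<in> gr_reps M E" "v = gr_class M E p" using v by (auto simp: gr_carrier)
    have "{j. gr_pr E j v \<noteq> \<zero>\<^bsub>assoc_gr M E\<^esub>} \<subseteq> int ` {l. p l \<noteq> \<zero>\<^bsub>M\<^esub>}"
    proof
      fix j assume "j \<in> {j. gr_pr E j v \<noteq> \<zero>\<^bsub>assoc_gr M E\<^esub>}"
      then have "(\<lambda>l. if int l = j then p l else \<zero>\<^bsub>M\<^esub>) \<noteq> (\<lambda>_. \<zero>\<^bsub>M\<^esub>)"
        unfolding p(2) gr_pr_class gr_zero by auto
      then show "j \<in> int ` {l. p l \<noteq> \<zero>\<^bsub>M\<^esub>}"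
        by (auto simp: fun_eq_iff split: if_splits)
    qed
    then show ?thesis
      using gr_repsD(2)[OF p(1)] by (auto intro: finite_subset)
  qed
  show "v = \<zero>\<^bsub>assoc_gr M E\<^esub>"
    if v: "v \<in> carrier (assoc_gr M E)" "\<And>j. gr_pr E j v = \<zero>\<^bsub>assoc_gr M E\<^esub>" for v
  proof
    fix l show "v l = \<zero>\<^bsub>assoc_gr M E\<^esub> l"
      using fun_cong[OF v(2)[of "int l"], of l] by (simp add: gr_pr_def)
  qed
  show "a \<odot>\<^bsub>assoc_gr M E\<^esub> v \<in> gr_component M E (i + j)"
    if av: "a \<in> gr_component (ring_module R) J i" "v \<in> gr_component M E j" for a v i j
  proof (cases "i < 0 \<or> j < 0")
    case True
    then have "a = \<zero>\<^bsub>gr_A\<^esub> \<or> v = \<zero>\<^bsub>assoc_gr M E\<^esub>"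
      using av gr_component_negative ring_filtration.gr_component_negative by (auto simp: assoc_gr_ring_def)
    moreover have "a \<in> carrier gr_A" "v \<in> carrier (assoc_gr M E)"
      using av by (simp_all add: gr_component_def assoc_gr_ring_def)
    ultimately have "a \<odot>\<^bsub>assoc_gr M E\<^esub> v = \<zero>\<^bsub>assoc_gr M E\<^esub>"
      by auto
    then show ?thesis
      using G.M.zero_closed by (simp add: gr_component_def) (simp add: gr_zero gr_class_zero piece_simps)
  next
    case False
    then obtain k l where kl: "i = int k" "j = int l"
      by (metis not_less zero_le_imp_eq_int)
    then obtain b w where "b \<in> J k" "a = gr_ring_class (single_entry (ring_module R) k b)"
        "w \<in> E l" "v = gr_class M E (single_entry M l w)"
      using av by (auto simp: gr_component_single ring_filtration.gr_component_single)
    then show ?thesis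
      using J_smult gr_component_single[of "k + l"] unfolding kl
      by (auto simp: gr_single_smult)
  qed
qed

lemma gr_graded_cring: "graded_cring gr_A (gr_component (ring_module R) J) (gr_pr J)"
proof (intro graded_cring.intro graded_cring_axioms.intro gr_ring_cring)
  show "graded_module gr_A (ring_module gr_A) (gr_component (ring_module R) J)
      (gr_component (ring_module R) J) (gr_pr J)"
    unfolding ring_module_assoc_gr_ring by (rule graded_action.gr_graded_module[OF ring_action])
  show "\<one>\<^bsub>gr_A\<^esub> \<in> gr_component (ring_module R) J 0"
    using ring_filtration.gr_component_single[of 0] J_0 by (simp add: gr_ring_simps)
qed

end

section \<open>Regularity over rings with a Conca generator\<close>

context conca_ring
begin

lemma adic_action:
  assumes N: "module R N"
  shows "graded_action R N (ideal_power R \<mm>) (adic_filtration R N)"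
proof -
  interpret N: module R N by (rule N)
  let ?J = "ideal_power R \<mm>"
  have JR: "?J i \<subseteq> carrier R" for i
    using ideal.Icarr[OF ideal_power_ideal[OF m_ideal]] by auto
  have E: "adic_filtration R N i = N.smult_span (?J i) (carrier N)" for i
    by (simp add: adic_filtration_def max_ideal_eq N.ideal_smult_eq)
  have sub: "submodule (adic_filtration R N i) R N" for i
    unfolding E by (rule N.smult_span_submodule[OF JR subset_refl])
  show ?thesis
  proof (intro graded_action.intro filtration.intro filtration_axioms.intro
      graded_action_axioms.intro N sub ideal_power_ideal[OF m_ideal] ideal_power_Suc_subset[OF m_ideal])
    show "adic_filtration R N (Suc i) \<subseteq> adic_filtration R N i" for i
      unfolding E by (intro N.smult_span_mono ideal_power_Suc_subset[OF m_ideal] subset_refl)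
    show "a \<otimes> b \<in> ?J (i + l)" if "a \<in> ?J i" "b \<in> ?J l" for a b i l
      using that by (rule ideal_power_mult[OF m_ideal])
    fix a v i l assume a: "a \<in> ?J i" and v: "v \<in> adic_filtration R N l"
    interpret a: linear_map R N N "\<lambda>v. a \<odot>\<^bsub>N\<^esub> v"
      using JR a by (intro N.smult_linear_map) auto
    have "adic_filtration R N l \<subseteq> {v \<in> carrier N. a \<odot>\<^bsub>N\<^esub> v \<in> adic_filtration R N (i + l)}"
      unfolding E[of l]
    proof (rule N.smult_span_least[OF a.preimage_submodule[OF sub]])
      fix b w assume b: "b \<in> ?J l" and w: "w \<in> carrier N"
      have "a \<odot>\<^bsub>N\<^esub> (b \<odot>\<^bsub>N\<^esub> w) = (a \<otimes> b) \<odot>\<^bsub>N\<^esub> w"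
        using a b w JR by (intro N.smult_assoc1[symmetric]) auto
      then show "b \<odot>\<^bsub>N\<^esub> w \<in> {v \<in> carrier N. a \<odot>\<^bsub>N\<^esub> v \<in> adic_filtration R N (i + l)}"
        using N.smult_span_memI[OF ideal_power_mult[OF m_ideal a b] w] b w JR
        by (auto simp: E)
    qed
    then show "a \<odot>\<^bsub>N\<^esub> v \<in> adic_filtration R N (i + l)"
      using v by blast
  qed simp
qed

text \<open>For \<open>l = 2\<close> this is \<open>\<mm>\<^sup>2 \<subseteq> x\<mm>\<close>;
  for \<open>l \<ge> 3\<close> one has \<open>\<mm>\<^sup>l = 0\<close>, and \<open>c = 0\<close> works.\<close>

lemma power_generated:
  assumes "2 \<le> l" "a \<in> ideal_power R \<mm> l"
  shows "\<exists>c\<in>ideal_power R \<mm> (l - 1). a = x \<otimes> c"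
proof (cases "l = 2")
  case True
  then show ?thesis
    using power2_mem[of a] assms(2) ideal_power_1[OF m_ideal] by (auto simp: numeral_2_eq_2 simp del: ideal_power.simps)
next
  case False
  then have "a = \<zero>"
    using power3_zero[of l a] assms by simp
  moreover have "\<zero> \<in> ideal_power R \<mm> (l - 1)"
    using additive_subgroup.zero_closed[OF ideal.axioms(1)[OF ideal_power_ideal[OF m_ideal]]] .
  ultimately show ?thesis
    using x_carrier by (intro bexI[of _ \<zero>]) auto
qed

lemma gr_ring_eq: "gr_ring R = assoc_gr_ring R (ideal_power R \<mm>)"
  by (simp add: gr_ring_def assoc_gr_ring_def Let_def max_ideal_eq)

lemma gr_ring_component_eq: "gr_ring_component R = gr_component (ring_module R) (ideal_power R \<mm>)"
  by (simp add: gr_ring_component_def max_ideal_eq)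

interpretation J: graded_action R "ring_module R" "ideal_power R \<mm>" "ideal_power R \<mm>"
  by (rule graded_action.ring_action[OF adic_action[OF ring_module_module]])

text \<open>Since \<open>\<mm>\<^sup>3 = 0\<close>, sequences of representatives are elements of \<open>R\<^sup>3\<close>. The representatives of an
  ideal of the associated graded ring form a submodule of \<open>R\<^sup>3\<close>, which is finitely generated.\<close>

lemma noetherian_gr_ring: "noetherian_ring (gr_ring R)"
proof -
  let ?J = "ideal_power R \<mm>" and ?A = "gr_ring R"
  let ?cl = "gr_class (ring_module R) ?J" and ?reps = "gr_reps (ring_module R) ?J"
  note simps = J.gr_ring_simps[folded gr_ring_eq]
  interpret A: cring ?A
    unfolding gr_ring_eq by (rule J.gr_ring_cring)
  interpret F: module R "free_module R 3" by (rule free_module_module)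
  have reps: "p \<in> carrier (free_module R 3)" if "p \<in> ?reps" for p
    using J.ring_repsD[OF that] power3_zero by (auto simp: free_module_mem)
  have scalar: "?cl (single_entry (ring_module R) 0 a) \<in> carrier ?A"
      "?cl (single_entry (ring_module R) 0 a) \<otimes>\<^bsub>?A\<^esub> ?cl p = ?cl (\<lambda>i. a \<otimes> p i)"
    if "a \<in> carrier R" "p \<in> ?reps" for a p
  proof -
    have *: "single_entry (ring_module R) 0 a \<in> ?reps"
      using that(1) by (intro J.single_entry_reps) simp
    then show "?cl (single_entry (ring_module R) 0 a) \<in> carrier ?A"
      by (simp add: simps)
    show "?cl (single_entry (ring_module R) 0 a) \<otimes>\<^bsub>?A\<^esub> ?cl p = ?cl (\<lambda>i. a \<otimes> p i)"
      using J.convolution_scalar[OF that(1), of p] J.ring_repsD(2)[OF that(2)] * that(2)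
      by (simp add: simps ring_module_simps)
  qed
  have pullback: "submodule {p \<in> ?reps. ?cl p \<in> I} R (free_module R 3)" if I: "ideal I ?A" for I
  proof -
    interpret I: ideal I ?A by (rule I)
    show ?thesis
    proof (rule F.submoduleI')
      show "{p \<in> ?reps. ?cl p \<in> I} \<subseteq> carrier (free_module R 3)"
        using reps by auto
      show "\<zero>\<^bsub>free_module R 3\<^esub> \<in> {p \<in> ?reps. ?cl p \<in> I}"
        using I.zero_closed J.gr_reps_zero by (simp add: simps free_module_simps ring_module_simps)
    next
      fix p q assume "p \<in> {p \<in> ?reps. ?cl p \<in> I}" "q \<in> {p \<in> ?reps. ?cl p \<in> I}"
      then show "p \<oplus>\<^bsub>free_module R 3\<^esub> q \<in> {p \<in> ?reps. ?cl p \<in> I}"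
        using I.a_closed[of "?cl p" "?cl q"] J.gr_reps_add[of p q]
        by (simp add: simps free_module_simps ring_module_simps)
    next
      fix a p assume a: "a \<in> carrier R" and p: "p \<in> {p \<in> ?reps. ?cl p \<in> I}"
      have "(\<lambda>i. a \<otimes> p i) \<in> ?reps"
        using J.gr_reps_smult[OF a, of p] p by (simp add: ring_module_simps)
      then show "a \<odot>\<^bsub>free_module R 3\<^esub> p \<in> {p \<in> ?reps. ?cl p \<in> I}"
        using I.I_l_closed[of "?cl p"] scalar[OF a, of p] p by (simp add: free_module_simps) metis
    qed
  qed
  show ?thesis
  proof (rule A.noetherian_ringI)
    fix I assume I: "ideal I ?A"
    obtain S where S: "S \<subseteq> {p \<in> ?reps. ?cl p \<in> I}" "finite S"
        "span_of R (free_module R 3) S = {p \<in> ?reps. ?cl p \<in> I}"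
      using noetherian_free_module[OF noetherian pullback[OF I]] by auto
    have clS: "?cl ` S \<subseteq> I" "?cl ` S \<subseteq> carrier ?A"
      using S(1) by (auto simp: simps)
    have "I \<subseteq> Idl\<^bsub>?A\<^esub> (?cl ` S)"
    proof
      fix f assume f: "f \<in> I"
      then obtain p where p: "p \<in> ?reps" "f = ?cl p"
        using ideal.Icarr[OF I f] by (auto simp: simps)
      have "span_of R (free_module R 3) S \<subseteq> {p \<in> ?reps. ?cl p \<in> Idl\<^bsub>?A\<^esub> (?cl ` S)}"
        using S(1) A.genideal_self[OF clS(2)]
        by (intro F.span_of_least pullback A.genideal_ideal clS(2)) auto
      then show "f \<in> Idl\<^bsub>?A\<^esub> (?cl ` S)"
        using f p S(3) by auto
    qed
    then show "\<exists>S\<subseteq>carrier ?A. finite S \<and> I = Idl\<^bsub>?A\<^esub> S"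
      using A.genideal_minimal[OF I clS(1)] clS(2) S(2) by (intro exI[of _ "?cl ` S"]) auto
  qed
qed

text \<open>The class of \<open>x\<close> in degree \<open>1\<close> inherits the relations \<open>x\<^sup>2 = 0\<close> and \<open>\<mm>\<^sup>l \<subseteq> x\<mm>\<^sup>l\<^sup>-\<^sup>1\<close>.\<close>

lemma gr_graded_conca_ring:
  "graded_conca_ring (gr_ring R) (gr_ring_component R) (gr_pr (ideal_power R \<mm>))
     (gr_class (ring_module R) (ideal_power R \<mm>) (single_entry (ring_module R) 1 x))"
proof (intro graded_conca_ring.intro graded_conca_ring_axioms.intro noetherian_gr_ring)
  let ?J = "ideal_power R \<mm>" and ?A = "gr_ring R"
  let ?cl = "gr_class (ring_module R) ?J" and ?e = "single_entry (ring_module R)"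
  note simps = J.gr_ring_simps[folded gr_ring_eq]
  show "graded_cring ?A (gr_ring_component R) (gr_pr ?J)"
    unfolding gr_ring_eq gr_ring_component_eq by (rule J.gr_graded_cring)
  have xJ: "x \<in> ?J 1"
    using x_mem ideal_power_1[OF m_ideal] by simp
  have mult: "?cl (?e 1 x) \<otimes>\<^bsub>?A\<^esub> ?cl (?e l a) = ?cl (?e (1 + l) (x \<otimes> a))" if "a \<in> ?J l" for l a
    using J.gr_single_smult[OF xJ that] by (simp add: gr_ring_eq assoc_gr_ring_def ring_module_simps)
  show "?cl (?e 1 x) \<in> gr_ring_component R 1"
    using J.gr_component_single[of 1] xJ by (simp add: gr_ring_component_eq)
  have "?e l \<zero> = (\<lambda>_. \<zero>)" for l
    by (auto simp: single_entry_def ring_module_simps)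
  then show "?cl (?e 1 x) \<otimes>\<^bsub>?A\<^esub> ?cl (?e 1 x) = \<zero>\<^bsub>?A\<^esub>"
    using mult[OF xJ] x_square by (simp add: simps)
  fix j u assume j: "2 \<le> j" and u: "u \<in> gr_ring_component R j"
  obtain k where k: "j = int k"
    using j by (metis zero_le_imp_eq_int order.trans zero_le_numeral)
  then obtain l where "k = Suc l" "1 \<le> l"
    using j by (cases k) auto
  with k have l: "j = int (Suc l)" "1 \<le> l"
    by auto
  then obtain a where a: "a \<in> ?J (Suc l)" "u = ?cl (?e (Suc l) a)"
    using u by (auto simp: gr_ring_component_eq J.gr_component_single simp del: of_nat_Suc)
  obtain c where c: "c \<in> ?J l" "a = x \<otimes> c"
    using power_generated[OF _ a(1)] l(2) by auto
  have "u = ?cl (?e 1 x) \<otimes>\<^bsub>?A\<^esub> ?cl (?e l c)"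
    using mult[OF c(1)] a(2) c(2) by simp
  moreover have "?cl (?e l c) \<in> gr_ring_component R (j - 1)"
    using c(1) l(1) J.gr_component_single[of l] by (simp add: gr_ring_component_eq)
  ultimately show "\<exists>w\<in>gr_ring_component R (j - 1). u = ?cl (?e 1 x) \<otimes>\<^bsub>?A\<^esub> w"
    by blast
qed

text \<open>The associated graded module is generated by the classes in degree \<open>0\<close> of a finite generating
  set of \<open>N\<close>, and \<open>\<mm>\<^sup>lN \<subseteq> x\<mm>\<^sup>l\<^sup>-\<^sup>1N\<close> for \<open>l \<ge> 2\<close>.\<close>

lemma regularity_le_1:
  assumes fg: "fg_module R N"
  shows "regularity R N \<le> 1"
proof -
  have N: "module R N" using fg by (simp add: fg_module_def)
  let ?J = "ideal_power R \<mm>"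
  define E where "E = adic_filtration R N"
  interpret N: graded_action R N ?J E
    unfolding E_def by (rule adic_action[OF N])
  let ?A = "gr_ring R" and ?G = "gr_module R N"
  let ?clA = "gr_class (ring_module R) ?J" and ?eA = "single_entry (ring_module R)"
  let ?cl = "gr_class N E" and ?e = "single_entry N"
  interpret A: graded_conca_ring ?A "gr_ring_component R" "gr_pr ?J" "?clA (?eA 1 x)"
    by (rule gr_graded_conca_ring)
  have G: "?G = assoc_gr N E"
    by (simp add: gr_module_def E_def)
  have comp: "gr_module_component R N = gr_component N E"
    by (simp add: gr_module_component_def E_def)
  have graded: "graded_module ?A ?G (gr_ring_component R) (gr_module_component R N) (gr_pr E)"
    unfolding G comp gr_ring_component_eq gr_ring_eq by (rule N.gr_graded_module)
  interpret G: graded_module ?A ?G "gr_ring_component R" "gr_module_component R N" "gr_pr E"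
    by (rule graded)
  have E_eq: "E l = N.smult_span (?J l) (carrier N)" for l
    by (simp add: E_def adic_filtration_def max_ideal_eq N.ideal_smult_eq)
  have E0: "E 0 = carrier N"
  proof
    show "carrier N \<subseteq> E 0"
    proof
      fix v assume "v \<in> carrier N"
      then show "v \<in> E 0"
        using N.smult_span_memI[of \<one> "?J 0" v "carrier N"] by (simp add: E_eq)
    qed
  qed (use N.E_carrier in auto)
  have JR: "?J l \<subseteq> carrier R" for l
    using ideal.Icarr[OF ideal_power_ideal[OF m_ideal]] by auto
  have act: "?clA (?eA i a) \<odot>\<^bsub>?G\<^esub> ?cl (?e l v) = ?cl (?e (i + l) (a \<odot>\<^bsub>N\<^esub> v))"
    if "a \<in> ?J i" "v \<in> E l" for a i l v
    unfolding G by (rule N.gr_single_smult[OF that])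
  have eA: "?clA (?eA i a) \<in> carrier ?A" if "a \<in> ?J i" for a i
    unfolding gr_ring_eq using that J.single_entry_reps by (simp add: J.gr_ring_simps)
  have add: "?cl (?e l u) \<oplus>\<^bsub>?G\<^esub> ?cl (?e l v) = ?cl (?e l (u \<oplus>\<^bsub>N\<^esub> v))" if "u \<in> E l" "v \<in> E l" for l u v
  proof -
    have "(\<lambda>i. ?e l u i \<oplus>\<^bsub>N\<^esub> ?e l v i) = ?e l (u \<oplus>\<^bsub>N\<^esub> v)"
      by (auto simp: single_entry_def)
    then show ?thesis
      unfolding G using N.gr_add[OF N.single_entry_reps[OF that(1)] N.single_entry_reps[OF that(2)]] by simp
  qed
  have zero: "?cl (?e l \<zero>\<^bsub>N\<^esub>) = \<zero>\<^bsub>?G\<^esub>" for l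
    unfolding G N.gr_zero by (rule arg_cong[where f = ?cl]) (auto simp: single_entry_def)
  obtain S where S: "S \<subseteq> carrier N" "finite S" "span_of R N S = carrier N"
    using fg by (auto simp: fg_module_def)
  let ?S = "(\<lambda>v. ?cl (?e 0 v)) ` S"
  have comp_single: "gr_module_component R N (int l) = (\<lambda>v. ?cl (?e l v)) ` E l" for l
    unfolding comp by (rule N.gr_component_single)
  have S0: "?S \<subseteq> gr_module_component R N 0"
    using comp_single[of 0] S(1) E0 by auto
  \<comment> \<open>A product \<open>av\<close> with \<open>a \<in> \<mm>\<^sup>l\<close> has the class \<open>[a][v]\<close> in degree \<open>l\<close>, so for fixed \<open>a\<close> it suffices
    to treat generators \<open>v\<close>; these products generate \<open>\<mm>\<^sup>lN\<close>.\<close>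
  have span: "span_of ?A ?G ?S = carrier ?G"
  proof
    have SG: "?S \<subseteq> carrier ?G"
      using S0 G.NG_carrier by blast
    note H = G.span_of_submodule[OF SG]
    note HD = G.submoduleD[OF H]
    show "span_of ?A ?G ?S \<subseteq> carrier ?G" by (rule HD(1))
    have single: "?cl (?e l u) \<in> span_of ?A ?G ?S" if u: "u \<in> E l" for l u
    proof -
      have gen: "?cl (?e l (a \<odot>\<^bsub>N\<^esub> v)) \<in> span_of ?A ?G ?S" if a: "a \<in> ?J l" and v: "v \<in> carrier N" for a v
      proof -
        have aR: "a \<in> carrier R" using a JR by auto
        have aE: "a \<odot>\<^bsub>N\<^esub> w \<in> E l" if "w \<in> carrier N" for w
          using N.J_smult[OF a, of w 0] that E0 by simp
        have "submodule {w \<in> carrier N. ?cl (?e l (a \<odot>\<^bsub>N\<^esub> w)) \<in> span_of ?A ?G ?S} R N"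
        proof (rule N.submoduleI')
          show "\<zero>\<^bsub>N\<^esub> \<in> {w \<in> carrier N. ?cl (?e l (a \<odot>\<^bsub>N\<^esub> w)) \<in> span_of ?A ?G ?S}"
            using aR zero HD(2) by simp
        next
          fix w w' assume w: "w \<in> {w \<in> carrier N. ?cl (?e l (a \<odot>\<^bsub>N\<^esub> w)) \<in> span_of ?A ?G ?S}"
            and w': "w' \<in> {w \<in> carrier N. ?cl (?e l (a \<odot>\<^bsub>N\<^esub> w)) \<in> span_of ?A ?G ?S}"
          then show "w \<oplus>\<^bsub>N\<^esub> w' \<in> {w \<in> carrier N. ?cl (?e l (a \<odot>\<^bsub>N\<^esub> w)) \<in> span_of ?A ?G ?S}"
            using HD(3) add[OF aE[of w] aE[of w']] aR by (simp add: N.smult_r_distr) metis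
        next
          fix r w assume r: "r \<in> carrier R" and w: "w \<in> {w \<in> carrier N. ?cl (?e l (a \<odot>\<^bsub>N\<^esub> w)) \<in> span_of ?A ?G ?S}"
          have "a \<odot>\<^bsub>N\<^esub> (r \<odot>\<^bsub>N\<^esub> w) = r \<odot>\<^bsub>N\<^esub> (a \<odot>\<^bsub>N\<^esub> w)"
            using r w aR by (simp add: m_comm flip: N.smult_assoc1)
          moreover have "?clA (?eA 0 r) \<odot>\<^bsub>?G\<^esub> ?cl (?e l (a \<odot>\<^bsub>N\<^esub> w)) \<in> span_of ?A ?G ?S"
            using HD(5) eA[of r 0] r w by simp
          ultimately show "r \<odot>\<^bsub>N\<^esub> w \<in> {w \<in> carrier N. ?cl (?e l (a \<odot>\<^bsub>N\<^esub> w)) \<in> span_of ?A ?G ?S}"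
            using act[of r 0 "a \<odot>\<^bsub>N\<^esub> w" l] aE w r by simp
        qed auto
        moreover have "S \<subseteq> {w \<in> carrier N. ?cl (?e l (a \<odot>\<^bsub>N\<^esub> w)) \<in> span_of ?A ?G ?S}"
        proof
          fix w assume w: "w \<in> S"
          have "?clA (?eA l a) \<odot>\<^bsub>?G\<^esub> ?cl (?e 0 w) \<in> span_of ?A ?G ?S"
            using HD(5)[OF eA[OF a]] G.span_of_superset[of ?S] w by blast
          then show "w \<in> {w \<in> carrier N. ?cl (?e l (a \<odot>\<^bsub>N\<^esub> w)) \<in> span_of ?A ?G ?S}"
            using act[OF a, of w 0] w S(1) E0 by auto
        qed
        ultimately have "span_of R N S \<subseteq> {w \<in> carrier N. ?cl (?e l (a \<odot>\<^bsub>N\<^esub> w)) \<in> span_of ?A ?G ?S}"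
          by (rule N.span_of_least)
        then show ?thesis
          using v S(3) by blast
      qed
      have "submodule {u \<in> E l. ?cl (?e l u) \<in> span_of ?A ?G ?S} R N"
      proof (rule N.submoduleI')
        show "{u \<in> E l. ?cl (?e l u) \<in> span_of ?A ?G ?S} \<subseteq> carrier N"
          using N.E_carrier by auto
        show "\<zero>\<^bsub>N\<^esub> \<in> {u \<in> E l. ?cl (?e l u) \<in> span_of ?A ?G ?S}"
          using N.E_zero zero HD(2) by simp
      next
        fix w w' assume "w \<in> {u \<in> E l. ?cl (?e l u) \<in> span_of ?A ?G ?S}"
          "w' \<in> {u \<in> E l. ?cl (?e l u) \<in> span_of ?A ?G ?S}"
        then show "w \<oplus>\<^bsub>N\<^esub> w' \<in> {u \<in> E l. ?cl (?e l u) \<in> span_of ?A ?G ?S}"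
          using HD(3) add[of w l w'] N.E_add by simp metis
      next
        fix r w assume r: "r \<in> carrier R" and w: "w \<in> {u \<in> E l. ?cl (?e l u) \<in> span_of ?A ?G ?S}"
        have "?clA (?eA 0 r) \<odot>\<^bsub>?G\<^esub> ?cl (?e l w) \<in> span_of ?A ?G ?S"
          using HD(5) eA[of r 0] r w by simp
        then show "r \<odot>\<^bsub>N\<^esub> w \<in> {u \<in> E l. ?cl (?e l u) \<in> span_of ?A ?G ?S}"
          using act[of r 0 w l] w r N.E_smult by simp
      qed
      then have "N.smult_span (?J l) (carrier N) \<subseteq> {u \<in> E l. ?cl (?e l u) \<in> span_of ?A ?G ?S}"
        using gen N.smult_span_memI[of _ "?J l" _ "carrier N"] by (intro N.smult_span_least) (auto simp: E_eq)
      then show ?thesis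
        using u unfolding E_eq by blast
    qed
    show "carrier ?G \<subseteq> span_of ?A ?G ?S"
    proof
      fix f assume f: "f \<in> carrier ?G"
      show "f \<in> span_of ?A ?G ?S"
      proof (rule G.mem_of_components[OF HD(2,3) f])
        fix j
        have pr: "gr_pr E j f \<in> gr_module_component R N j"
          by (rule G.pr_mem[OF f])
        show "gr_pr E j f \<in> span_of ?A ?G ?S"
        proof (cases "j < 0")
          case True
          then show ?thesis
            using pr N.gr_component_negative[of j] HD(2) by (simp add: comp G)
        next
          case False
          then obtain l where "j = int l"
            by (metis not_less zero_le_imp_eq_int)
          then show ?thesis
            using pr single comp_single[of l] by auto
        qed
      qed
    qed
  qed
  have gen: "\<exists>w\<in>gr_module_component R N (j - 1). v = ?clA (?eA 1 x) \<odot>\<^bsub>?G\<^esub> w"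
    if j: "2 \<le> j" and v: "v \<in> gr_module_component R N j" for j v
  proof -
    obtain k where k: "j = int k"
      using j by (metis zero_le_imp_eq_int order.trans zero_le_numeral)
    then obtain l where l: "k = Suc l" "1 \<le> l"
      using j by (cases k) auto
    obtain u where u: "u \<in> E (Suc l)" "v = ?cl (?e (Suc l) u)"
      using v comp_single[of k] unfolding k l(1) by auto
    interpret x: linear_map R N N "\<lambda>v. x \<odot>\<^bsub>N\<^esub> v"
      by (rule N.smult_linear_map[OF x_carrier])
    have "E (Suc l) \<subseteq> (\<lambda>v. x \<odot>\<^bsub>N\<^esub> v) ` E l"
      unfolding E_eq[of "Suc l"]
    proof (rule N.smult_span_least[OF x.image_submodule[OF N.E_submodule]])
      fix a w assume a: "a \<in> ?J (Suc l)" and w: "w \<in> carrier N"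
      obtain c where c: "c \<in> ?J l" "a = x \<otimes> c"
        using power_generated[OF _ a] l(2) by auto
      then have "a \<odot>\<^bsub>N\<^esub> w = x \<odot>\<^bsub>N\<^esub> (c \<odot>\<^bsub>N\<^esub> w)"
        using x_carrier JR w by (auto intro: N.smult_assoc1)
      then show "a \<odot>\<^bsub>N\<^esub> w \<in> (\<lambda>v. x \<odot>\<^bsub>N\<^esub> v) ` E l"
        using N.smult_span_memI[OF c(1) w] by (auto simp: E_eq)
    qed
    then obtain w where w: "w \<in> E l" "u = x \<odot>\<^bsub>N\<^esub> w"
      using u(1) by auto
    have "x \<in> ?J 1"
      using x_mem ideal_power_1[OF m_ideal] by simp
    from act[OF this w(1)] have "v = ?clA (?eA 1 x) \<odot>\<^bsub>?G\<^esub> ?cl (?e l w)"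
      using u(2) w(2) by simp
    moreover have "?cl (?e l w) \<in> gr_module_component R N (j - 1)"
      using comp_single[of l] w(1) k l(1) by auto
    ultimately show ?thesis by blast
  qed
  show ?thesis
    unfolding regularity_def
    by (rule A.graded_regularity_le_1[OF graded S0 finite_imageI[OF S(2)] span gen])
qed

end

theorem theorem2p13:
  fixes R :: "('a, 'r) ring_scheme" and M :: "('a, 'b, 'm) module_scheme" and x :: 'a
  assumes "local_noetherian_ring R"
    and "conca_generator R x"
    and "fg_module R M"
  shows "((\<forall>v\<in>carrier M. x \<odot>\<^bsub>M\<^esub> v = \<zero>\<^bsub>M\<^esub>) \<longrightarrow> koszul_module R M) \<and>
         regularity R M \<le> 1 \<and>
         koszul_module R (M\<lparr>carrier := ideal_smult R (max_ideal R) M\<rparr>) \<and>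
         (\<forall>I. ideal I R \<and> I \<noteq> carrier R \<longrightarrow> koszul_ring (R Quot I))"
proof -
  interpret conca_ring R "max_ideal R" x
    by (rule conca_generator_conca_ring[OF assms(1,2)])
  have M: "module R M"
    using assms(3) by (simp add: fg_module_def)
  show ?thesis
  proof (intro conjI allI impI)
    assume "\<forall>v\<in>carrier M. x \<odot>\<^bsub>M\<^esub> v = \<zero>\<^bsub>M\<^esub>"
    then show "koszul_module R M"
      using conca_filtered_koszul[OF assms(3)] conca_filtered_if_annihilated[OF M] by blast
  next
    show "regularity R M \<le> 1"
      by (rule regularity_le_1[OF assms(3)])
    show "koszul_module R (M\<lparr>carrier := ideal_smult R (max_ideal R) M\<rparr>)"
      by (rule conca_filtered_koszul[OF fg_module_m_smult[OF assms(3)] conca_filtered_m_smult[OF M]])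
  next
    fix I assume "ideal I R \<and> I \<noteq> carrier R"
    then show "koszul_ring (R Quot I)"
      using conca_ring.koszul_ring[OF quotient_conca_ring] by blast
  qed
qed

end
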